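(* In the Hill problem, for every $n\in\mathbb{N}$ (with $n\ge1$) there exists $\hat K(n)>0$ such that for every $K\ge\hat K(n)$ there exist exactly four $n$-ejection-collision orbits ($n$-EC orbits) with first integral equal to $K$, which can be characterized by: (i) two $n$-EC orbits, each itself symmetric with respect to the $x_h$ axis, and one symmetric to the other with respect to the $y_h$ axis; (ii) two $n$-EC orbits, each itself symmetric with respect to the $y_h$ axis, and one symmetric to the other with respect to the $x_h$ axis. The respective families (when varying $K$) are labelled $\alpha_n,\gamma_n$ (those in (i)) and $\beta_n,\delta_n$ (those in (ii)).
   Context: Hill problem: the particle $(x_h(t),y_h(t))$ satisfies $$\ddot x_h-2\dot y_h=\Psi_{x_h},\qquad \ddot y_h+2\dot x_h=\Psi_{y_h},\qquad \Psi(x_h,y_h)=\tfrac32x_h^2+\frac{1}{\sqrt{x_h^2+y_h^2}},$$ with first integral $K=2\Psi(x_h,y_h)-\dot x_h^2-\dot y_h^2$. The primary $P_h$ is at the origin. Collisions with $P_h$ are regularized by the Levi-Civita change $x_h=u_h^2-v_h^2$, $y_h=2u_hv_h$, $dt/ds=4(u_h^2+v_h^2)$; for fixed $K$ the regularized equations are ($'=d/ds$) $$u_h''-8(u_h^2+v_h^2)v_h'=\partial_{u_h}\big(4(u_h^2+v_h^2)\,\mathcal U_h\big),\quad v_h''+8(u_h^2+v_h^2)u_h'=\partial_{v_h}\big(4(u_h^2+v_h^2)\,\mathcal U_h\big),$$ $$\mathcal U_h=\tfrac32(u_h^2-v_h^2)^2+\frac1{u_h^2+v_h^2}-\frac K2,$$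 with $u_h'^2+v_h'^2=8(u_h^2+v_h^2)\,\mathcal U_h$, so $u_h'^2+v_h'^2=8$ at $u_h=v_h=0$. Ejection orbits are the solutions starting at $u_h=v_h=0$; $(u_h,v_h)$ and $(-u_h,-v_h)$ represent the same point of the $(x_h,y_h)$ plane, and orbits are counted in the $(x_h,y_h)$ plane. An $n$-EC orbit is the orbit described by a particle that ejects from $P_h$ (starts at collision with $P_h$) and whose distance to $P_h$ reaches $n$ times a relative maximum before the particle collides with $P_h$. Symmetries of orbits refer to their projections to the $(x_h,y_h)$ plane. *)

theory Defs
  imports "HOL-Analysis.Analysis"
begin

definition hill_Psi :: "real \<Rightarrow> real \<Rightarrow> real" where
  "hill_Psi x y = 3/2 * x^2 + 1 / sqrt (x^2 + y^2)"

definition levi_civita :: "real \<Rightarrow> real \<Rightarrow> real \<times> real" where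
  "levi_civita u v = (u^2 - v^2, 2 * u * v)"

definition hill_U :: "real \<Rightarrow> real \<Rightarrow> real \<Rightarrow> real" where
  "hill_U K u v = 3/2 * (u^2 - v^2)^2 + 1 / (u^2 + v^2) - K/2"

(* This is 4 * (u^2 + v^2) * hill_U K u v with the removable singularity at the origin
   removed. The unsimplified product would take the value 0 there, since 1 / 0 = 0, and
   would not be differentiable. *)
definition hill_W :: "real \<Rightarrow> real \<Rightarrow> real \<Rightarrow> real" where
  "hill_W K u v = 6 * (u^2 + v^2) * (u^2 - v^2)^2 + 4 - 2 * K * (u^2 + v^2)"

lemma hill_U_eq_Psi: "hill_U K u v = case_prod hill_Psi (levi_civita u v) - K/2"
proof -
  have "(u^2 - v^2)^2 + (2 * u * v)^2 = (u^2 + v^2)^2"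
    by (simp add: power2_eq_square algebra_simps)
  then show ?thesis by (simp add: hill_U_def hill_Psi_def levi_civita_def)
qed

lemma hill_W_eq: "(u, v) \<noteq> (0, 0) \<Longrightarrow> hill_W K u v = 4 * (u^2 + v^2) * hill_U K u v"
proof -
  assume "(u, v) \<noteq> (0, 0)"
  then have "u^2 + v^2 \<noteq> 0" by (simp add: sum_power2_eq_zero_iff)
  then have "(u^2 + v^2) * (1 / (u^2 + v^2)) = 1" by simp
  then show ?thesis unfolding hill_W_def hill_U_def by algebra
qed

(* A solution of the Levi-Civita regularized equations on [0, S], in the regularized time s;
   derivatives at 0 and S are one-sided. The last conjunct fixes the value K of the first
   integral. *)
definition hill_reg_solution :: "real \<Rightarrow> real \<Rightarrow> (real \<Rightarrow> real) \<Rightarrow> (real \<Rightarrow> real) \<Rightarrow> bool" where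
  "hill_reg_solution K S u v \<longleftrightarrow>
    (\<exists>u' v'. \<forall>s\<in>{0..S}.
      (u has_real_derivative u' s) (at s within {0..S}) \<and>
      (v has_real_derivative v' s) (at s within {0..S}) \<and>
      (u' has_real_derivative
         8 * ((u s)^2 + (v s)^2) * v' s + deriv (\<lambda>a. hill_W K a (v s)) (u s))
         (at s within {0..S}) \<and>
      (v' has_real_derivative
         - 8 * ((u s)^2 + (v s)^2) * u' s + deriv (\<lambda>b. hill_W K (u s) b) (v s))
         (at s within {0..S}) \<and>
      (u' s)^2 + (v' s)^2 = 2 * hill_W K (u s) (v s))"

lemma has_real_derivative_inverse_dist:
  assumes "(t::real)^2 + k > 0"
  shows "((\<lambda>t. 1 / sqrt (t^2 + k)) has_real_derivative - t / (sqrt (t^2 + k))^3) (at t)"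
proof -
  have "((\<lambda>t. sqrt (t^2 + k)) has_real_derivative (2 * t) * (inverse (sqrt (t^2 + k)) / 2)) (at t)"
    using assms by (auto intro!: derivative_eq_intros)
  from DERIV_inverse'[OF this] show ?thesis
    using assms by (simp add: field_simps power3_eq_cube)
qed

(* Away from collision, the projected solution satisfies the Hill equations with first
   integral K: since dt/ds = 4 * (u^2 + v^2), the functions p, q below are the velocities
   dx/dt, dy/dt. *)
lemma hill_reg_solution_projects:
  assumes sol: "hill_reg_solution K S u v"
    and nz: "\<And>s. s \<in> {0<..<S} \<Longrightarrow> (u s, v s) \<noteq> (0, 0)"
  defines "x \<equiv> \<lambda>s. fst (levi_civita (u s) (v s))"
    and "y \<equiv> \<lambda>s. snd (levi_civita (u s) (v s))"
    and "dt \<equiv> \<lambda>s. 4 * ((u s)^2 + (v s)^2)"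
  shows "\<exists>p q. \<forall>s\<in>{0<..<S}.
    (x has_real_derivative dt s * p s) (at s) \<and>
    (y has_real_derivative dt s * q s) (at s) \<and>
    (p has_real_derivative dt s * (2 * q s + deriv (\<lambda>a. hill_Psi a (y s)) (x s))) (at s) \<and>
    (q has_real_derivative dt s * (- 2 * p s + deriv (\<lambda>b. hill_Psi (x s) b) (y s))) (at s) \<and>
    2 * hill_Psi (x s) (y s) - (p s)^2 - (q s)^2 = K"
proof -
  obtain u' v' where sol': "\<forall>s\<in>{0..S}.
      (u has_real_derivative u' s) (at s within {0..S}) \<and>
      (v has_real_derivative v' s) (at s within {0..S}) \<and>
      (u' has_real_derivative
         8 * ((u s)^2 + (v s)^2) * v' s + deriv (\<lambda>a. hill_W K a (v s)) (u s))
         (at s within {0..S}) \<and>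
      (v' has_real_derivative
         - 8 * ((u s)^2 + (v s)^2) * u' s + deriv (\<lambda>b. hill_W K (u s) b) (v s))
         (at s within {0..S}) \<and>
      (u' s)^2 + (v' s)^2 = 2 * hill_W K (u s) (v s)"
    using sol unfolding hill_reg_solution_def by blast
  define p where "p = (\<lambda>s. (u s * u' s - v s * v' s) / (2 * ((u s)^2 + (v s)^2)))"
  define q where "q = (\<lambda>s. (u s * v' s + v s * u' s) / (2 * ((u s)^2 + (v s)^2)))"
  show ?thesis
  proof (rule exI[of _ p], rule exI[of _ q], rule ballI)
    fix s assume s: "s \<in> {0<..<S}"
    then have sc: "s \<in> {0..S}" by simp
    have at: "at s within {0..S} = at s" by (rule at_within_interior) (use s in simp)
    define a b c d r where abcd: "a = u s" "b = v s" "c = u' s" "d = v' s" "r = a^2 + b^2"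
    have r: "r > 0" using nz[OF s] by (auto simp: abcd sum_power2_gt_zero_iff)
    have Wu: "deriv (\<lambda>t. hill_W K t b) a
        = 12*a*(a^2-b^2)^2 + 24*a*r*(a^2-b^2) - 4*K*a"
      unfolding hill_W_def
      by (rule DERIV_imp_deriv) (auto intro!: derivative_eq_intros
          simp: abcd(5) power2_eq_square algebra_simps)
    have Wv: "deriv (\<lambda>t. hill_W K a t) b
        = 12*b*(a^2-b^2)^2 - 24*b*r*(a^2-b^2) - 4*K*b"
      unfolding hill_W_def
      by (rule DERIV_imp_deriv) (auto intro!: derivative_eq_intros
          simp: abcd(5) power2_eq_square algebra_simps)
    note S = sol'[rule_format, OF sc, unfolded at, folded abcd(1-4), unfolded Wu Wv,
        folded abcd(5)]
    have du: "(u has_real_derivative c) (at s)" and dv: "(v has_real_derivative d) (at s)"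
      and du': "(u' has_real_derivative
         8*r*d + (12*a*(a^2-b^2)^2 + 24*a*r*(a^2-b^2) - 4*K*a)) (at s)"
      and dv': "(v' has_real_derivative
         -8*r*c + (12*b*(a^2-b^2)^2 - 24*b*r*(a^2-b^2) - 4*K*b)) (at s)"
      and en: "c^2 + d^2 = 2 * (6*r*(a^2-b^2)^2 + 4 - 2*K*r)"
      using S by (simp_all add: hill_W_def abcd(5))
    have xy: "x s = a^2 - b^2" "y s = 2*a*b" "dt s = 4*r"
      by (simp_all add: x_def y_def dt_def levi_civita_def abcd)
    have nrm: "(a^2 - b^2)^2 + (2*a*b)^2 = r^2"
      by (simp add: abcd(5) power2_eq_square algebra_simps)
    then have sq: "sqrt ((a^2 - b^2)^2 + (2*a*b)^2) = r" using r by simp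
    have pos: "(a^2 - b^2)^2 + (2*a*b)^2 > 0" using r nrm by simp
    have Px: "deriv (\<lambda>t. hill_Psi t (y s)) (x s) = 3 * (a^2-b^2) - (a^2-b^2) / r^3"
    proof -
      have sqd: "((\<lambda>t. 3/2 * t^2) has_real_derivative 3 * (a^2-b^2)) (at (a^2-b^2))"
        by (auto intro!: derivative_eq_intros)
      show ?thesis
        unfolding hill_Psi_def xy
        using DERIV_add[OF sqd has_real_derivative_inverse_dist[OF pos, unfolded sq]]
        by (intro DERIV_imp_deriv) (simp only: minus_divide_left[symmetric] diff_conv_add_uminus[symmetric])
    qed
    have Py: "deriv (\<lambda>t. hill_Psi (x s) t) (y s) = - (2*a*b) / r^3"
    proof -
      have pos': "(2*a*b)^2 + (a^2 - b^2)^2 > 0" using pos by (simp add: add.commute)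
      have sq': "sqrt ((2*a*b)^2 + (a^2 - b^2)^2) = r" using sq by (simp add: add.commute)
      have "((\<lambda>t. 3/2 * (a^2-b^2)^2 + 1 / sqrt (t^2 + (a^2-b^2)^2)) has_real_derivative
          - (2*a*b) / r^3) (at (2*a*b))"
        using DERIV_add[OF DERIV_const has_real_derivative_inverse_dist[OF pos', unfolded sq']]
        by simp
      then show ?thesis
        unfolding hill_Psi_def xy by (intro DERIV_imp_deriv) (simp add: add.commute)
    qed
    have pq: "p s = (a*c - b*d) / (2*r)" "q s = (a*d + b*c) / (2*r)"
      by (simp_all add: p_def q_def abcd)
    define c1 where "c1 = 8*r*d + (12*a*(a^2-b^2)^2 + 24*a*r*(a^2-b^2) - 4*K*a)"
    define d1 where "d1 = -8*r*c + (12*b*(a^2-b^2)^2 - 24*b*r*(a^2-b^2) - 4*K*b)"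
    note du' = du'[folded c1_def] and dv' = dv'[folded d1_def]
    have r0: "2 * ((u s)^2 + (v s)^2) \<noteq> 0" using r by (simp add: abcd)
    have dR: "((\<lambda>s. 2 * ((u s)^2 + (v s)^2)) has_real_derivative 4*(a*c + b*d)) (at s)"
      by (rule derivative_eq_intros du dv refl)+ (simp add: abcd)
    have dNp: "((\<lambda>s. u s * u' s - v s * v' s) has_real_derivative
        (c*c + a*c1 - (d*d + b*d1))) (at s)"
      by (rule derivative_eq_intros du dv du' dv' refl)+ (simp add: abcd)
    have dNq: "((\<lambda>s. u s * v' s + v s * u' s) has_real_derivative
        (c*d + a*d1 + (d*c + b*c1))) (at s)"
      by (rule derivative_eq_intros du dv du' dv' refl)+ (simp add: abcd)
    have Dx: "(x has_real_derivative dt s * p s) (at s)"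
    proof -
      have "(x has_real_derivative 2*(a*c - b*d)) (at s)"
        unfolding x_def levi_civita_def fst_conv
        by (rule derivative_eq_intros du dv refl)+ (simp add: abcd)
      moreover have "2*(a*c - b*d) = dt s * p s"
        using r by (simp add: xy pq field_simps)
      ultimately show ?thesis by simp
    qed
    have Dy: "(y has_real_derivative dt s * q s) (at s)"
    proof -
      have "(y has_real_derivative 2*(a*d + b*c)) (at s)"
        unfolding y_def levi_civita_def snd_conv
        by (rule derivative_eq_intros du dv refl)+ (simp add: abcd algebra_simps)
      moreover have "2*(a*d + b*c) = dt s * q s"
        using r by (simp add: xy pq field_simps)
      ultimately show ?thesis by simp
    qed
    have Ip: "(c*c + a*c1 - (d*d + b*d1)) * r - (a*c - b*d) * (2*(a*c + b*d))
        = 8*r^2*(a*d + b*c) + 24*r^3*(a^2-b^2) - 8*(a^2-b^2)"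
      using en abcd(5) c1_def d1_def by algebra
    have Iq: "(c*d + a*d1 + (d*c + b*c1)) * r - (a*d + b*c) * (2*(a*c + b*d))
        = - 8*r^2*(a*c - b*d) - 8*(2*a*b)"
      using en abcd(5) c1_def d1_def by algebra
    have Dp: "(p has_real_derivative
        dt s * (2 * q s + deriv (\<lambda>a. hill_Psi a (y s)) (x s))) (at s)"
    proof -
      have "((c*c + a*c1 - (d*d + b*d1)) * (2*r) - (a*c - b*d) * (4*(a*c + b*d))) / (2*r * (2*r))
          = ((c*c + a*c1 - (d*d + b*d1)) * r - (a*c - b*d) * (2*(a*c + b*d))) / (2*r^2)"
        using r by (simp add: field_simps power2_eq_square)
      also have "\<dots> = dt s * (2 * q s + deriv (\<lambda>a. hill_Psi a (y s)) (x s))"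
        unfolding Ip pq Px unfolding xy using r
        by (simp add: field_simps power2_eq_square power3_eq_cube)
      finally show ?thesis
        using DERIV_divide[OF dNp dR r0] unfolding p_def by (simp add: abcd)
    qed
    have Dq: "(q has_real_derivative
        dt s * (- 2 * p s + deriv (\<lambda>b. hill_Psi (x s) b) (y s))) (at s)"
    proof -
      have "((c*d + a*d1 + (d*c + b*c1)) * (2*r) - (a*d + b*c) * (4*(a*c + b*d))) / (2*r * (2*r))
          = ((c*d + a*d1 + (d*c + b*c1)) * r - (a*d + b*c) * (2*(a*c + b*d))) / (2*r^2)"
        using r by (simp add: field_simps power2_eq_square)
      also have "\<dots> = dt s * (- 2 * p s + deriv (\<lambda>b. hill_Psi (x s) b) (y s))"
        unfolding Iq pq Py unfolding xy using r
        by (simp add: field_simps power2_eq_square power3_eq_cube)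
      finally show ?thesis
        using DERIV_divide[OF dNq dR r0] unfolding q_def by (simp add: abcd)
    qed
    have En: "2 * hill_Psi (x s) (y s) - (p s)^2 - (q s)^2 = K"
    proof -
      have "(a*c - b*d)^2 + (a*d + b*c)^2 = r * (2 * (6*r*(a^2-b^2)^2 + 4 - 2*K*r))"
        using en abcd(5) by algebra
      then have "(p s)^2 + (q s)^2 = (r * (2 * (6*r*(a^2-b^2)^2 + 4 - 2*K*r))) / (4*r^2)"
        unfolding pq power_divide by (simp add: power_mult_distrib add_divide_distrib[symmetric])
      also have "\<dots> = 3*(a^2-b^2)^2 + 2 / r - K"
        using r by (simp add: field_simps power2_eq_square power3_eq_cube)
      finally show ?thesis unfolding hill_Psi_def xy sq by simp
    qed
    show "(x has_real_derivative dt s * p s) (at s) \<and>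
    (y has_real_derivative dt s * q s) (at s) \<and>
    (p has_real_derivative dt s * (2 * q s + deriv (\<lambda>a. hill_Psi a (y s)) (x s))) (at s) \<and>
    (q has_real_derivative dt s * (- 2 * p s + deriv (\<lambda>b. hill_Psi (x s) b) (y s))) (at s) \<and>
    2 * hill_Psi (x s) (y s) - (p s)^2 - (q s)^2 = K"
      using Dx Dy Dp Dq En by blast
  qed
qed

(* An n-ejection-collision orbit is recorded as a pair (S, \<gamma>): its duration S in
   regularized time and its parametrized projection \<gamma> to the (x, y) plane, made unique by
   restriction to [0, S]. Thus (u, v) and (-u, -v) give the same orbit. Since s and t are
   increasing functions of each other, relative maxima may be counted in s. *)
definition hill_nEC_orbits :: "real \<Rightarrow> nat \<Rightarrow> (real \<times> (real \<Rightarrow> real \<times> real)) set" where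
  "hill_nEC_orbits K n = {(S, \<gamma>). 0 < S \<and>
    (\<exists>u v. hill_reg_solution K S u v \<and>
      (u 0, v 0) = (0, 0) \<and> (u S, v S) = (0, 0) \<and>
      (\<forall>s\<in>{0<..<S}. (u s, v s) \<noteq> (0, 0)) \<and>
      \<gamma> = restrict (\<lambda>s. levi_civita (u s) (v s)) {0..S}) \<and>
    (let M = {s \<in> {0<..<S}. \<forall>\<^sub>F s' in at s. norm (\<gamma> s') \<le> norm (\<gamma> s)}
     in finite M \<and> card M = n)}"

definition trace_of :: "real \<times> (real \<Rightarrow> real \<times> real) \<Rightarrow> (real \<times> real) set" where
  "trace_of \<omega> = snd \<omega> ` {0..fst \<omega>}"

definition reflect_x_axis :: "real \<times> real \<Rightarrow> real \<times> real" where
  "reflect_x_axis z = (fst z, - snd z)"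

definition reflect_y_axis :: "real \<times> real \<Rightarrow> real \<times> real" where
  "reflect_y_axis z = (- fst z, snd z)"

end

theory Submission
  imports Defs
begin

text \<open>
  Rescale by \<open>Z = (u + \<i> v) / sqrt (2 / K)\<close>, \<open>t = 2 sqrt K s\<close>. With \<open>R = \<bar>Z\<bar>\<^sup>2\<close>, \<open>D = Re Z\<^sup>2\<close> and
  \<open>e = 8 / K\<^bsup>3/2\<^esup>\<close> the regularized equations become
  \<open>Z'' = - Z - \<i> e R Z' + 3/16 e\<^sup>2 (D\<^sup>2 Z + 2 R D cnj Z)\<close>, a perturbation of an isotropic oscillator
  that is small when \<open>K\<close> is large. The quantity \<open>Im (cnj Z Z') + e R\<^sup>2 / 4\<close> has derivative
  \<open>- 3/4 e\<^sup>2 h\<close> with \<open>h = R Im (Z\<^sup>4) / 4\<close>. At the critical point of \<open>R\<close> near \<open>n \<pi>\<close> of the solution ejected in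
  direction \<open>b\<close>, a collision therefore happens exactly if the integral of \<open>h\<close> vanishes. This integral is
  \<open>Im (b\<^sup>4) / 4\<close> times the integral of \<open>sin\<^sup>6\<close>, up to an error that is small together with its Lipschitz
  constant in \<open>b\<close>. Hence there is exactly one collision direction near each root of \<open>Im (b\<^sup>4) = 0\<close>, that
  is four up to sign. The reversing symmetries permute the collision orbits, and uniqueness
  near each root decides where each of them goes.

  It remains to exclude an earlier collision of such an orbit. By symmetry, a collision orbit ejected
  at angle \<open>\<theta>\<close> from the axis arrives at angle \<open>- \<theta>\<close>, and the Coriolis term makes the direction turn
  clockwise, so \<open>\<theta> > 0\<close>. The continuation past an early collision would be a collision orbit ejected
  at the negative angle \<open>- \<theta>\<close>.
\<close>

section \<open>Derivative bounds and a fixed point theorem for short times\<close>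

text \<open>The directions separate only at second order. The Coriolis term is invariant under
  rotations, so to first order in \<open>e\<close> all ejection directions behave alike; the tidal
  term, which distinguishes them, carries the factor \<open>e^2\<close>. Expanding solutions that
  far is avoided because the momentum identity is exact: \<open>e^2\<close> is divided out in
  \<open>momF\<close>, and then \<open>Z\<close> is needed only to order zero. Closeness alone would
  give existence but not uniqueness, since near a root of Im (b^4) the error could oscillate. Hence
  the estimates compare two solutions at a time (\<open>lip_pair\<close>, \<open>lip_quad\<close>),
  which replaces differentiation with respect to the initial direction and the implicit function
  theorem. The orbits to be counted have no prescribed duration. A time span \<open>N\<close> is
  therefore fixed from \<open>n\<close> alone, long enough to contain \<open>n + 1\<close> maxima,
  and only then is \<open>K\<close> taken so large that \<open>e * N^2\<close> is small.\<close>

lemma vector_derivative_bound: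
  fixes f :: "real \<Rightarrow> 'a::real_normed_vector"
  assumes "\<And>t. t \<in> {a..b} \<Longrightarrow> (f has_vector_derivative f' t) (at t within {a..b})"
    and "\<And>t. t \<in> {a..b} \<Longrightarrow> norm (f' t) \<le> B"
    and "x \<in> {a..b}" "y \<in> {a..b}"
  shows "norm (f x - f y) \<le> B * \<bar>x - y\<bar>"
proof -
  have "norm (f x - f y) \<le> B * norm (x - y)"
  proof (rule differentiable_bound)
    show "(f has_derivative (\<lambda>h. h *\<^sub>R f' t)) (at t within {a..b})" if "t \<in> {a..b}" for t
      using assms(1)[OF that] by (simp add: has_vector_derivative_def)
    show "onorm (\<lambda>h. h *\<^sub>R f' t) \<le> B" if "t \<in> {a..b}" for t
    proof (rule onorm_le)
      fix h :: real
      show "norm (h *\<^sub>R f' t) \<le> B * norm h"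
        using mult_left_mono[OF assms(2)[OF that], of "\<bar>h\<bar>"] by (simp add: mult.commute)
    qed
  qed (use assms in auto)
  then show ?thesis by simp
qed

lemma derivative_lower_bound:
  fixes f :: "real \<Rightarrow> real"
  assumes d: "\<And>t. t \<in> {a..b} \<Longrightarrow> (f has_real_derivative f' t) (at t within {a..b})"
    and B: "\<And>t. t \<in> {a..b} \<Longrightarrow> B \<le> f' t" and "a \<le> b"
  shows "B * (b - a) \<le> f b - f a"
proof (cases "a = b")
  case False
  then have ab: "a < b" using assms by simp
  have "continuous_on {a..b} f"
    using d by (meson DERIV_continuous continuous_on_eq_continuous_within)
  moreover have "(f has_real_derivative f' t) (at t)" if "a < t" "t < b" for t
    using d[of t] that at_within_Icc_at[of a t b] by simp
  ultimately obtain z where z: "a < z" "z < b" "f b - f a = (b - a) * f' z"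
    using mvt[OF ab, of f "\<lambda>t h. h * f' t"] 
    by (metis has_field_derivative_imp_has_derivative mult_commute_abs)
  then show ?thesis
    using B[of z] ab by (simp add: mult.commute mult_left_mono)
qed simp

text \<open>The plain supremum norm suffices because \<open>L * T < 1\<close>. The theorem is
  applied in slowly varying coordinates, where \<open>L\<close> is of order \<open>e\<close>, so
  that \<open>T\<close> may be long.\<close>

theorem small_time_picard:
  fixes f :: "real \<Rightarrow> 'a::euclidean_space \<Rightarrow> 'a"
  assumes cont: "continuous_on ({0..T} \<times> UNIV) (\<lambda>(t, y). f t y)"
    and lip: "\<And>t x y. t \<in> {0..T} \<Longrightarrow> norm (f t x - f t y) \<le> L * norm (x - y)"
    and small: "L * T < 1" and "0 \<le> T" "0 \<le> L"
  obtains y where "y 0 = y0"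
    "\<And>t. t \<in> {0..T} \<Longrightarrow> (y has_vector_derivative f t (y t)) (at t within {0..T})"
proof -
  \<comment> \<open>Clamping time to the interval turns curves on it into bounded continuous
    functions on the whole line, a complete type on which the contraction principle applies.\<close>
  define c where "c = (\<lambda>t. max 0 (min T t))"
  have c: "c t \<in> {0..T}" for t using \<open>0 \<le> T\<close> by (auto simp: c_def)
  have c_id: "c t = t" if "t \<in> {0..T}" for t using that by (auto simp: c_def)
  have contc: "continuous_on UNIV c" unfolding c_def by (intro continuous_intros)
  have cf: "continuous_on {0..T} (\<lambda>s. f s (apply_bcontfun g s))" for g :: "real \<Rightarrow>\<^sub>C 'a"
  proof -
    have "continuous_on {0..T} ((\<lambda>(t, y). f t y) \<circ> (\<lambda>s. (s, apply_bcontfun g s)))"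
      by (intro continuous_on_compose continuous_on_subset[OF cont] continuous_intros) auto
    then show ?thesis by (simp add: o_def)
  qed
  define h where "h = (\<lambda>(g :: real \<Rightarrow>\<^sub>C 'a) t. y0 + integral {0..t} (\<lambda>s. f s (g s)))"
  have conth: "continuous_on {0..T} (h g)" for g
    unfolding h_def by (intro continuous_intros indefinite_integral_continuous_1
        integrable_continuous_real cf)
  have hb: "(\<lambda>t. h g (c t)) \<in> bcontfun" for g
  proof -
    have 1: "continuous_on UNIV (\<lambda>t. h g (c t))"
      by (rule continuous_on_compose2[OF conth contc]) (use c in blast)
    have "bounded (h g ` {0..T})"
      using conth compact_continuous_image compact_imp_bounded by blast
    then obtain B where "\<And>x. x \<in> {0..T} \<Longrightarrow> norm (h g x) \<le> B"
      unfolding bounded_iff by blast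
    then show ?thesis using bcontfun_normI[OF 1] c by blast
  qed
  define \<Phi> where "\<Phi> = (\<lambda>g. Bcontfun (\<lambda>t. h g (c t)))"
  have \<Phi>: "apply_bcontfun (\<Phi> g) t = h g (c t)" for g t
    unfolding \<Phi>_def using hb Bcontfun_inverse by metis
  have "\<exists>!g. \<Phi> g = g"
  proof (rule banach_fix_type)
    show "\<forall>x y. dist (\<Phi> x) (\<Phi> y) \<le> L * T * dist x y"
    proof (intro allI, rule dist_bound)
      fix g k :: "real \<Rightarrow>\<^sub>C 'a" and t
      let ?d = "\<lambda>s. f s (g s) - f s (k s)"
      have "dist (\<Phi> g t) (\<Phi> k t) = norm (integral {0..c t} ?d)"
      proof -
        have *: "(\<lambda>s. f s (apply_bcontfun g s)) integrable_on {0..c t}" for g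
          by (rule integrable_continuous_real, rule continuous_on_subset[OF cf]) (use c[of t] in auto)
        show ?thesis unfolding \<Phi> h_def dist_norm by (simp add: integral_diff[OF * *])
      qed
      also have "\<dots> \<le> (L * dist g k) * (c t - 0)"
      proof (rule integral_bound)
        show "continuous_on {0..c t} ?d"
          by (rule continuous_on_subset[of "{0..T}"], intro continuous_intros cf) (use c[of t] in auto)
        fix s assume "s \<in> {0..c t}"
        then have "s \<in> {0..T}" using c[of t] by auto
        then have "norm (?d s) \<le> L * norm (g s - k s)" by (rule lip)
        also have "\<dots> \<le> L * dist g k"
          by (intro mult_left_mono) (use dist_bounded[of g s k] \<open>0 \<le> L\<close> in \<open>auto simp: dist_norm\<close>)
        finally show "norm (?d s) \<le> L * dist g k" .
      qed (use c[of t] in auto)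
      also have "\<dots> \<le> (L * dist g k) * T"
        by (intro mult_left_mono) (use c[of t] \<open>0 \<le> L\<close> in auto)
      finally show "dist (\<Phi> g t) (\<Phi> k t) \<le> L * T * dist g k" by (simp add: mult_ac)
    qed
  qed (use assms in auto)
  then obtain g where g: "\<Phi> g = g" by blast
  have gh: "apply_bcontfun g t = h g t" if "t \<in> {0..T}" for t
    using \<Phi>[of g t] c_id[OF that] by (simp add: g)
  show thesis
  proof (rule that[of "apply_bcontfun g"])
    show "apply_bcontfun g 0 = y0" using gh[of 0] \<open>0 \<le> T\<close> by (simp add: h_def)
    fix t assume t: "t \<in> {0..T}"
    have "(h g has_vector_derivative f t (g t)) (at t within {0..T})"
      unfolding h_def using integral_has_vector_derivative[OF cf t]
      by (auto intro!: derivative_eq_intros)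
    then show "(apply_bcontfun g has_vector_derivative f t (g t)) (at t within {0..T})"
      by (rule has_vector_derivative_transform[OF t, rotated]) (use gh in auto)
  qed
qed

section \<open>Lipschitz estimates for polynomials\<close>

text \<open>One constant \<open>B\<close> bounds both the size and the Lipschitz quotient over the
  parameter distance \<open>d\<close>, so that polynomial estimates are obtained by chaining one
  rule per operation.\<close>

definition lip_pair :: "real \<Rightarrow> real \<Rightarrow> 'a::real_normed_vector \<Rightarrow> 'a \<Rightarrow> bool" where
  "lip_pair d B x y \<longleftrightarrow> norm x \<le> B \<and> norm y \<le> B \<and> norm (x - y) \<le> B * d"

lemma lip_pairD:
  assumes "lip_pair d B x y"
  shows "norm x \<le> B" "norm y \<le> B" "norm (x - y) \<le> B * d" "0 \<le> B"
  using assms norm_ge_zero[of x] unfolding lip_pair_def by linarith+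

lemma lip_pair_add:
  assumes "lip_pair d B x y" "lip_pair d C u v"
  shows "lip_pair d (B + C) (x + u) (y + v)"
proof -
  have eq: "(x + u) - (y + v) = (x - y) + (u - v)" by simp
  have "norm ((x + u) - (y + v)) \<le> B * d + C * d"
    unfolding eq
    using norm_triangle_ineq[of "x - y" "u - v"] lip_pairD[OF assms(1)] lip_pairD[OF assms(2)]
    by linarith
  moreover have "norm (x + u) \<le> B + C" "norm (y + v) \<le> B + C"
    using norm_triangle_ineq[of x u] norm_triangle_ineq[of y v]
      lip_pairD[OF assms(1)] lip_pairD[OF assms(2)] by linarith+
  ultimately show ?thesis by (simp add: lip_pair_def algebra_simps)
qed

lemma lip_pair_mult:
  fixes x :: "'a::real_normed_algebra"
  assumes "lip_pair d B x y" "lip_pair d C u v" "0 \<le> d"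
  shows "lip_pair d (2 * B * C) (x * u) (y * v)"
proof -
  note 1 = lip_pairD[OF assms(1)] and 2 = lip_pairD[OF assms(2)]
  have le: "norm (a * b) \<le> \<alpha> * \<beta>" if "norm a \<le> \<alpha>" "norm b \<le> \<beta>" for a b :: 'a and \<alpha> \<beta>
    using that order_trans[OF norm_ge_zero that(1)]
    by (intro order_trans[OF norm_mult_ineq] mult_mono) auto
  have eq: "x * u - y * v = (x - y) * u + y * (u - v)" by (simp add: algebra_simps)
  have "norm (x * u - y * v) \<le> (B * d) * C + B * (C * d)"
    unfolding eq
    using norm_triangle_ineq[of "(x - y) * u" "y * (u - v)"] le[OF 1(3) 2(1)] le[OF 1(2) 2(3)]
    by linarith
  moreover have "norm (x * u) \<le> B * C" "norm (y * v) \<le> B * C" "0 \<le> B * C"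
    using le[OF 1(1) 2(1)] le[OF 1(2) 2(2)] 1 2 by auto
  ultimately show ?thesis by (simp add: lip_pair_def algebra_simps)
qed

lemma lip_pair_norm_le:
  assumes "lip_pair d B x y" "\<And>x y. norm (f x - f y) \<le> c * norm (x - y)" "f 0 = 0" "0 \<le> c"
  shows "lip_pair d (c * B) (f x) (f y)"
  using assms(2)[of x 0] assms(2)[of y 0] assms(2)[of x y] assms(3,4) lip_pairD[OF assms(1)]
    mult_left_mono[of _ _ c]
  unfolding lip_pair_def by (smt (verit) diff_zero mult.assoc)

lemma lip_pair_cnj: "lip_pair d B x y \<Longrightarrow> lip_pair d B (cnj x) (cnj y)"
  using lip_pair_norm_le[of d B x y cnj 1] by (simp flip: complex_cnj_diff)

lemma lip_pair_Re: "lip_pair d B x y \<Longrightarrow> lip_pair d B (complex_of_real (Re x)) (of_real (Re y))"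
  using lip_pair_norm_le[of d B x y "\<lambda>x. complex_of_real (Re x)" 1]
  by (simp flip: of_real_diff add: abs_Re_le_cmod[of "_ - _", simplified])

lemma lip_pair_cmult:
  fixes x y :: complex
  shows "lip_pair d B x y \<Longrightarrow> norm c \<le> C \<Longrightarrow> lip_pair d (C * B) (c * x) (c * y)"
proof -
  assume 1: "lip_pair d B x y" and c: "norm c \<le> C"
  have C: "0 \<le> C" using c norm_ge_zero[of c] by linarith
  show ?thesis
    using lip_pair_norm_le[OF 1, of "\<lambda>x. c * x" C] C c
    by (simp add: norm_mult mult_right_mono flip: right_diff_distrib)
qed

lemma lip_pair_mono: "lip_pair d B x y \<Longrightarrow> B \<le> C \<Longrightarrow> 0 \<le> d \<Longrightarrow> lip_pair d C x y"
  unfolding lip_pair_def by (smt (verit) mult_right_mono)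

text \<open>Second-order version: \<open>x, y\<close> are perturbations of size \<open>k\<close> of \<open>x0, y0\<close>, and the perturbation
  itself is Lipschitz with a small constant when \<open>d\<close> is the distance of the parameters.\<close>

definition lip_quad ::
    "real \<Rightarrow> real \<Rightarrow> real \<Rightarrow> 'a::real_normed_vector \<Rightarrow> 'a \<Rightarrow> 'a \<Rightarrow> 'a \<Rightarrow> bool" where
  "lip_quad k d B x y x0 y0 \<longleftrightarrow> lip_pair d B x y \<and> lip_pair d B x0 y0 \<and>
    lip_pair k B x x0 \<and> lip_pair k B y y0 \<and> norm ((x - y) - (x0 - y0)) \<le> B * k * d"

text \<open>The mixed second difference of a product telescopes into four terms, each at most
  \<open>B * C * k * d\<close>.\<close>

lemma lip_quad_mult:
  fixes x :: "'a::real_normed_algebra"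
  assumes "lip_quad k d B x y x0 y0" "lip_quad k d C u v u0 v0" "0 \<le> d" "0 \<le> k"
  shows "lip_quad k d (4 * B * C) (x * u) (y * v) (x0 * u0) (y0 * v0)"
proof -
  note 1 = assms(1)[unfolded lip_quad_def] and 2 = assms(2)[unfolded lip_quad_def]
  have BC: "0 \<le> B" "0 \<le> C" using 1 2 lip_pairD(4) by blast+
  have le: "norm (a * b) \<le> \<alpha> * \<beta>" if "norm a \<le> \<alpha>" "norm b \<le> \<beta>" for a b :: 'a and \<alpha> \<beta>
    using that order_trans[OF norm_ge_zero that(1)]
    by (intro order_trans[OF norm_mult_ineq] mult_mono) auto
  have eq: "(x * u - y * v) - (x0 * u0 - y0 * v0)
      = (((x - y) - (x0 - y0)) * u + (x0 - y0) * (u - u0))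
      + (y * ((u - v) - (u0 - v0)) + (y - y0) * (u0 - v0))"
    by (simp add: algebra_simps)
  have "norm (((x - y) - (x0 - y0)) * u) \<le> (B * k * d) * C"
    "norm ((x0 - y0) * (u - u0)) \<le> (B * d) * (C * k)"
    "norm (y * ((u - v) - (u0 - v0))) \<le> B * (C * k * d)"
    "norm ((y - y0) * (u0 - v0)) \<le> (B * k) * (C * d)"
    using 1 2 unfolding lip_pair_def by (intro le; blast)+
  then have "norm ((x * u - y * v) - (x0 * u0 - y0 * v0)) \<le> 4 * B * C * k * d"
    unfolding eq
    by (intro order_trans[OF norm_triangle_ineq]
        order_trans[OF add_mono[OF norm_triangle_ineq norm_triangle_ineq]])
      (simp add: mult_ac)
  moreover have "lip_pair d (4*B*C) (x * u) (y * v)" "lip_pair d (4*B*C) (x0 * u0) (y0 * v0)"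
    "lip_pair k (4*B*C) (x * u) (x0 * u0)" "lip_pair k (4*B*C) (y * v) (y0 * v0)"
    using 1 2 BC assms(3,4) by (auto intro!: lip_pair_mono[OF lip_pair_mult])
  ultimately show ?thesis by (simp add: lip_quad_def)
qed

lemma lip_quad_cnj: "lip_quad k d B x y x0 y0 \<Longrightarrow> lip_quad k d B (cnj x) (cnj y) (cnj x0) (cnj y0)"
  unfolding lip_quad_def by (auto intro!: lip_pair_cnj simp flip: complex_cnj_diff)

section \<open>The rescaled equation\<close>

text \<open>The force beyond the linear term, divided by \<open>e\<close>. The squared norm and D
  are spelled as products and real parts of \<open>z\<close> and \<open>cnj z\<close>, so that the
  \<open>lip_pair\<close> rules apply to the syntax.\<close>

definition pert :: "real \<Rightarrow> complex \<Rightarrow> complex \<Rightarrow> complex" where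
  "pert e z w = - (\<i> * ((z * cnj z) * w)) + of_real (3/16 * e) *
    ((of_real (Re (z * z)) * of_real (Re (z * z))) * z +
      2 * ((z * cnj z) * of_real (Re (z * z)) * cnj z))"

text \<open>The rules give 32 for the cubic Coriolis term and 1536 for the quintic terms, hence
  \<open>3/16 * e * 1536 = 288 * e\<close>; 40 and \<open>300 * e\<close> round up. The second bound
  isolates the Coriolis term, which determines the precession.\<close>

lemma pert_lip:
  assumes e: "0 \<le> e" "e \<le> 1/1000" and d: "0 \<le> d"
    and z: "lip_pair d 2 z1 z2" and w: "lip_pair d 2 w1 w2"
  shows "lip_pair d 40 (pert e z1 w1) (pert e z2 w2)"
    and "lip_pair d (300 * e) (pert e z1 w1 + \<i> * ((z1 * cnj z1) * w1))
       (pert e z2 w2 + \<i> * ((z2 * cnj z2) * w2))"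
proof -
  define q where "q = (\<lambda>z. (of_real (Re (z * z)) * of_real (Re (z * z))) * z +
      2 * ((z * cnj z) * of_real (Re (z * z)) * cnj z))"
  have p: "pert e z w = (- \<i>) * ((z * cnj z) * w) + of_real (3/16 * e) * q z" for z w
    by (simp add: pert_def q_def)
  note m = lip_pair_mult[OF _ _ d]
  have R: "lip_pair d 8 (z1 * cnj z1) (z2 * cnj z2)"
    using m[OF z lip_pair_cnj[OF z]] by simp
  have D: "lip_pair d 8 (complex_of_real (Re (z1 * z1))) (of_real (Re (z2 * z2)))"
    using lip_pair_Re[OF m[OF z z]] by simp
  have "lip_pair d (512 + 2 * 512) (q z1) (q z2)"
    unfolding q_def
    using lip_pair_add[OF m[OF m[OF D D] z] lip_pair_cmult[of d 512 _ _ 2 2, OF m[OF m[OF R D] lip_pair_cnj[OF z], simplified]]]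
    by simp
  then have 1: "lip_pair d (3/16 * e * 1536) (of_real (3/16 * e) * q z1) (of_real (3/16 * e) * q z2)"
    using lip_pair_cmult[of d 1536 "q z1" "q z2" "of_real (3/16 * e)" "3/16 * e"] e by simp
  have 2: "lip_pair d 32 ((- \<i>) * ((z1 * cnj z1) * w1)) ((- \<i>) * ((z2 * cnj z2) * w2))"
    using lip_pair_cmult[OF m[OF R w], of "- \<i>" 1] by simp
  show "lip_pair d 40 (pert e z1 w1) (pert e z2 w2)"
    unfolding p by (rule lip_pair_mono[OF lip_pair_add[OF 2 1]]) (use e d in auto)
  show "lip_pair d (300 * e) (pert e z1 w1 + \<i> * ((z1 * cnj z1) * w1))
       (pert e z2 w2 + \<i> * ((z2 * cnj z2) * w2))"
    unfolding p using lip_pair_mono[OF 1 _ d, of "300*e"] e by (simp add: algebra_simps)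
qed

text \<open>The third conjunct is the first integral; its constant 1 records the chosen value of
  \<open>K\<close> and gives unit speed at a collision.\<close>

definition hill_sol :: "real \<Rightarrow> real \<Rightarrow> (real \<Rightarrow> complex) \<Rightarrow> (real \<Rightarrow> complex) \<Rightarrow> bool" where
  "hill_sol e T Z W \<longleftrightarrow> (\<forall>t\<in>{0..T}.
    (Z has_vector_derivative W t) (at t within {0..T}) \<and>
    (W has_vector_derivative - Z t + of_real e * pert e (Z t) (W t)) (at t within {0..T}) \<and>
    (norm (W t))\<^sup>2 + (norm (Z t))\<^sup>2 = 1 + 3/16 * e\<^sup>2 * (norm (Z t))\<^sup>2 * (Re (Z t * Z t))\<^sup>2)"

lemma hill_solD:
  assumes "hill_sol e T Z W" "t \<in> {0..T}"
  shows "(Z has_vector_derivative W t) (at t within {0..T})"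
    and "(W has_vector_derivative - Z t + of_real e * pert e (Z t) (W t)) (at t within {0..T})"
    and "(norm (W t))\<^sup>2 + (norm (Z t))\<^sup>2 = 1 + 3/16 * e\<^sup>2 * (norm (Z t))\<^sup>2 * (Re (Z t * Z t))\<^sup>2"
  using assms unfolding hill_sol_def by blast+

lemma hill_sol_components:
  assumes "hill_sol e T Z W" "t \<in> {0..T}"
  shows "((\<lambda>t. Re (Z t)) has_real_derivative Re (W t)) (at t within {0..T})"
    and "((\<lambda>t. Im (Z t)) has_real_derivative Im (W t)) (at t within {0..T})"
    and "((\<lambda>t. Re (W t)) has_real_derivative - Re (Z t) + e * Re (pert e (Z t) (W t))) (at t within {0..T})"
    and "((\<lambda>t. Im (W t)) has_real_derivative - Im (Z t) + e * Im (pert e (Z t) (W t))) (at t within {0..T})"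
  using hill_solD(1,2)[OF assms]
  by (auto simp: has_vector_derivative_complex_iff)

lemma hill_sol_continuous:
  assumes "hill_sol e T Z W"
  shows "continuous_on {0..T} Z" "continuous_on {0..T} W"
  using hill_solD(1,2)[OF assms]
  by (meson continuous_on_eq_continuous_within has_vector_derivative_continuous)+

lemma Re_pert: "Re (pert e (Complex x y) (Complex p q)) = (x^2+y^2) * q
    + 3/16 * e * ((x^2-y^2)^2 * x + 2 * (x^2+y^2) * (x^2-y^2) * x)"
  and Im_pert: "Im (pert e (Complex x y) (Complex p q)) = - (x^2+y^2) * p
    + 3/16 * e * ((x^2-y^2)^2 * y - 2 * (x^2+y^2) * (x^2-y^2) * y)"
  by (simp_all add: pert_def power2_eq_square field_simps)

text \<open>Half the derivative of the squared distance to the origin; it also vanishes at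
  collisions.\<close>

definition rho :: "(real \<Rightarrow> complex) \<Rightarrow> (real \<Rightarrow> complex) \<Rightarrow> real \<Rightarrow> real" where
  "rho Z W t = Re (cnj (Z t) * W t)"

definition h6 :: "complex \<Rightarrow> real" where
  "h6 z = Im ((z * z) * (z * z) * (z * cnj z)) / 4"

text \<open>The multiple of \<open>Im (cnj Z W) + e R\<^sup>2 / 4\<close> that is an antiderivative of \<open>h6\<close> along solutions.\<close>

definition momF :: "real \<Rightarrow> (real \<Rightarrow> complex) \<Rightarrow> (real \<Rightarrow> complex) \<Rightarrow> real \<Rightarrow> real" where
  "momF e Z W t = - 4 / (3 * e\<^sup>2) * (Im (cnj (Z t) * W t) + e * (norm (Z t))^4 / 4)"

lemma hill_sol_norm_deriv:
  assumes "hill_sol e T Z W" "t \<in> {0..T}"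
  shows "((\<lambda>t. (norm (Z t))\<^sup>2) has_real_derivative 2 * rho Z W t) (at t within {0..T})"
  unfolding cmod_power2
  by (rule hill_sol_components[OF assms] derivative_eq_intros refl)+ (simp add: rho_def)

lemma hill_sol_rho_deriv:
  assumes "hill_sol e T Z W" "t \<in> {0..T}"
  shows "(rho Z W has_real_derivative (norm (W t))\<^sup>2 - (norm (Z t))\<^sup>2
      + e * Re (cnj (Z t) * pert e (Z t) (W t))) (at t within {0..T})"
proof -
  have "rho Z W = (\<lambda>t. Re (Z t) * Re (W t) + Im (Z t) * Im (W t))"
    by (simp add: rho_def fun_eq_iff)
  then show ?thesis unfolding cmod_power2
    by (rule ssubst) (rule hill_sol_components[OF assms] derivative_eq_intros refl
      | simp add: power2_eq_square algebra_simps)+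
qed

text \<open>The oscillator force is central and does not change the angular momentum. The Coriolis
  term contributes - e R \<open>rho\<close>, which the derivative of e R^2 / 4 cancels exactly, so
  only the tidal term survives, with factor \<open>e^2\<close>.\<close>

lemma hill_sol_momF_deriv:
  assumes "hill_sol e T Z W" "t \<in> {0..T}" "e \<noteq> 0"
  shows "(momF e Z W has_real_derivative h6 (Z t)) (at t within {0..T})"
proof -
  obtain x y p q where xy: "Z t = Complex x y" "W t = Complex p q" by (meson complex.exhaust)
  have n4: "(norm z)^4 = ((Re z)^2 + (Im z)^2)^2" for z
    by (metis cmod_power2 mult_2_right numeral_Bit0 power_add power2_eq_square)
  have "((\<lambda>t. - 4 / (3 * e\<^sup>2) * ((Re (Z t) * Im (W t) - Im (Z t) * Re (W t))
      + e / 4 * ((Re (Z t))^2 + (Im (Z t))^2)^2))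
      has_real_derivative - 4 / (3 * e\<^sup>2) * (
        (x * (- y + e * Im (pert e (Complex x y) (Complex p q))) + p * q
          - (y * (- x + e * Re (pert e (Complex x y) (Complex p q))) + q * p))
        + e * (x^2+y^2) * (x * p + y * q))) (at t within {0..T})"
    by (rule hill_sol_components[OF assms(1,2)] derivative_eq_intros refl)+
      (simp add: xy algebra_simps)
  moreover have X: "(x * (- y + e * Im (pert e (Complex x y) (Complex p q))) + p * q
          - (y * (- x + e * Re (pert e (Complex x y) (Complex p q))) + q * p))
        + e * (x^2+y^2) * (x * p + y * q) = - (3 * e^2) / 4 * h6 (Complex x y)"
    unfolding Re_pert Im_pert h6_def by (simp add: power2_eq_square algebra_simps)
  moreover have "momF e Z W = (\<lambda>t. - 4 / (3 * e\<^sup>2) * ((Re (Z t) * Im (W t) - Im (Z t) * Re (W t))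
      + e / 4 * ((Re (Z t))^2 + (Im (Z t))^2)^2))"
    by (simp add: fun_eq_iff momF_def n4 algebra_simps)
  moreover have "- 4 / (3 * e\<^sup>2) * (- (3 * e^2) / 4 * h6 (Complex x y)) = h6 (Complex x y)"
    using \<open>e \<noteq> 0\<close> by simp
  ultimately show ?thesis by (simp only: xy)
qed

text \<open>Variation of constants: undoing the rotation of the harmonic oscillator leaves
  coordinates that move only at speed of order \<open>e\<close>, so errors grow linearly in
  time.\<close>

lemma hill_sol_slow_deriv:
  assumes "hill_sol e T Z W" "t \<in> {0..T}"
  shows "((\<lambda>t. of_real (cos t) * Z t - of_real (sin t) * W t) has_vector_derivative
      of_real (- e * sin t) * pert e (Z t) (W t)) (at t within {0..T})"
    and "((\<lambda>t. of_real (sin t) * Z t + of_real (cos t) * W t) has_vector_derivative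
      of_real (e * cos t) * pert e (Z t) (W t)) (at t within {0..T})"
proof -
  have c: "((\<lambda>t. complex_of_real (cos t)) has_vector_derivative of_real (- sin t)) (at t within {0..T})"
    and s: "((\<lambda>t. complex_of_real (sin t)) has_vector_derivative of_real (cos t)) (at t within {0..T})"
    by (auto intro!: has_vector_derivative_of_real derivative_eq_intros)
  show "((\<lambda>t. of_real (cos t) * Z t - of_real (sin t) * W t) has_vector_derivative
      of_real (- e * sin t) * pert e (Z t) (W t)) (at t within {0..T})"
    using has_vector_derivative_diff[OF has_vector_derivative_mult[OF c hill_solD(1)[OF assms]]
        has_vector_derivative_mult[OF s hill_solD(2)[OF assms]]]
    by (simp add: algebra_simps)
  show "((\<lambda>t. of_real (sin t) * Z t + of_real (cos t) * W t) has_vector_derivative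
      of_real (e * cos t) * pert e (Z t) (W t)) (at t within {0..T})"
    using has_vector_derivative_add[OF has_vector_derivative_mult[OF s hill_solD(1)[OF assms]]
        has_vector_derivative_mult[OF c hill_solD(2)[OF assms]]]
    by (simp add: algebra_simps)
qed

section \<open>Symmetries of the solutions: sign change, time shift, reflected time reversal\<close>

lemma hill_sol_restrict: "hill_sol e T Z W \<Longrightarrow> T' \<le> T \<Longrightarrow> hill_sol e T' Z W"
  unfolding hill_sol_def
  by (meson atLeastAtMost_iff atLeastatMost_subset_iff has_vector_derivative_within_subset order_refl
      order_trans)

lemma pert_minus: "pert e (- z) (- w) = - pert e z w"
  by (simp add: pert_def algebra_simps)

lemma hill_sol_minus: "hill_sol e T Z W \<Longrightarrow> hill_sol e T (\<lambda>t. - Z t) (\<lambda>t. - W t)"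
proof -
  assume h: "hill_sol e T Z W"
  show ?thesis unfolding hill_sol_def pert_minus
  proof (intro ballI conjI)
    fix t assume t: "t \<in> {0..T}"
    show "((\<lambda>t. - Z t) has_vector_derivative - W t) (at t within {0..T})"
      by (intro derivative_intros hill_solD[OF h t])
    show "((\<lambda>t. - W t) has_vector_derivative - (- Z t) + of_real e * (- pert e (Z t) (W t))) (at t within {0..T})"
      using has_vector_derivative_minus[OF hill_solD(2)[OF h t]] by (simp add: algebra_simps)
  qed (use hill_solD(3)[OF h] in auto)
qed

lemma hill_sol_shift:
  assumes h: "hill_sol e T Z W" and r: "0 \<le> r"
  shows "hill_sol e (T - r) (\<lambda>t. Z (r + t)) (\<lambda>t. W (r + t))"
  unfolding hill_sol_def
proof (intro ballI conjI)
  fix t assume "t \<in> {0..T - r}"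
  then have t: "r + t \<in> {0..T}" using r by auto
  have sub: "(\<lambda>t. r + t) ` {0..T - r} \<subseteq> {0..T}" using r by auto
  have d: "((\<lambda>t. r + t) has_vector_derivative 1) (at t within {0..T - r})"
    by (auto intro!: derivative_eq_intros)
  show "((\<lambda>t. Z (r + t)) has_vector_derivative W (r + t)) (at t within {0..T - r})"
    using vector_diff_chain_within[OF d has_vector_derivative_within_subset[OF hill_solD(1)[OF h t] sub]]
    by (simp add: o_def)
  show "((\<lambda>t. W (r + t)) has_vector_derivative - Z (r + t) + of_real e * pert e (Z (r + t)) (W (r + t)))
      (at t within {0..T - r})"
    using vector_diff_chain_within[OF d has_vector_derivative_within_subset[OF hill_solD(2)[OF h t] sub]]
    by (simp add: o_def)
  show "(norm (W (r + t)))\<^sup>2 + (norm (Z (r + t)))\<^sup>2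
      = 1 + 3/16 * e\<^sup>2 * (norm (Z (r + t)))\<^sup>2 * (Re (Z (r + t) * Z (r + t)))\<^sup>2"
    using hill_solD(3)[OF h t] by simp
qed

text \<open>Reflection and time reversal each change the sign of the Coriolis term, so together they
  preserve it. Since \<open>c * c\<close> is 1 or -1, D at most changes sign, which the tidal term
  tolerates. After squaring, \<open>c\<close> = 1, -1 becomes the reflection in the x axis and
  \<open>c\<close> = \<i>, -\<i> the one in the y axis.\<close>

lemma pert_reverse:
  assumes "c \<in> {1, -1, \<i>, -\<i>}"
  shows "pert e (c * cnj z) (- (c * cnj w)) = c * cnj (pert e z w)"
    "(Re (c * cnj z * (c * cnj z)))\<^sup>2 = (Re (z * z))\<^sup>2"
  using assms by (auto simp: complex_eq_iff pert_def power2_eq_square field_simps)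

lemma hill_sol_reverse:
  assumes h: "hill_sol e T Z W" and c: "c \<in> {1, -1, \<i>, -\<i>}"
  shows "hill_sol e T (\<lambda>t. c * cnj (Z (T - t))) (\<lambda>t. - (c * cnj (W (T - t))))"
  unfolding hill_sol_def pert_reverse[OF c]
proof (intro ballI conjI)
  fix t assume "t \<in> {0..T}"
  then have t: "T - t \<in> {0..T}" by auto
  have sub: "(\<lambda>t. T - t) ` {0..T} \<subseteq> {0..T}" by auto
  have d: "((\<lambda>t. T - t) has_vector_derivative -1) (at t within {0..T})"
    by (auto intro!: derivative_eq_intros)
  have m: "((\<lambda>t. c * cnj (f (T - t))) has_vector_derivative - (c * cnj f')) (at t within {0..T})"
    if "(f has_vector_derivative f') (at (T - t) within {0..T})" for f f'
    using has_vector_derivative_mult_right[OF has_vector_derivative_cnj[OF vector_diff_chain_within[OF d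
      has_vector_derivative_within_subset[OF that sub]]], of c]
    by (simp add: o_def)
  show "((\<lambda>t. c * cnj (Z (T - t))) has_vector_derivative - (c * cnj (W (T - t)))) (at t within {0..T})"
    by (rule m[OF hill_solD(1)[OF h t]])
  show "((\<lambda>t. - (c * cnj (W (T - t)))) has_vector_derivative
      - (c * cnj (Z (T - t))) + of_real e * (c * cnj (pert e (Z (T - t)) (W (T - t))))) (at t within {0..T})"
    using has_vector_derivative_minus[OF m[OF hill_solD(2)[OF h t]]] by (simp add: algebra_simps)
  show "(norm (- (c * cnj (W (T - t)))))\<^sup>2 + (norm (c * cnj (Z (T - t))))\<^sup>2
      = 1 + 3/16 * e\<^sup>2 * (norm (c * cnj (Z (T - t))))\<^sup>2 * (Re (Z (T - t) * Z (T - t)))\<^sup>2"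
    using hill_solD(3)[OF h t] c by (auto simp: norm_mult)
qed

section \<open>Solutions ejected from the origin\<close>

lemma rotate_back:
  fixes z w b :: complex and t :: real
  assumes P: "norm (of_real (cos t) * z - of_real (sin t) * w) \<le> A"
    and Q: "norm (of_real (sin t) * z + of_real (cos t) * w - b) \<le> A"
  shows "norm (z - of_real (sin t) * b) \<le> 2 * A" "norm (w - of_real (cos t) * b) \<le> 2 * A"
proof -
  let ?c = "complex_of_real (cos t)" and ?s = "complex_of_real (sin t)"
  have cs: "?c * ?c + ?s * ?s = 1"
    by (metis of_real_1 of_real_add of_real_mult sin_cos_squared_add3)
  have eq: "z - ?s * b = ?c * (?c * z - ?s * w) + ?s * (?s * z + ?c * w - b)"
    "w - ?c * b = ?c * (?s * z + ?c * w - b) - ?s * (?c * z - ?s * w)"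
    using cs by algebra+
  have le: "norm (?c * x) \<le> A" "norm (?s * x) \<le> A" if "norm x \<le> A" for x
    using that mult_mono[of "\<bar>cos t\<bar>" 1 "norm x" A] mult_mono[of "\<bar>sin t\<bar>" 1 "norm x" A]
    by (auto simp: norm_mult)
  show "norm (z - ?s * b) \<le> 2 * A"
    unfolding eq using le[OF P] le[OF Q]
      norm_triangle_ineq[of "?c * (?c * z - ?s * w)" "?s * (?s * z + ?c * w - b)"] by linarith
  show "norm (w - ?c * b) \<le> 2 * A"
    unfolding eq using le[OF P] le[OF Q]
      norm_triangle_ineq4[of "?c * (?s * z + ?c * w - b)" "?s * (?c * z - ?s * w)"] by linarith
qed

lemma rotate_norm:
  fixes p q :: complex and t :: real
  shows "norm (of_real (cos t) * p + of_real (sin t) * q) \<le> norm (p, q)"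
    "norm (of_real (cos t) * q - of_real (sin t) * p) \<le> norm (p, q)"
proof -
  have "(norm (of_real c * p + of_real s * q))\<^sup>2 + (norm (of_real c * q - of_real s * p))\<^sup>2
      = (c * c + s * s) * ((norm p)\<^sup>2 + (norm q)\<^sup>2)" for c s :: real
    unfolding cmod_power2 by (simp add: power2_eq_square algebra_simps)
  then have *: "(norm (of_real (cos t) * p + of_real (sin t) * q))\<^sup>2
      + (norm (of_real (cos t) * q - of_real (sin t) * p))\<^sup>2 = (norm (p, q))\<^sup>2"
    by (simp add: norm_Pair)
  then have "(norm (of_real (cos t) * p + of_real (sin t) * q))\<^sup>2 \<le> (norm (p, q))\<^sup>2"
    "(norm (of_real (cos t) * q - of_real (sin t) * p))\<^sup>2 \<le> (norm (p, q))\<^sup>2"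
    using zero_le_power2[of "norm (of_real (cos t) * p + of_real (sin t) * q)"]
      zero_le_power2[of "norm (of_real (cos t) * q - of_real (sin t) * p)"] by linarith+
  then show "norm (of_real (cos t) * p + of_real (sin t) * q) \<le> norm (p, q)"
    "norm (of_real (cos t) * q - of_real (sin t) * p) \<le> norm (p, q)"
    by (auto intro: power2_le_imp_le)
qed

text \<open>Stated for components instead of \<open>hill_sol\<close>, because it serves to establish
  the energy conjunct of \<open>hill_sol\<close> for solutions found by the fixed point
  theorem.\<close>

lemma energy_derivative:
  fixes x y p q :: "real \<Rightarrow> real"
  assumes "(x has_real_derivative p t) (at t within A)" "(y has_real_derivative q t) (at t within A)"
    "(p has_real_derivative - x t + e * Re (pert e (Complex (x t) (y t)) (Complex (p t) (q t)))) (at t within A)"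
    "(q has_real_derivative - y t + e * Im (pert e (Complex (x t) (y t)) (Complex (p t) (q t)))) (at t within A)"
  shows "((\<lambda>t. (p t)\<^sup>2 + (q t)\<^sup>2 + ((x t)\<^sup>2 + (y t)\<^sup>2)
      - 3/16 * e\<^sup>2 * (((x t)\<^sup>2 + (y t)\<^sup>2) * ((x t)\<^sup>2 - (y t)\<^sup>2)\<^sup>2)) has_real_derivative 0) (at t within A)"
  by (rule assms derivative_eq_intros refl)+
    (unfold Re_pert Im_pert, simp add: power2_eq_square field_simps)

text \<open>\<open>N\<close> bounds the duration of all solutions considered; the numerical constants are far from optimal.\<close>

locale weak_hill =
  fixes e N :: real
  assumes e_pos: "0 < e" and N_ge: "4 \<le> N" and small: "10^10 * (e * N\<^sup>2) \<le> 1"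
begin

text \<open>The common error of all comparisons with the oscillator. Drift at speed
  \<open>40 * e\<close> during time \<open>N\<close>, doubled by \<open>rotate_back\<close>, gives
  \<open>80 * e * N\<close>; the comparison of two solutions costs another factor 4.\<close>

definition kap :: real where "kap = 320 * e * N"

lemma eN_small: "10^10 * (e * N) \<le> 1" "10^11 * e \<le> 1"
proof -
  have "e * N * 1 \<le> e * N * N" using e_pos N_ge by (intro mult_left_mono) auto
  then show "10^10 * (e * N) \<le> 1" using small by (simp add: power2_eq_square)
  have "N * N \<ge> 4 * 4" using N_ge by (intro mult_mono) auto
  then have "e * 16 \<le> e * N\<^sup>2" using e_pos by (simp add: power2_eq_square)
  then show "10^11 * e \<le> 1" using small by simp
qed

lemma kap_small: "0 < kap" "kap * N \<le> 32/10^9" "kap \<le> 8/10^9"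
proof -
  show "0 < kap" using e_pos N_ge by (simp add: kap_def)
  show *: "kap * N \<le> 32/10^9" using small by (simp add: kap_def power2_eq_square)
  have "kap * 4 \<le> kap * N" using \<open>0 < kap\<close> N_ge by simp
  then show "kap \<le> 8/10^9" using * by simp
qed

section \<open>Ejected solutions: a priori bounds, comparison with the oscillator, existence\<close>

definition launch :: "real \<Rightarrow> complex \<Rightarrow> (real \<Rightarrow> complex) \<Rightarrow> (real \<Rightarrow> complex) \<Rightarrow> bool" where
  "launch T b Z W \<longleftrightarrow> 0 \<le> T \<and> T \<le> N \<and> hill_sol e T Z W \<and> Z 0 = 0 \<and> W 0 = b"

lemma launchD:
  assumes "launch T b Z W"
  shows "0 \<le> T" "T \<le> N" "hill_sol e T Z W" "Z 0 = 0" "W 0 = b"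
  using assms by (auto simp: launch_def)

lemma launch_restrict: "launch T b Z W \<Longrightarrow> 0 \<le> T' \<Longrightarrow> T' \<le> T \<Longrightarrow> launch T' b Z W"
  using hill_sol_restrict by (auto simp: launch_def)

lemma launch_unit: "launch T b Z W \<Longrightarrow> norm b = 1"
  using hill_solD(3)[of e T Z W 0] norm_ge_zero[of b]
  by (auto simp: launch_def power2_eq_1_iff)

text \<open>The energy relation alone does not confine \<open>Z\<close>, because its right side
  grows with the sixth power of the distance. A barrier does: starting from 0, the squared distance
  would have to pass through 2, where the relation fails.\<close>

lemma launch_bounded:
  assumes "launch T b Z W" "t \<in> {0..T}"
  shows "norm (Z t) \<le> 3/2" "norm (W t) \<le> 3/2"
proof -
  note L = launchD[OF assms(1)]
  have e2: "e\<^sup>2 \<le> 1/100"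
    using eN_small(2) e_pos power_mono[of e "1/10" 2] by (simp add: power2_eq_square)
  have D: "(Re (z * z))\<^sup>2 \<le> ((norm z)\<^sup>2)\<^sup>2" for z :: complex
    by (metis abs_Re_le_cmod abs_ge_zero norm_mult power2_abs power2_eq_square power_mono)
  have en: "(norm (W s))\<^sup>2 + (norm (Z s))\<^sup>2 \<le> 1 + 3/1600 * ((norm (Z s))\<^sup>2)^3" if "s \<in> {0..T}" for s
  proof -
    have "3/16 * e\<^sup>2 * (norm (Z s))\<^sup>2 * (Re (Z s * Z s))\<^sup>2 \<le> 3/16 * (1/100) * (norm (Z s))\<^sup>2 * ((norm (Z s))\<^sup>2)\<^sup>2"
      by (intro mult_mono D e2) auto
    then show ?thesis using hill_solD(3)[OF L(3) that] by (simp add: power2_eq_square power3_eq_cube)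
  qed
  have R2: "(norm (Z s))\<^sup>2 < 2" if s: "s \<in> {0..T}" for s
  proof (rule ccontr)
    assume "\<not> (norm (Z s))\<^sup>2 < 2"
    moreover have "continuous_on {0..s} (\<lambda>s. (norm (Z s))\<^sup>2)"
      by (intro continuous_intros continuous_on_subset[OF hill_sol_continuous(1)[OF L(3)]]) (use s in auto)
    ultimately obtain r where "0 \<le> r" "r \<le> s" "(norm (Z r))\<^sup>2 = 2"
      using IVT'[of "\<lambda>s. (norm (Z s))\<^sup>2" 0 2 s] s L(4) by auto
    then have "(norm (W r))\<^sup>2 + 2 \<le> 1 + 3/1600 * 2^3" using en[of r] s by simp
    then show False using zero_le_power2[of "norm (W r)"] by simp
  qed
  have "((norm (Z t))\<^sup>2)^3 \<le> 8"
    using power_mono[OF less_imp_le[OF R2[OF assms(2)]], of 3] by simp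
  then have "(norm (W t))\<^sup>2 \<le> 9/4" "(norm (Z t))\<^sup>2 \<le> 9/4"
    using en[OF assms(2)] R2[OF assms(2)] zero_le_power2[of "norm (Z t)"] by linarith+
  then have "(norm (W t))\<^sup>2 \<le> (3/2)\<^sup>2" "(norm (Z t))\<^sup>2 \<le> (3/2)\<^sup>2"
    by (simp_all add: power2_eq_square)
  then show "norm (Z t) \<le> 3/2" "norm (W t) \<le> 3/2" by (auto intro: power2_le_imp_le)
qed

lemma launch_pert_bound:
  assumes "launch T b Z W" "t \<in> {0..T}"
  shows "norm (pert e (Z t) (W t)) \<le> 40"
proof -
  have "lip_pair 0 2 (Z t) (Z t)" "lip_pair 0 2 (W t) (W t)"
    using launch_bounded[OF assms] by (auto simp: lip_pair_def)
  then show ?thesis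
    using pert_lip(1)[of e 0 "Z t" "Z t" "W t" "W t"] e_pos eN_small(2) by (auto simp: lip_pair_def)
qed

lemma norm_trig_mult_le:
  assumes "norm x \<le> B"
  shows "norm (of_real (- e * sin t) * x :: complex) \<le> e * B" "norm (of_real (e * cos t) * x :: complex) \<le> e * B"
proof -
  have "\<bar>e * sin t\<bar> \<le> e * 1" "\<bar>e * cos t\<bar> \<le> e * 1"
    using e_pos by (auto simp: abs_mult)
  then have "\<bar>e * sin t\<bar> * norm x \<le> e * B" "\<bar>e * cos t\<bar> * norm x \<le> e * B"
    using order_trans[OF norm_ge_zero assms] e_pos by (auto intro!: mult_mono assms)
  moreover have "norm (of_real (- e * sin t) * x) = \<bar>e * sin t\<bar> * norm x"
    "norm (of_real (e * cos t) * x) = \<bar>e * cos t\<bar> * norm x"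
    by (simp_all add: norm_mult abs_mult)
  ultimately show "norm (of_real (- e * sin t) * x) \<le> e * B" "norm (of_real (e * cos t) * x) \<le> e * B"
    by (simp_all only:)
qed

lemma launch_close:
  assumes l: "launch T b Z W" and t: "t \<in> {0..T}"
  shows "norm (Z t - of_real (sin t) * b) \<le> kap" "norm (W t - of_real (cos t) * b) \<le> kap"
proof -
  note L = launchD[OF l]
  have 0: "0 \<in> {0..T}" using L by simp
  have tN: "e * 40 * \<bar>t - 0\<bar> \<le> 40 * e * N" using t L e_pos by simp
  have P: "norm (of_real (cos t) * Z t - of_real (sin t) * W t) \<le> 40 * e * N"
    using order_trans[OF vector_derivative_bound[OF hill_sol_slow_deriv(1)[OF L(3)]
        norm_trig_mult_le(1)[OF launch_pert_bound[OF l]] t 0] tN] L by simp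
  have Q: "norm (of_real (sin t) * Z t + of_real (cos t) * W t - b) \<le> 40 * e * N"
    using order_trans[OF vector_derivative_bound[OF hill_sol_slow_deriv(2)[OF L(3)]
        norm_trig_mult_le(2)[OF launch_pert_bound[OF l]] t 0] tN] L by simp
  have "2 * (40 * e * N) \<le> kap" using e_pos N_ge by (simp add: kap_def)
  then show "norm (Z t - of_real (sin t) * b) \<le> kap" "norm (W t - of_real (cos t) * b) \<le> kap"
    using rotate_back[OF P Q] by linarith+
qed

lemma launch_diff:
  assumes l1: "launch T b1 Z1 W1" and l2: "launch T b2 Z2 W2" and t: "t \<in> {0..T}"
  shows "norm ((Z1 t - Z2 t) - of_real (sin t) * (b1 - b2)) \<le> kap * norm (b1 - b2)"
    and "norm ((W1 t - W2 t) - of_real (cos t) * (b1 - b2)) \<le> kap * norm (b1 - b2)"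
proof -
  note L1 = launchD[OF l1] and L2 = launchD[OF l2]
  have 0: "0 \<in> {0..T}" using L1 by simp
  \<comment> \<open>In place of a Gronwall inequality: the maximum \<open>m\<close> of the
    difference controls the forcing, and the resulting inequality for \<open>m\<close> itself closes
    because \<open>e * N\<close> is small.\<close>
  define d where "d = (\<lambda>t. norm (Z1 t - Z2 t) + norm (W1 t - W2 t))"
  have "continuous_on {0..T} d" unfolding d_def
    by (intro continuous_intros hill_sol_continuous[OF L1(3)] hill_sol_continuous[OF L2(3)])
  then obtain r where r: "r \<in> {0..T}" "\<And>s. s \<in> {0..T} \<Longrightarrow> d s \<le> d r"
    using continuous_attains_sup[of "{0..T}" d] 0 by auto
  define m where "m = d r"
  have m0: "0 \<le> m" by (simp add: m_def d_def)
  have pb: "norm (pert e (Z1 s) (W1 s) - pert e (Z2 s) (W2 s)) \<le> 40 * m" if s: "s \<in> {0..T}" for s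
  proof -
    have "norm (Z1 s - Z2 s) \<le> m" "norm (W1 s - W2 s) \<le> m"
      using r(2)[OF s] norm_ge_zero[of "Z1 s - Z2 s"] norm_ge_zero[of "W1 s - W2 s"]
      unfolding m_def d_def by linarith+
    then have "lip_pair m 2 (Z1 s) (Z2 s)" "lip_pair m 2 (W1 s) (W2 s)"
      using launch_bounded[OF l1 s] launch_bounded[OF l2 s] m0 by (auto simp: lip_pair_def)
    then show ?thesis using pert_lip(1)[OF _ _ m0] e_pos eN_small(2) by (auto simp: lip_pair_def)
  qed
  have *: "norm ((Z1 s - Z2 s) - of_real (sin s) * (b1 - b2)) \<le> 80 * e * N * m \<and>
      norm ((W1 s - W2 s) - of_real (cos s) * (b1 - b2)) \<le> 80 * e * N * m" if s: "s \<in> {0..T}" for s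
  proof -
    have sN: "e * (40 * m) * \<bar>s - 0\<bar> \<le> 40 * e * N * m"
      using s L1 e_pos m0 mult_left_mono[of s N "e * (40 * m)"] by (simp add: mult_ac)
    have "norm ((of_real (cos s) * Z1 s - of_real (sin s) * W1 s)
        - (of_real (cos s) * Z2 s - of_real (sin s) * W2 s) -
      ((of_real (cos 0) * Z1 0 - of_real (sin 0) * W1 0)
        - (of_real (cos 0) * Z2 0 - of_real (sin 0) * W2 0))) \<le> e * (40 * m) * \<bar>s - 0\<bar>"
    proof (rule vector_derivative_bound[OF has_vector_derivative_diff[OF
          hill_sol_slow_deriv(1)[OF L1(3)] hill_sol_slow_deriv(1)[OF L2(3)]] _ s 0])
      fix t assume "t \<in> {0..T}"
      then show "norm (of_real (- e * sin t) * pert e (Z1 t) (W1 t) - of_real (- e * sin t) * pert e (Z2 t) (W2 t))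
        \<le> e * (40 * m)"
        using norm_trig_mult_le(1)[OF pb] by (simp only: right_diff_distrib)
    qed
    then have P: "norm (of_real (cos s) * (Z1 s - Z2 s) - of_real (sin s) * (W1 s - W2 s)) \<le> 40 * e * N * m"
      using sN L1 L2 by (simp add: algebra_simps)
    have "norm ((of_real (sin s) * Z1 s + of_real (cos s) * W1 s)
        - (of_real (sin s) * Z2 s + of_real (cos s) * W2 s) -
      ((of_real (sin 0) * Z1 0 + of_real (cos 0) * W1 0)
        - (of_real (sin 0) * Z2 0 + of_real (cos 0) * W2 0))) \<le> e * (40 * m) * \<bar>s - 0\<bar>"
    proof (rule vector_derivative_bound[OF has_vector_derivative_diff[OF
          hill_sol_slow_deriv(2)[OF L1(3)] hill_sol_slow_deriv(2)[OF L2(3)]] _ s 0])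
      fix t assume "t \<in> {0..T}"
      then show "norm (of_real (e * cos t) * pert e (Z1 t) (W1 t) - of_real (e * cos t) * pert e (Z2 t) (W2 t))
        \<le> e * (40 * m)"
        using norm_trig_mult_le(2)[OF pb] by (simp only: right_diff_distrib)
    qed
    then have Q: "norm (of_real (sin s) * (Z1 s - Z2 s) + of_real (cos s) * (W1 s - W2 s) - (b1 - b2))
        \<le> 40 * e * N * m"
      using sN L1 L2 by (simp add: algebra_simps)
    show ?thesis using rotate_back[OF P Q] by simp
  qed
  have tr: "norm (x * b) \<le> norm b" if "norm x \<le> 1" for x b :: complex
    using mult_right_mono[OF that, of "norm b"] by (simp add: norm_mult)
  have "norm (Z1 r - Z2 r) \<le> norm (b1 - b2) + 80 * e * N * m"
    "norm (W1 r - W2 r) \<le> norm (b1 - b2) + 80 * e * N * m"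
    using *[OF r(1)] tr[of "of_real (sin r)" "b1 - b2"] tr[of "of_real (cos r)" "b1 - b2"]
      norm_triangle_sub[of "Z1 r - Z2 r" "of_real (sin r) * (b1 - b2)"]
      norm_triangle_sub[of "W1 r - W2 r" "of_real (cos r) * (b1 - b2)"]
    by (auto simp: norm_minus_commute)
  then have "m \<le> 2 * norm (b1 - b2) + 160 * (e * N * m)" unfolding m_def d_def by linarith
  moreover have "160 * (e * N * m) \<le> 1/2 * m"
    using mult_right_mono[OF eN_small(1) m0] m0 by simp
  ultimately have "m \<le> 4 * norm (b1 - b2)" by linarith
  then have "80 * e * N * m \<le> 80 * e * N * (4 * norm (b1 - b2))"
    using e_pos N_ge by (intro mult_left_mono) auto
  then have "80 * e * N * m \<le> kap * norm (b1 - b2)" by (simp add: kap_def)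
  then show "norm ((Z1 t - Z2 t) - of_real (sin t) * (b1 - b2)) \<le> kap * norm (b1 - b2)"
    and "norm ((W1 t - W2 t) - of_real (cos t) * (b1 - b2)) \<le> kap * norm (b1 - b2)"
    using *[OF t] by linarith+
qed

lemma launch_exists:
  assumes b: "norm b = 1"
  obtains Z W where "launch N b Z W"
proof -
  \<comment> \<open>The perturbation is polynomial, hence only locally Lipschitz. The projection to
    a ball is nonexpansive and makes it globally Lipschitz with the same constant. The slow
    coordinates start at norm 1 and move by at most 1/2 in time \<open>N\<close>, so radius 3/2
    makes the truncation invisible.\<close>
  define B where "B = cball (0 :: complex \<times> complex) (3/2)"
  have B: "convex B" "closed B" "B \<noteq> {}" by (auto simp: B_def)
  define cp where "cp = closest_point B"
  define zz where "zz = (\<lambda>(t::real) (y :: complex \<times> complex). of_real (cos t) * fst y + of_real (sin t) * snd y)"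
  define ww where "ww = (\<lambda>(t::real) (y :: complex \<times> complex). of_real (cos t) * snd y - of_real (sin t) * fst y)"
  define p where "p = (\<lambda>t y. pert e (zz t y) (ww t y))"
  define f where "f = (\<lambda>t y. (of_real (- e * sin t) * p t (cp y), of_real (e * cos t) * p t (cp y)))"
  have nz: "norm (zz t y) \<le> norm y" "norm (ww t y) \<le> norm y" for t y
    using rotate_norm[where p = "fst y" and q = "snd y"] by (auto simp: zz_def ww_def)
  have cpB: "norm (cp y) \<le> 3/2" for y
    using closest_point_in_set[OF B(2,3), of y] by (simp add: B_def cp_def)
  have plip: "norm (p t (cp x)) \<le> 40 \<and> norm (p t (cp x) - p t (cp y)) \<le> 40 * norm (x - y)" for t x y
  proof -
    have d: "norm (cp x - cp y) \<le> norm (x - y)"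
      using closest_point_lipschitz[OF B, of x y] by (simp add: cp_def dist_norm)
    have "zz t x - zz t y = zz t (x - y)" "ww t x - ww t y = ww t (x - y)" for x y
      by (simp_all add: zz_def ww_def algebra_simps)
    then have "norm (zz t (cp x) - zz t (cp y)) \<le> norm (x - y)" "norm (ww t (cp x) - ww t (cp y)) \<le> norm (x - y)"
      using nz[of t "cp x - cp y"] d by auto
    then have "lip_pair (norm (x - y)) 2 (zz t (cp x)) (zz t (cp y))"
      "lip_pair (norm (x - y)) 2 (ww t (cp x)) (ww t (cp y))"
      using nz[of t "cp x"] nz[of t "cp y"] cpB[of x] cpB[of y] norm_ge_zero[of "x - y"]
      unfolding lip_pair_def by linarith+
    then show ?thesis
      using pert_lip(1)[of e "norm (x - y)"] e_pos eN_small(2) by (auto simp: lip_pair_def p_def)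
  qed
  have np: "norm (u, v) \<le> norm u + norm v" for u v :: complex
    by (simp add: norm_Pair sqrt_sum_squares_le_sum)
  have fb: "norm (f t x) \<le> 80 * e" for t x
    using np[of "of_real (- e * sin t) * p t (cp x)" "of_real (e * cos t) * p t (cp x)"]
      norm_trig_mult_le[of "p t (cp x)" 40 t] plip[of t x] by (simp add: f_def)
  have flip: "norm (f t x - f t y) \<le> (80 * e) * norm (x - y)" for t x y
    using np[of "of_real (- e * sin t) * (p t (cp x) - p t (cp y))" "of_real (e * cos t) * (p t (cp x) - p t (cp y))"]
      norm_trig_mult_le[of "p t (cp x) - p t (cp y)" "40 * norm (x - y)" t] plip[of t x y]
    by (simp add: f_def algebra_simps)
  have "continuous_on ({0..N} \<times> UNIV) (\<lambda>(t, y). f t y)"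
    unfolding f_def p_def pert_def zz_def ww_def cp_def split_beta
    by (intro continuous_intros continuous_on_compose2[OF continuous_on_closest_point[OF B, of UNIV]]) auto
  moreover have "(80 * e) * N < 1" using eN_small(1) by simp
  ultimately obtain y where y0: "y 0 = (0, b)"
    and y: "\<And>t. t \<in> {0..N} \<Longrightarrow> (y has_vector_derivative f t (y t)) (at t within {0..N})"
    using small_time_picard[of N f "80 * e" "(0, b)"] flip N_ge e_pos by auto
  define P Q where "P = (\<lambda>t. fst (y t))" and "Q = (\<lambda>t. snd (y t))"
  define Z W where "Z = (\<lambda>t. of_real (cos t) * P t + of_real (sin t) * Q t)"
    and "W = (\<lambda>t. of_real (cos t) * Q t - of_real (sin t) * P t)"
  have cpy: "cp (y t) = y t" if t: "t \<in> {0..N}" for t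
  proof -
    have "norm (y t - y 0) \<le> 80 * e * \<bar>t - 0\<bar>"
      by (rule vector_derivative_bound[OF y fb t]) (use N_ge in auto)
    also have "\<dots> \<le> 80 * e * N" using t e_pos by simp
    also have "\<dots> \<le> 1/2" using eN_small(1) by simp
    finally have "norm (y t) \<le> 3/2"
      using norm_triangle_sub[of "y t" "y 0"] b by (simp add: y0 norm_Pair)
    then show ?thesis by (simp add: cp_def B_def closest_point_self)
  qed
  have der: "(Z has_vector_derivative W t) (at t within {0..N})"
    "(W has_vector_derivative - Z t + of_real e * pert e (Z t) (W t)) (at t within {0..N})"
    if t: "t \<in> {0..N}" for t
  proof -
    have pz: "p t (y t) = pert e (Z t) (W t)" by (simp add: p_def zz_def ww_def Z_def W_def P_def Q_def)
    have dP: "(P has_vector_derivative of_real (- e * sin t) * pert e (Z t) (W t)) (at t within {0..N})"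
      and dQ: "(Q has_vector_derivative of_real (e * cos t) * pert e (Z t) (W t)) (at t within {0..N})"
      using bounded_linear.has_vector_derivative[OF bounded_linear_fst y[OF t]]
        bounded_linear.has_vector_derivative[OF bounded_linear_snd y[OF t]]
      by (simp_all add: P_def Q_def f_def cpy[OF t] pz)
    have c: "((\<lambda>t. complex_of_real (cos t)) has_vector_derivative of_real (- sin t)) (at t within {0..N})"
      and s: "((\<lambda>t. complex_of_real (sin t)) has_vector_derivative of_real (cos t)) (at t within {0..N})"
      by (auto intro!: has_vector_derivative_of_real derivative_eq_intros)
    have cs: "complex_of_real (cos t) * of_real (cos t) + of_real (sin t) * of_real (sin t) = 1"
      by (metis of_real_1 of_real_add of_real_mult sin_cos_squared_add3)
    show "(Z has_vector_derivative W t) (at t within {0..N})"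
      using has_vector_derivative_add[OF has_vector_derivative_mult[OF c dP] has_vector_derivative_mult[OF s dQ]]
      unfolding Z_def W_def by (simp add: algebra_simps)
    have "of_real (cos t) * (of_real (e * cos t) * pert e (Z t) (W t)) + of_real (- sin t) * Q t -
        (of_real (sin t) * (of_real (- e * sin t) * pert e (Z t) (W t)) + of_real (cos t) * P t)
        = - (of_real (cos t) * P t + of_real (sin t) * Q t) + of_real e * pert e (Z t) (W t)"
      using cs unfolding of_real_mult of_real_minus by algebra
    then have eq: "of_real (cos t) * (of_real (e * cos t) * pert e (Z t) (W t)) + of_real (- sin t) * Q t -
        (of_real (sin t) * (of_real (- e * sin t) * pert e (Z t) (W t)) + of_real (cos t) * P t)
        = - Z t + of_real e * pert e (Z t) (W t)"
      by (simp only: Z_def)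
    have "((\<lambda>t. of_real (cos t) * Q t - of_real (sin t) * P t) has_vector_derivative
        - Z t + of_real e * pert e (Z t) (W t)) (at t within {0..N})"
      by (rule has_vector_derivative_eq_rhs[OF has_vector_derivative_diff[OF
          has_vector_derivative_mult[OF c dQ] has_vector_derivative_mult[OF s dP]] eq])
    then show "(W has_vector_derivative - Z t + of_real e * pert e (Z t) (W t)) (at t within {0..N})"
      by (simp only: W_def[symmetric])
  qed
  have init: "Z 0 = 0" "W 0 = b" by (simp_all add: Z_def W_def P_def Q_def y0)
  define E where "E = (\<lambda>t. (Re (W t))\<^sup>2 + (Im (W t))\<^sup>2 + ((Re (Z t))\<^sup>2 + (Im (Z t))\<^sup>2)
      - 3/16 * e\<^sup>2 * (((Re (Z t))\<^sup>2 + (Im (Z t))\<^sup>2) * ((Re (Z t))\<^sup>2 - (Im (Z t))\<^sup>2)\<^sup>2))"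
  have E': "(E has_real_derivative 0) (at t within {0..N})" if t: "t \<in> {0..N}" for t
    unfolding E_def
    by (rule energy_derivative) (use der[OF t] in \<open>auto simp: has_vector_derivative_complex_iff\<close>)
  have E1: "E t = 1" if t: "t \<in> {0..N}" for t
  proof -
    have "norm (E t - E 0) \<le> 0 * \<bar>t - 0\<bar>"
      by (rule vector_derivative_bound[of 0 N _ "\<lambda>_. 0"])
        (use E' t N_ge in \<open>auto simp: has_real_derivative_iff_has_vector_derivative\<close>)
    moreover have "E 0 = 1" using b by (simp add: E_def init flip: cmod_power2)
    ultimately show ?thesis by simp
  qed
  have en: "(norm (W t))\<^sup>2 + (norm (Z t))\<^sup>2 = 1 + 3/16 * e\<^sup>2 * (norm (Z t))\<^sup>2 * (Re (Z t * Z t))\<^sup>2"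
    if "t \<in> {0..N}" for t
  proof -
    have D: "Re (Z t * Z t) = (Re (Z t))\<^sup>2 - (Im (Z t))\<^sup>2" by (simp add: power2_eq_square)
    show ?thesis using E1[OF that] unfolding E_def cmod_power2 D mult.assoc by linarith
  qed
  have "launch N b Z W"
    using N_ge init der en by (auto simp: launch_def hill_sol_def)
  then show thesis by (rule that)
qed

end

section \<open>Angular momentum and critical points of the distance\<close>

lemma abs_sin_ge_half:
  fixes x :: real
  assumes "\<bar>x\<bar> \<le> 1"
  shows "\<bar>x\<bar> / 2 \<le> \<bar>sin x\<bar>"
proof -
  have *: "y / 2 \<le> sin y" if y: "0 \<le> y" "y \<le> 1" for y :: real
  proof -
    have "1/2 * (y - 0) \<le> sin y - sin 0"
    proof (rule derivative_lower_bound)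
      fix t assume "t \<in> {0..y}"
      then have "cos (pi / 3) \<le> cos t" using y pi_gt3 by (intro cos_monotone_0_pi_le) auto
      then show "1/2 \<le> cos t" by (simp add: cos_60)
    qed (use y in \<open>auto intro!: derivative_eq_intros\<close>)
    then show ?thesis by simp
  qed
  show ?thesis using *[of x] *[of "- x"] assms by (cases "0 \<le> x") auto
qed

lemma abs_le_of_sin_small:
  fixes x :: real
  assumes x: "\<bar>x\<bar> \<le> pi / 2" and s: "\<bar>sin x\<bar> \<le> s" "s < 1/2"
  shows "\<bar>x\<bar> \<le> 2 * s"
proof -
  have "\<bar>x\<bar> \<le> pi / 6"
  proof (rule ccontr)
    assume "\<not> \<bar>x\<bar> \<le> pi / 6"
    then have "sin (pi / 6) \<le> sin \<bar>x\<bar>" using x by (intro sin_monotone_2pi_le) auto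
    moreover have "sin \<bar>x\<bar> \<le> \<bar>sin x\<bar>" by (cases "0 \<le> x") auto
    ultimately show False using s by (simp add: sin_30)
  qed
  then show ?thesis using abs_sin_ge_half[of x] pi_less_4 s by auto
qed

lemma nearest_multiple_pi:
  fixes y :: real
  obtains j :: int where "\<bar>y - of_int j * pi\<bar> \<le> pi / 2" "\<bar>sin (y - of_int j * pi)\<bar> = \<bar>sin y\<bar>"
proof -
  define j where "j = round (y / pi)"
  have "\<bar>y / pi - of_int j\<bar> \<le> 1/2"
    using of_int_round_abs_le[of "y / pi"] by (simp add: j_def abs_minus_commute)
  then have "\<bar>y / pi - of_int j\<bar> * pi \<le> 1/2 * pi" by (intro mult_right_mono) auto
  moreover have "\<bar>y / pi - of_int j\<bar> * pi = \<bar>y - of_int j * pi\<bar>"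
    by (simp add: abs_mult[symmetric, of _ pi, simplified] field_simps)
  moreover have "\<bar>sin (y - of_int j * pi)\<bar> = \<bar>sin y\<bar>"
    by (simp add: sin_diff abs_mult mult.commute)
  ultimately show thesis using that[of j] by simp
qed

lemma unit_near_one:
  assumes "norm u = 1" "norm (u - 1) \<le> 1/20"
  obtains \<phi> where "u = cis \<phi>" "\<bar>\<phi>\<bar> \<le> 1/10"
proof -
  define \<phi> where "\<phi> = Arg u"
  have u: "u = cis \<phi>" using assms(1) by (metis \<phi>_def cis_Arg norm_zero sgn_eq zero_neq_one div_by_1 of_real_1)
  have "\<bar>Re (u - 1)\<bar> \<le> 1/20" "\<bar>Im (u - 1)\<bar> \<le> 1/20"
    using assms(2) abs_Re_le_cmod[of "u - 1"] abs_Im_le_cmod[of "u - 1"] by linarith+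
  then have c: "cos \<phi> > 0" and s: "\<bar>sin \<phi>\<bar> \<le> 1/20" by (auto simp: u)
  have "\<bar>\<phi>\<bar> \<le> pi" using mpi_less_Arg[of u] Arg_le_pi[of u] by (auto simp: \<phi>_def)
  have "\<bar>\<phi>\<bar> \<le> pi / 2"
  proof (rule ccontr)
    assume "\<not> \<bar>\<phi>\<bar> \<le> pi / 2"
    then have "cos \<bar>\<phi>\<bar> \<le> cos (pi / 2)" using \<open>\<bar>\<phi>\<bar> \<le> pi\<close> by (intro cos_monotone_0_pi_le) auto
    then show False using c by simp
  qed
  then show thesis using that[OF u] abs_le_of_sin_small[OF _ s] by simp
qed

lemma norm_cis_diff_le: "norm (cis x - cis y) \<le> \<bar>x - y\<bar>"
proof -
  have "norm (cis x - cis y) \<le> 1 * \<bar>x - y\<bar>"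
  proof (rule vector_derivative_bound[of "min x y" "max x y" cis "\<lambda>t. \<i> * cis t"])
    fix t
    show "(cis has_vector_derivative \<i> * cis t) (at t within {min x y..max x y})"
      by (auto simp: has_vector_derivative_complex_iff intro!: derivative_eq_intros)
  qed (auto simp: norm_mult)
  then show ?thesis by simp
qed

text \<open>The range 1/5 keeps 4 t below pi/3, where the cosine is at least 1/2. This is the
  quantitative simplicity of the roots of Im (b^4) that beats the Lipschitz error in
  \<open>ec_unique\<close>.\<close>

lemma sin4_expanding:
  fixes x y :: real
  assumes "\<bar>x\<bar> \<le> 1/5" "\<bar>y\<bar> \<le> 1/5"
  shows "2 * \<bar>x - y\<bar> \<le> \<bar>sin (4 * x) - sin (4 * y)\<bar>"
proof -
  have *: "2 * (y - x) \<le> sin (4 * y) - sin (4 * x)" if "x \<le> y" "\<bar>x\<bar> \<le> 1/5" "\<bar>y\<bar> \<le> 1/5" for x y :: real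
  proof (rule derivative_lower_bound[where f' = "\<lambda>t. 4 * cos (4 * t)"])
    fix t assume t: "t \<in> {x..y}"
    have "cos (pi / 3) \<le> cos \<bar>4 * t\<bar>"
      using t that pi_gt3 by (intro cos_monotone_0_pi_le) (auto simp: abs_if)
    then show "2 \<le> 4 * cos (4 * t)" by (simp add: cos_60)
    show "((\<lambda>t. sin (4 * t)) has_real_derivative 4 * cos (4 * t)) (at t within {x..y})"
      by (auto intro!: derivative_eq_intros)
  qed (use that in auto)
  show ?thesis using *[of x y] *[of y x] assms by (cases "x \<le> y") auto
qed

text \<open>The antiderivative of the sixth power of the sine that vanishes at 0; 5/16 is the mean
  of that power.\<close>

definition sin6 :: "real \<Rightarrow> real" where
  "sin6 t = 5/16 * t - (sin t)^5 * cos t / 6 - 5/24 * ((sin t)^3 * cos t) - 5/16 * (sin t * cos t)"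

lemma sin6_deriv: "(sin6 has_real_derivative (sin t)^6) (at t within A)"
proof -
  have cc: "cos t * cos t = 1 - sin t * sin t"
    using sin_cos_squared_add3[of t] by linarith
  have "(sin6 has_real_derivative 5/16 - (5 * (sin t)^4 * cos t * cos t - (sin t)^5 * sin t) / 6
      - 5/24 * (3 * (sin t)^2 * cos t * cos t - (sin t)^3 * sin t)
      - 5/16 * (cos t * cos t - sin t * sin t)) (at t within A)"
    unfolding sin6_def
    by (rule derivative_eq_intros refl | simp add: eval_nat_numeral field_simps)+
  moreover have "5/16 - (5 * (sin t)^4 * cos t * cos t - (sin t)^5 * sin t) / 6
      - 5/24 * (3 * (sin t)^2 * cos t * cos t - (sin t)^3 * sin t)
      - 5/16 * (cos t * cos t - sin t * sin t) = (sin t)^6"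
    unfolding mult.assoc cc by (simp add: eval_nat_numeral field_simps)
  ultimately show ?thesis by simp
qed

lemma abs_sin_pow_cos_le: "\<bar>(sin t)^k * cos t\<bar> \<le> (1::real)"
  using mult_mono[of "\<bar>(sin t)^k\<bar>" 1 "\<bar>cos t\<bar>" 1] power_le_one[of "\<bar>sin t\<bar>" k]
  by (simp add: abs_mult power_abs)

text \<open>11/16 = 1/6 + 5/24 + 5/16, the sum of the coefficients of the periodic terms.\<close>

lemma sin6_bounds: "5/16 * t - 11/16 \<le> sin6 t" "sin6 t \<le> 5/16 * t + 11/16"
  using abs_sin_pow_cos_le[of t 5] abs_sin_pow_cos_le[of t 3] abs_sin_pow_cos_le[of t 1]
  unfolding sin6_def power_one_right abs_le_iff by linarith+

text \<open>The antiderivative of sin^2 cos^2 that vanishes at 0. Multiplied by \<open>e\<close> it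
  is, to first order, the angle by which the Coriolis term has turned the direction.\<close>

definition sc2 :: "real \<Rightarrow> real" where
  "sc2 t = t / 8 - sin t * cos t * (1 - 2 * (sin t * sin t)) / 8"

lemma sc2_deriv: "(sc2 has_real_derivative (sin t)^2 * (cos t)^2) (at t within A)"
proof -
  have cc: "cos t * cos t = 1 - sin t * sin t"
    using sin_cos_squared_add3[of t] by linarith
  have "(sc2 has_real_derivative 1/8 - ((cos t * cos t - sin t * sin t) * (1 - 2 * (sin t * sin t))
      - 4 * (sin t * sin t) * (cos t * cos t)) / 8) (at t within A)"
    unfolding sc2_def
    by (rule derivative_eq_intros refl | simp add: field_simps)+
  moreover have "1/8 - ((cos t * cos t - sin t * sin t) * (1 - 2 * (sin t * sin t))
      - 4 * (sin t * sin t) * (cos t * cos t)) / 8 = (sin t)^2 * (cos t)^2"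
    unfolding power2_eq_square cc by (simp add: field_simps)
  ultimately show ?thesis by simp
qed

lemma sc2_ge: "(t - 1) / 8 \<le> sc2 t"
proof -
  have 1: "\<bar>sin t * cos t\<bar> \<le> 1" using abs_sin_pow_cos_le[of t 1] by simp
  have "sin t * sin t \<le> 1" "0 \<le> sin t * sin t"
    using sin_cos_squared_add3[of t] zero_le_square[of "cos t"] by (linarith, simp)
  then have 2: "\<bar>1 - 2 * (sin t * sin t)\<bar> \<le> 1" by linarith
  have "\<bar>sin t * cos t * (1 - 2 * (sin t * sin t))\<bar> \<le> 1"
    using mult_mono[OF 1 2] by (simp add: abs_mult)
  then show ?thesis by (simp add: sc2_def abs_le_iff field_simps)
qed

section \<open>The integrand \<open>h6\<close> near harmonic solutions\<close>

lemma h6_scaled: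
  assumes "norm b = 1"
  shows "h6 (of_real s * b) = s^6 * Im (b^4) / 4"
proof -
  have bb: "b * cnj b = 1" using assms by (simp add: complex_norm_square[symmetric])
  have "(of_real s * b * (of_real s * b)) * (of_real s * b * (of_real s * b)) *
      (of_real s * b * cnj (of_real s * b)) = of_real (s^6) * (b^4 * (b * cnj b))"
    by (simp add: eval_nat_numeral mult_ac)
  then show ?thesis unfolding h6_def by (simp add: bb del: of_real_power)
qed

lemma norm_h6: "\<bar>h6 z\<bar> \<le> (norm z)^6 / 4"
proof -
  have "norm (z * z * (z * z) * (z * cnj z)) = (norm z)^6"
    by (simp add: norm_mult eval_nat_numeral mult_ac)
  then show ?thesis using abs_Im_le_cmod[of "z * z * (z * z) * (z * cnj z)"] by (simp add: h6_def)
qed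

text \<open>Six factors with constant 2 and five products, each contributing a factor 4, give 2^16 =
  65536; the division by 4 in \<open>h6\<close> leaves 16384.\<close>

lemma h6_quad:
  assumes q: "lip_quad k d 2 z1 z2 a1 a2" and dk: "0 \<le> d" "0 \<le> k"
  shows "\<bar>h6 z1 - h6 a1\<bar> \<le> 16384 * k" "\<bar>(h6 z1 - h6 z2) - (h6 a1 - h6 a2)\<bar> \<le> 16384 * k * d"
proof -
  let ?f = "\<lambda>z. z * z * (z * z) * (z * cnj z)"
  note m = lip_quad_mult[OF _ _ dk]
  have "lip_quad k d 65536 (?f z1) (?f z2) (?f a1) (?f a2)"
    using m[OF m[OF m[OF q q] m[OF q q]] m[OF q lip_quad_cnj[OF q]]] by simp
  then have "norm (?f z1 - ?f a1) \<le> 65536 * k" "norm ((?f z1 - ?f z2) - (?f a1 - ?f a2)) \<le> 65536 * k * d"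
    by (auto simp: lip_quad_def lip_pair_def)
  then show "\<bar>h6 z1 - h6 a1\<bar> \<le> 16384 * k" "\<bar>(h6 z1 - h6 z2) - (h6 a1 - h6 a2)\<bar> \<le> 16384 * k * d"
    using abs_Im_le_cmod[of "?f z1 - ?f a1"] abs_Im_le_cmod[of "(?f z1 - ?f z2) - (?f a1 - ?f a2)"]
    unfolding h6_def minus_complex.sel by linarith+
qed

text \<open>At radius pi/8 the doubled angle stays within pi/4 of a multiple of pi, and 7/10 < sqrt
  2 / 2. Even \<open>m\<close> marks the windows of minima of the distance, odd \<open>m\<close>
  those of maxima.\<close>

lemma window_cos:
  assumes "\<bar>t - real m * (pi / 2)\<bar> \<le> pi / 8"
  shows "7/10 \<le> (-1)^m * cos (2 * t)"
proof -
  define x where "x = t - real m * (pi / 2)"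
  have t: "2 * t = 2 * x + real m * pi" by (simp add: x_def field_simps)
  have "cos (2 * t) = (-1)^m * cos (2 * x)" unfolding t by (simp add: cos_add)
  moreover have "\<bar>2 * x\<bar> \<le> pi / 4"
    using assms[folded x_def] by (simp add: abs_mult)
  then have "cos (pi / 4) \<le> cos \<bar>2 * x\<bar>"
    by (intro cos_monotone_0_pi_le) auto
  moreover have "7/5 \<le> sqrt 2" by (rule real_le_rsqrt) (simp add: power2_eq_square)
  ultimately show ?thesis by (simp add: cos_45 flip: mult.assoc power_mult_distrib)
qed

context weak_hill
begin

section \<open>Momentum and radial velocity along ejected solutions\<close>

lemma launch_quad:
  assumes l1: "launch T b1 Z1 W1" and l2: "launch T b2 Z2 W2" and t: "t \<in> {0..T}"
  shows "lip_quad kap (norm (b1 - b2)) 2 (Z1 t) (Z2 t) (of_real (sin t) * b1) (of_real (sin t) * b2)"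
    and "lip_pair (norm (b1 - b2)) 2 (W1 t) (W2 t)"
proof -
  let ?d = "norm (b1 - b2)"
  have tr: "norm (of_real c * b) \<le> norm b" if "\<bar>c\<bar> \<le> 1" for c and b :: complex
    using mult_right_mono[OF that, of "norm b"] by (simp add: norm_mult)
  have k: "kap * ?d \<le> ?d" "0 \<le> kap * ?d"
    using mult_right_mono[of kap 1 ?d] kap_small by auto
  have s: "norm (of_real (sin t) * (b1 - b2)) \<le> ?d" "norm (of_real (cos t) * (b1 - b2)) \<le> ?d"
    by (auto intro!: tr)
  have Z: "norm (Z1 t - Z2 t) \<le> 2 * ?d" "norm (W1 t - W2 t) \<le> 2 * ?d"
    using launch_diff[OF l1 l2 t] s k
      norm_triangle_sub[of "Z1 t - Z2 t" "of_real (sin t) * (b1 - b2)"]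
      norm_triangle_sub[of "W1 t - W2 t" "of_real (cos t) * (b1 - b2)"]
    by linarith+
  show "lip_pair ?d 2 (W1 t) (W2 t)"
    using Z launch_bounded[OF l1 t] launch_bounded[OF l2 t] by (auto simp: lip_pair_def)
  have u: "norm (of_real (sin t) * b1) \<le> 2" "norm (of_real (sin t) * b2) \<le> 2"
    using tr[of "sin t" b1] tr[of "sin t" b2] launch_unit[OF l1] launch_unit[OF l2] by auto
  have "norm (of_real (sin t) * b1 - of_real (sin t) * b2) \<le> 2 * ?d"
    using s(1) norm_ge_zero[of "b1 - b2"] unfolding right_diff_distrib by linarith
  moreover have "norm (Z1 t - of_real (sin t) * b1) \<le> 2 * kap" "norm (Z2 t - of_real (sin t) * b2) \<le> 2 * kap"
    using launch_close(1)[OF l1 t] launch_close(1)[OF l2 t] kap_small(1) by linarith+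
  moreover have "norm (Z1 t - Z2 t - (of_real (sin t) * b1 - of_real (sin t) * b2)) \<le> 2 * kap * ?d"
    using launch_diff(1)[OF l1 l2 t] k unfolding right_diff_distrib by linarith
  ultimately show "lip_quad kap ?d 2 (Z1 t) (Z2 t) (of_real (sin t) * b1) (of_real (sin t) * b2)"
    using Z u launch_bounded[OF l1 t] launch_bounded[OF l2 t]
    by (auto simp: lip_pair_def lip_quad_def)
qed

lemma momF_0: "launch T b Z W \<Longrightarrow> momF e Z W 0 = 0"
  by (simp add: launch_def momF_def)

text \<open>The mixed bound of \<open>h6_quad\<close> integrated over time. The error carries both
  the small factor \<open>kap * N\<close> and the distance of the directions, which is what
  uniqueness requires.\<close>

lemma momF_diff:
  assumes l1: "launch T b1 Z1 W1" and l2: "launch T b2 Z2 W2" and t: "t \<in> {0..T}"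
  shows "\<bar>(momF e Z1 W1 t - momF e Z2 W2 t) - (Im (b1^4) - Im (b2^4)) / 4 * sin6 t\<bar>
      \<le> 16384 * kap * N * norm (b1 - b2)"
proof -
  define f where "f = (\<lambda>t. (momF e Z1 W1 t - momF e Z2 W2 t) - (Im (b1^4) - Im (b2^4)) / 4 * sin6 t)"
  have "norm (f t - f 0) \<le> 16384 * kap * norm (b1 - b2) * \<bar>t - 0\<bar>"
  proof (rule vector_derivative_bound)
    fix t assume t: "t \<in> {0..T}"
    show "(f has_vector_derivative (h6 (Z1 t) - h6 (Z2 t)) - (Im (b1^4) - Im (b2^4)) / 4 * (sin t)^6)
        (at t within {0..T})"
      unfolding f_def has_real_derivative_iff_has_vector_derivative[symmetric]
      using launchD(3)[OF l1] launchD(3)[OF l2] t e_pos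
      by (intro DERIV_diff hill_sol_momF_deriv DERIV_cmult sin6_deriv) auto
    have E: "(Im (b1^4) - Im (b2^4)) / 4 * (sin t)^6 = h6 (of_real (sin t) * b1) - h6 (of_real (sin t) * b2)"
      using h6_scaled launch_unit[OF l1] launch_unit[OF l2] by (simp add: field_simps)
    show "norm ((h6 (Z1 t) - h6 (Z2 t)) - (Im (b1^4) - Im (b2^4)) / 4 * (sin t)^6)
        \<le> 16384 * kap * norm (b1 - b2)"
      unfolding E real_norm_def
      by (rule h6_quad(2)[OF launch_quad(1)[OF l1 l2 t]]) (use kap_small(1) in auto)
  qed (use t launchD[OF l1] in auto)
  also have "\<dots> \<le> 16384 * kap * norm (b1 - b2) * N"
    using t launchD(2)[OF l1] kap_small(1) by (intro mult_left_mono) auto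
  finally show ?thesis using momF_0[OF l1] momF_0[OF l2] by (simp add: f_def mult_ac) (simp add: sin6_def)
qed

text \<open>6/10^4 rounds up 16384 * 32/10^9, the constant of \<open>h6_quad\<close> times the bound
  for \<open>kap * N\<close>.\<close>

lemma momF_close:
  assumes l: "launch T b Z W" and t: "t \<in> {0..T}"
  shows "\<bar>momF e Z W t - Im (b^4) / 4 * sin6 t\<bar> \<le> 6/10^4"
proof -
  define f where "f = (\<lambda>t. momF e Z W t - Im (b^4) / 4 * sin6 t)"
  have "norm (f t - f 0) \<le> 16384 * kap * \<bar>t - 0\<bar>"
  proof (rule vector_derivative_bound)
    fix t assume t: "t \<in> {0..T}"
    show "(f has_vector_derivative h6 (Z t) - Im (b^4) / 4 * (sin t)^6) (at t within {0..T})"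
      unfolding f_def has_real_derivative_iff_has_vector_derivative[symmetric]
      using launchD(3)[OF l] t e_pos
      by (intro DERIV_diff hill_sol_momF_deriv DERIV_cmult sin6_deriv) auto
    show "norm (h6 (Z t) - Im (b^4) / 4 * (sin t)^6) \<le> 16384 * kap"
      using h6_quad(1)[OF launch_quad(1)[OF l l t]] kap_small(1) h6_scaled[OF launch_unit[OF l], of "sin t"]
      by (simp add: mult_ac)
  qed (use t launchD[OF l] in auto)
  also have "\<dots> \<le> 16384 * kap * N"
    using t launchD(2)[OF l] kap_small(1) by (intro mult_left_mono) auto
  also have "\<dots> \<le> 6/10^4" using kap_small(2) by simp
  finally show ?thesis using momF_0[OF l] by (simp add: f_def sin6_def)
qed

lemma momF_lipschitz:
  assumes l: "launch T b Z W" and ab: "0 \<le> a" "a \<le> c" "c \<le> T"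
    and B: "\<And>t. t \<in> {a..c} \<Longrightarrow> \<bar>h6 (Z t)\<bar> \<le> B"
  shows "\<bar>momF e Z W a - momF e Z W c\<bar> \<le> B * (c - a)"
proof -
  have "norm (momF e Z W a - momF e Z W c) \<le> B * \<bar>a - c\<bar>"
  proof (rule vector_derivative_bound)
    fix t assume t: "t \<in> {a..c}"
    have "(momF e Z W has_vector_derivative h6 (Z t)) (at t within {0..T})"
      unfolding has_real_derivative_iff_has_vector_derivative[symmetric]
      using launchD(3)[OF l] t e_pos ab by (intro hill_sol_momF_deriv) auto
    then show "(momF e Z W has_vector_derivative h6 (Z t)) (at t within {a..c})"
      by (rule has_vector_derivative_within_subset) (use ab in auto)
    show "norm (h6 (Z t)) \<le> B" using B[OF t] by simp
  qed (use ab in auto)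
  then show ?thesis using ab by simp
qed

lemma rho_close:
  assumes l: "launch T b Z W" and t: "t \<in> {0..T}"
  shows "\<bar>rho Z W t - sin t * cos t\<bar> \<le> 4 * kap"
proof -
  have u: "norm b = 1" by (rule launch_unit[OF l])
  then have bb: "cnj b * b = 1" by (metis complex_norm_square mult.commute of_real_1 power_one)
  have eq: "cnj (Z t) * W t - of_real (sin t * cos t)
      = cnj (Z t - of_real (sin t) * b) * W t + of_real (sin t) * cnj b * (W t - of_real (cos t) * b)"
    using bb by (simp add: algebra_simps)
  have "norm (cnj (Z t - of_real (sin t) * b) * W t) \<le> kap * (3/2)"
    unfolding norm_mult complex_mod_cnj
    using launch_close[OF l t] launch_bounded[OF l t] kap_small(1) by (intro mult_mono) auto
  moreover have "norm (of_real (sin t) * cnj b * (W t - of_real (cos t) * b)) \<le> 1 * kap"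
    unfolding norm_mult using launch_close[OF l t] u kap_small(1) by (intro mult_mono) auto
  ultimately have "norm (cnj (Z t) * W t - of_real (sin t * cos t)) \<le> 4 * kap"
    unfolding eq
    using norm_triangle_ineq[of "cnj (Z t - of_real (sin t) * b) * W t"
        "of_real (sin t) * cnj b * (W t - of_real (cos t) * b)"] kap_small(1) by linarith
  then show ?thesis
    using abs_Re_le_cmod[of "cnj (Z t) * W t - of_real (sin t * cos t)"] by (simp add: rho_def)
qed

definition drho :: "(real \<Rightarrow> complex) \<Rightarrow> (real \<Rightarrow> complex) \<Rightarrow> real \<Rightarrow> real" where
  "drho Z W t = (norm (W t))\<^sup>2 - (norm (Z t))\<^sup>2 + e * Re (cnj (Z t) * pert e (Z t) (W t))"

lemma drho_close:
  assumes l: "launch T b Z W" and t: "t \<in> {0..T}"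
  shows "\<bar>drho Z W t - cos (2 * t)\<bar> \<le> 1/10"
proof -
  have u: "norm b = 1" by (rule launch_unit[OF l])
  have sq: "\<bar>(norm x)\<^sup>2 - c\<^sup>2\<bar> \<le> 1/100"
    if "norm (x - of_real c * b) \<le> kap" "norm x \<le> 3/2" "\<bar>c\<bar> \<le> 1" for x c
  proof -
    have "\<bar>norm x - \<bar>c\<bar>\<bar> \<le> kap"
      using norm_triangle_ineq3[of x "of_real c * b"] that(1) u by (simp add: norm_mult)
    moreover have "\<bar>norm x + \<bar>c\<bar>\<bar> \<le> 5/2" using that norm_ge_zero[of x] by linarith
    ultimately have "\<bar>norm x - \<bar>c\<bar>\<bar> * \<bar>norm x + \<bar>c\<bar>\<bar> \<le> kap * (5/2)"
      by (intro mult_mono) (use kap_small in auto)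
    moreover have "(norm x)\<^sup>2 - c\<^sup>2 = (norm x - \<bar>c\<bar>) * (norm x + \<bar>c\<bar>)"
      by (simp add: power2_eq_square algebra_simps)
    ultimately show ?thesis using kap_small by (simp add: abs_mult)
  qed
  have "norm (cnj (Z t) * pert e (Z t) (W t)) \<le> 3/2 * 40"
    unfolding norm_mult complex_mod_cnj
    using launch_bounded[OF l t] launch_pert_bound[OF l t] by (intro mult_mono) auto
  then have "\<bar>Re (cnj (Z t) * pert e (Z t) (W t))\<bar> \<le> 60"
    using abs_Re_le_cmod[of "cnj (Z t) * pert e (Z t) (W t)"] by linarith
  then have "\<bar>e * Re (cnj (Z t) * pert e (Z t) (W t))\<bar> \<le> e * 60"
    using e_pos by (simp only: abs_mult) (simp add: mult_left_mono)
  moreover have "e * 60 \<le> 1/100" using eN_small(2) e_pos by simp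
  ultimately have "\<bar>e * Re (cnj (Z t) * pert e (Z t) (W t))\<bar> \<le> 1/100" by linarith
  moreover have "\<bar>(norm (Z t))\<^sup>2 - (sin t)\<^sup>2\<bar> \<le> 1/100" "\<bar>(norm (W t))\<^sup>2 - (cos t)\<^sup>2\<bar> \<le> 1/100"
    using sq[OF launch_close(1)[OF l t] launch_bounded(1)[OF l t]]
      sq[OF launch_close(2)[OF l t] launch_bounded(2)[OF l t]] by auto
  ultimately show ?thesis unfolding drho_def cos_double by linarith
qed

text \<open>The derivative of \<open>rho\<close> is within 1/10 of cos (2 t), which in the window
  has the sign of \<open>(-1)^m\<close> and modulus at least 7/10. Hence a window contains at most
  one critical point, and its position is Lipschitz in the direction.\<close>

lemma rho_monotone:
  assumes l: "launch T b Z W" and ac: "0 \<le> a" "a \<le> c" "c \<le> T"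
    and win: "real m * (pi/2) - pi/8 \<le> a" "c \<le> real m * (pi/2) + pi/8"
  shows "1/2 * (c - a) \<le> (-1)^m * rho Z W c - (-1)^m * rho Z W a"
proof (rule derivative_lower_bound[OF _ _ ac(2)])
  fix t assume t: "t \<in> {a..c}"
  have "(rho Z W has_real_derivative drho Z W t) (at t within {0..T})"
    unfolding drho_def by (rule hill_sol_rho_deriv[OF launchD(3)[OF l]]) (use t ac in auto)
  then have "(rho Z W has_real_derivative drho Z W t) (at t within {a..c})"
    by (rule DERIV_subset) (use ac in auto)
  then show "((\<lambda>t. (-1)^m * rho Z W t) has_real_derivative (-1)^m * drho Z W t) (at t within {a..c})"
    by (rule DERIV_cmult)
  have "\<bar>drho Z W t - cos (2 * t)\<bar> \<le> 1/10" using drho_close[OF l] t ac by simp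
  moreover have "7/10 \<le> (-1)^m * cos (2 * t)"
  proof (rule window_cos)
    have "a \<le> t" "t \<le> c" using t by auto
    then show "\<bar>t - real m * (pi/2)\<bar> \<le> pi/8" using win unfolding abs_le_iff by linarith
  qed
  ultimately show "1/2 \<le> (-1)^m * drho Z W t"
    unfolding abs_le_iff by (cases "even m") auto
qed

text \<open>\<open>rho\<close> is close to sin (2 t) / 2, whose values at the two ends of the window
  are opposite and of modulus at least 7/20, well above the error.\<close>

lemma rho_zero_exists:
  assumes l: "launch T b Z W" and T: "real m * (pi/2) + pi/8 \<le> T" and m: "1 \<le> m"
  obtains t where "\<bar>t - real m * (pi/2)\<bar> \<le> pi/8" "rho Z W t = 0" "t < real m * (pi/2) + pi/8"
proof -
  define a c where "a = real m * (pi/2) - pi/8" and "c = real m * (pi/2) + pi/8"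
  have m': "pi/2 \<le> real m * (pi/2)" using m by simp
  then have ac: "0 \<le> a" "a \<le> c" "c \<le> T" using T pi_gt_zero by (auto simp: a_def c_def)
  have sc: "(-1)^m * (sin x * cos x) = sin (2 * (x - real m * (pi/2))) / 2" for x
  proof -
    have "2 * (x - real m * (pi/2)) = 2 * x - real m * pi" by (simp add: field_simps)
    then have "sin (2 * (x - real m * (pi/2))) = sin (2 * x) * (-1)^m" by (simp add: sin_diff)
    then show ?thesis by (simp add: sin_double)
  qed
  have "7/5 \<le> sqrt 2" by (rule real_le_rsqrt) (simp add: power2_eq_square)
  then have s: "7/10 \<le> sin (pi/4)" by (simp add: sin_45)
  have 1: "(-1)^m * (sin a * cos a) = - sin (pi/4) / 2" "(-1)^m * (sin c * cos c) = sin (pi/4) / 2"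
    unfolding sc by (simp_all add: a_def c_def)
  have 2: "\<bar>(-1)^m * rho Z W x - (-1)^m * (sin x * cos x)\<bar> \<le> 1/10" if "x \<in> {0..T}" for x
    using rho_close[OF l that] kap_small(3) by (simp add: abs_mult flip: right_diff_distrib)
  have "a \<in> {0..T}" "c \<in> {0..T}" using ac by auto
  from 2[OF this(1)] 2[OF this(2)] have sg: "(-1)^m * rho Z W a < 0" "0 < (-1)^m * rho Z W c"
    unfolding 1 abs_le_iff using s by linarith+
  have "continuous_on {0..T} (rho Z W)"
    using hill_sol_rho_deriv[OF launchD(3)[OF l]]
    by (meson DERIV_continuous continuous_on_eq_continuous_within)
  then have "continuous_on {a..c} (rho Z W)"
    by (rule continuous_on_subset) (use ac in auto)
  then have "continuous_on {a..c} (\<lambda>t. (-1)^m * rho Z W t)"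
    by (rule continuous_on_mult[OF continuous_on_const])
  then obtain t where t: "a \<le> t" "t \<le> c" "(-1)^m * rho Z W t = 0"
    using IVT'[of "\<lambda>t. (-1)^m * rho Z W t" a 0 c] less_imp_le[OF sg(1)] less_imp_le[OF sg(2)] ac(2)
    by blast
  have "t \<noteq> c" using t sg by auto
  then have "t < c" using t by simp
  moreover have "\<bar>t - real m * (pi/2)\<bar> \<le> pi/8"
    using t unfolding a_def c_def abs_le_iff by linarith
  ultimately show thesis using t(3) by (intro that[of t]) (auto simp: c_def)
qed

end

section \<open>Collision orbits\<close>

lemma window_cos_abs:
  fixes k :: nat
  assumes "\<bar>T - real k * pi\<bar> \<le> pi / 8"
  shows "9/10 \<le> \<bar>cos T\<bar>"
proof -
  have "7/10 \<le> (-1)^(2 * k) * cos (2 * T)"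
    by (rule window_cos) (use assms in \<open>simp add: field_simps\<close>)
  then have "(9/10)\<^sup>2 \<le> (cos T)\<^sup>2" by (simp add: cos_double_cos power2_eq_square)
  then have "\<bar>9/10\<bar> \<le> \<bar>cos T\<bar>" by (simp only: abs_le_square_iff)
  then show ?thesis by simp
qed

text \<open>7/8 pi > 21/8, and 5/16 * 21/8 - 11/16 = 17/128 > 1/8. The second bound keeps the
  coefficient of Im (b^4) in \<open>momF\<close> away from 0 at the critical time.\<close>

lemma window_ge:
  fixes k :: nat
  assumes "1 \<le> k" "\<bar>T - real k * pi\<bar> \<le> pi / 8"
  shows "21/8 \<le> T" "1/8 \<le> sin6 T"
proof -
  have "1 * pi \<le> real k * pi" using assms(1) by (intro mult_right_mono) auto
  then show "21/8 \<le> T" using assms(2) pi_gt3 unfolding abs_le_iff by linarith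
  then show "1/8 \<le> sin6 T" using sin6_bounds(1)[of T] by linarith
qed

text \<open>Half axes of the (x, y) plane. Levi-Civita coordinates enter through
  \<open>w * w\<close>: that it lies in this set means that \<open>w^4\<close> is 1 or -1, so these
  are the unit roots of Im (w^4) = 0 up to the sign of \<open>w\<close>.\<close>

definition axis_dirs :: "complex set" where "axis_dirs = {1, -1, \<i>, -\<i>}"

lemma axis_dirs_simps:
  assumes "c \<in> axis_dirs"
  shows "norm c = 1" "c * cnj c = 1" "c * c = 1 \<or> c * c = -1" "- c \<in> axis_dirs"
  using assms by (auto simp: axis_dirs_def)

lemma axis_root_unit:
  assumes "w * w \<in> axis_dirs"
  shows "norm w = 1"
proof -
  have "(norm w)\<^sup>2 = 1"
    using axis_dirs_simps(1)[OF assms] by (simp add: norm_mult power2_eq_square)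
  then show ?thesis using norm_ge_zero[of w] by (auto simp: power2_eq_1_iff)
qed

lemma Im_axis_pow4:
  assumes "w * w \<in> axis_dirs"
  obtains s where "s = 1 \<or> s = (-1::real)" "\<And>\<theta>. Im ((w * cis \<theta>)^4) = s * sin (4 * \<theta>)"
proof -
  have eq: "(w * cis \<theta>)^4 = (w * w) * (w * w) * cis (4 * \<theta>)" for \<theta>
    by (simp add: power_mult_distrib Complex.DeMoivre eval_nat_numeral(3))
      (simp add: power2_eq_square eval_nat_numeral mult_ac)
  obtain s :: real where s: "s = 1 \<or> s = -1" "(w * w) * (w * w) = of_real s"
    using axis_dirs_simps(3)[OF assms] by (metis of_real_1 of_real_minus)
  show thesis by (rule that[OF s(1)]) (simp only: eq s(2), simp)
qed

context weak_hill
begin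

text \<open>\<open>crit\<close> singles out the \<open>k\<close>-th minimum of the distance. In \<open>ec\<close> the final collision at \<open>T\<close> need not be the
  first one, so that uniqueness also applies to the pieces of an orbit with an intermediate collision.\<close>

definition crit :: "nat \<Rightarrow> real \<Rightarrow> complex \<Rightarrow> (real \<Rightarrow> complex) \<Rightarrow> (real \<Rightarrow> complex) \<Rightarrow> bool" where
  "crit k T b Z W \<longleftrightarrow> launch T b Z W \<and> \<bar>T - real k * pi\<bar> \<le> pi / 8 \<and> rho Z W T = 0"

definition ec :: "nat \<Rightarrow> real \<Rightarrow> complex \<Rightarrow> (real \<Rightarrow> complex) \<Rightarrow> (real \<Rightarrow> complex) \<Rightarrow> bool" where
  "ec k T b Z W \<longleftrightarrow> launch T b Z W \<and> \<bar>T - real k * pi\<bar> \<le> pi / 8 \<and> Z T = 0"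

lemma ec_crit: "ec k T b Z W \<Longrightarrow> crit k T b Z W" and ec_momF: "ec k T b Z W \<Longrightarrow> momF e Z W T = 0"
  by (auto simp: ec_def crit_def rho_def momF_def)

text \<open>At such a time \<open>cnj (Z T) * W T\<close> is purely imaginary of modulus e |Z|^4 /
  4. If \<open>Z T\<close> were not 0, the speed would be e |Z|^3 / 4, which is tiny, whereas near a
  multiple of pi it is close to 1.\<close>

lemma crit_ec:
  assumes c: "crit k T b Z W" and F: "momF e Z W T = 0"
  shows "ec k T b Z W"
proof -
  have l: "launch T b Z W" and win: "\<bar>T - real k * pi\<bar> \<le> pi / 8" and r: "Re (cnj (Z T) * W T) = 0"
    using c by (auto simp: crit_def rho_def)
  have T: "T \<in> {0..T}" using launchD[OF l] by simp
  have "Im (cnj (Z T) * W T) = - e * (norm (Z T))^4 / 4"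
    using F e_pos by (simp add: momF_def add_eq_0_iff)
  then have "cnj (Z T) * W T = Complex 0 (- e * (norm (Z T))^4 / 4)"
    using r by (simp add: complex_eq_iff)
  then have "norm (cnj (Z T) * W T) = e * (norm (Z T))^4 / 4"
    using e_pos by (simp add: cmod_def del: complex_cnj)
  then have eq: "norm (Z T) * norm (W T) = norm (Z T) * (e * (norm (Z T))^3 / 4)"
    by (simp add: norm_mult eval_nat_numeral)
  have "norm (W T) \<ge> 1/2"
  proof -
    have "norm (of_real (cos T) * b) \<ge> 9/10"
      using window_cos_abs[OF win] launch_unit[OF l] by (simp add: norm_mult)
    then show ?thesis
      using launch_close(2)[OF l T] norm_triangle_ineq2[of "of_real (cos T) * b" "W T"] kap_small(3)
      by (simp add: norm_minus_commute)
  qed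
  moreover have "(norm (Z T))^3 \<le> (3/2)^3" using launch_bounded[OF l T] by (intro power_mono) auto
  then have "e * (norm (Z T))^3 \<le> (1/10) * (3/2)^3"
    using eN_small(2) e_pos by (intro mult_mono) auto
  then have "e * (norm (Z T))^3 / 4 < 1/2" by (simp add: eval_nat_numeral)
  ultimately have "Z T = 0" using eq by auto
  then show ?thesis using l win by (simp add: ec_def)
qed

text \<open>Dividing the error of \<open>rho\<close> by a cosine of at least 9/10 turns
  \<open>4 * kap\<close> into \<open>5 * kap\<close>. The critical times of all directions thus lie
  in a tiny interval on which \<open>Z\<close> stays near the origin.\<close>

lemma rho_zero_near:
  assumes "crit k T b Z W"
  shows "\<bar>sin T\<bar> \<le> 5 * kap" "\<bar>T - real k * pi\<bar> \<le> 10 * kap"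
proof -
  have l: "launch T b Z W" and win: "\<bar>T - real k * pi\<bar> \<le> pi / 8" and r: "rho Z W T = 0"
    using assms by (auto simp: crit_def)
  have "\<bar>sin T\<bar> * \<bar>cos T\<bar> \<le> 4 * kap"
    using rho_close[OF l, of T] launchD(1)[OF l] r by (simp add: abs_mult)
  moreover have "\<bar>sin T\<bar> * (9/10) \<le> \<bar>sin T\<bar> * \<bar>cos T\<bar>"
    using window_cos_abs[OF win] by (intro mult_left_mono) auto
  ultimately show *: "\<bar>sin T\<bar> \<le> 5 * kap" using kap_small(1) by linarith
  have "\<bar>T - real k * pi\<bar> \<le> pi / 2" using win pi_gt_zero by linarith
  moreover have "\<bar>sin (T - real k * pi)\<bar> \<le> 5 * kap" using * by (simp add: sin_diff abs_mult)
  ultimately show "\<bar>T - real k * pi\<bar> \<le> 10 * kap"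
    using abs_le_of_sin_small[of "T - real k * pi" "5 * kap"] kap_small(3) by auto
qed

text \<open>The critical times differ, so \<open>momF\<close> is compared at two times. As
  \<open>rho\<close> changes by at most 8 times the distance of the directions and has slope at
  least 1/2, the times differ by at most 16 times that distance. The order of the times ensures that
  both solutions exist up to \<open>T1\<close>.\<close>

lemma crit_diff_ordered:
  assumes c1: "crit k T1 b1 Z1 W1" and c2: "crit k T2 b2 Z2 W2" and T: "T1 \<le> T2"
  shows "T2 - T1 \<le> 16 * norm (b1 - b2)"
    and "\<bar>(momF e Z1 W1 T1 - momF e Z2 W2 T2) - (Im (b1^4) - Im (b2^4)) / 4 * sin6 T1\<bar>
      \<le> norm (b1 - b2) / 1000"
proof -
  let ?d = "norm (b1 - b2)"
  have l1: "launch T1 b1 Z1 W1" and l2: "launch T2 b2 Z2 W2" and r: "rho Z1 W1 T1 = 0" "rho Z2 W2 T2 = 0"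
    and win: "\<bar>T1 - real k * pi\<bar> \<le> pi / 8" "\<bar>T2 - real k * pi\<bar> \<le> pi / 8"
    using c1 c2 by (auto simp: crit_def)
  have l2': "launch T1 b2 Z2 W2" using launch_restrict[OF l2 _ T] launchD[OF l1] by simp
  have T1: "T1 \<in> {0..T1}" using launchD[OF l1] by simp
  have "1/2 * (T2 - T1) \<le> (-1)^(2 * k) * rho Z2 W2 T2 - (-1)^(2 * k) * rho Z2 W2 T1"
  proof (rule rho_monotone[OF l2])
    have "real (2 * k) * (pi/2) = real k * pi" by simp
    then show "real (2 * k) * (pi/2) - pi/8 \<le> T1" "T2 \<le> real (2 * k) * (pi/2) + pi/8"
      using win unfolding abs_le_iff by linarith+
  qed (use T T1 in auto)
  moreover have "\<bar>rho Z1 W1 T1 - rho Z2 W2 T1\<bar> \<le> 8 * ?d"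
  proof -
    have "lip_pair ?d 8 (cnj (Z1 T1) * W1 T1) (cnj (Z2 T1) * W2 T1)"
      using lip_pair_mult[OF lip_pair_cnj launch_quad(2)[OF l1 l2' T1], of 2 "Z1 T1" "Z2 T1"]
        launch_quad(1)[OF l1 l2' T1] by (simp add: lip_quad_def)
    then show ?thesis
      using abs_Re_le_cmod[of "cnj (Z1 T1) * W1 T1 - cnj (Z2 T1) * W2 T1"]
      unfolding rho_def lip_pair_def minus_complex.sel by linarith
  qed
  ultimately show d: "T2 - T1 \<le> 16 * ?d" using r by simp
  \<comment> \<open>Passing from one critical time to the other is cheap: in between
    \<open>Z2\<close> is within \<open>11 * kap\<close> of the origin, so \<open>h6\<close> is
    negligible there.\<close>
  have "\<bar>momF e Z2 W2 T1 - momF e Z2 W2 T2\<bar> \<le> 11 * kap * (T2 - T1)"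
  proof (rule momF_lipschitz[OF l2 _ T order_refl])
    fix t assume t: "t \<in> {T1..T2}"
    have "\<bar>t - real k * pi\<bar> \<le> 10 * kap"
      using rho_zero_near(2)[OF c1] rho_zero_near(2)[OF c2] t by auto
    moreover have "\<bar>sin t\<bar> = \<bar>sin (t - real k * pi)\<bar>" by (simp add: sin_diff abs_mult)
    ultimately have "\<bar>sin t\<bar> \<le> 10 * kap" using abs_sin_x_le_abs_x[of "t - real k * pi"] by linarith
    then have "norm (of_real (sin t) * b2) \<le> 10 * kap" using launch_unit[OF l2] by (simp add: norm_mult)
    moreover have "t \<in> {0..T2}" using t T1 by auto
    ultimately have n: "norm (Z2 t) \<le> 11 * kap"
      using launch_close(1)[OF l2, of t] norm_triangle_sub[of "Z2 t" "of_real (sin t) * b2"] by linarith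
    then have "norm (Z2 t) \<le> 1" using kap_small(3) by simp
    then have "(norm (Z2 t))^5 \<le> 1" by (intro power_le_one) auto
    then have "norm (Z2 t) * (norm (Z2 t))^5 \<le> norm (Z2 t) * 1" by (intro mult_left_mono) auto
    then have "(norm (Z2 t))^6 \<le> norm (Z2 t)" by (simp add: eval_nat_numeral)
    then show "\<bar>h6 (Z2 t)\<bar> \<le> 11 * kap" using norm_h6[of "Z2 t"] n norm_ge_zero[of "Z2 t"] by linarith
  qed (use T1 in auto)
  also have "\<dots> \<le> 11 * kap * (16 * ?d)" using d kap_small(1) by (intro mult_left_mono) auto
  finally have 1: "\<bar>momF e Z2 W2 T1 - momF e Z2 W2 T2\<bar> \<le> 176 * (kap * ?d)" by simp
  have 2: "\<bar>(momF e Z1 W1 T1 - momF e Z2 W2 T1) - (Im (b1^4) - Im (b2^4)) / 4 * sin6 T1\<bar>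
      \<le> 16384 * (kap * N * ?d)"
    using momF_diff[OF l1 l2' T1] by (simp add: mult_ac)
  have "kap \<le> 1/10^7" using kap_small(3) by simp
  then have "kap * ?d \<le> 1/10^7 * ?d" "kap * N * ?d \<le> 32/10^9 * ?d"
    by (rule mult_right_mono, simp) (rule mult_right_mono[OF kap_small(2)], simp)
  then have "kap * ?d \<le> ?d / 10000000" "kap * N * ?d \<le> ?d / 31250000" by simp_all
  \<comment> \<open>16384/31250000 + 176/10000000 is about 0.00054.\<close>
  then have sm: "16384 * (kap * N * ?d) + 176 * (kap * ?d) \<le> ?d / 1000"
    using norm_ge_zero[of "b1 - b2"] by linarith
  have eq: "(momF e Z1 W1 T1 - momF e Z2 W2 T2) - (Im (b1^4) - Im (b2^4)) / 4 * sin6 T1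
      = ((momF e Z1 W1 T1 - momF e Z2 W2 T1) - (Im (b1^4) - Im (b2^4)) / 4 * sin6 T1)
        + (momF e Z2 W2 T1 - momF e Z2 W2 T2)" by simp
  show "\<bar>(momF e Z1 W1 T1 - momF e Z2 W2 T2) - (Im (b1^4) - Im (b2^4)) / 4 * sin6 T1\<bar>
      \<le> ?d / 1000"
    unfolding eq by (rule order_trans[OF order_trans[OF abs_triangle_ineq add_mono[OF 2 1]] sm])
qed

text \<open>The time \<open>t\<close> is the smaller of the two critical times; naming it by an
  existential removes the assumption on their order.\<close>

lemma crit_diff:
  assumes c1: "crit k T1 b1 Z1 W1" and c2: "crit k T2 b2 Z2 W2"
  shows "\<bar>T2 - T1\<bar> \<le> 16 * norm (b1 - b2)"
    and "\<exists>t \<in> {T1, T2}. \<bar>(momF e Z1 W1 T1 - momF e Z2 W2 T2) - (Im (b1^4) - Im (b2^4)) / 4 * sin6 t\<bar>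
      \<le> norm (b1 - b2) / 1000"
proof -
  have "\<bar>T2 - T1\<bar> \<le> 16 * norm (b1 - b2) \<and> (\<exists>t \<in> {T1, T2}.
      \<bar>(momF e Z1 W1 T1 - momF e Z2 W2 T2) - (Im (b1^4) - Im (b2^4)) / 4 * sin6 t\<bar> \<le> norm (b1 - b2) / 1000)"
  proof (cases "T1 \<le> T2")
    case True
    then show ?thesis using crit_diff_ordered[OF c1 c2] by auto
  next
    case False
    then have "T2 \<le> T1" by simp
    note * = crit_diff_ordered[OF c2 c1 this]
    have "(momF e Z1 W1 T1 - momF e Z2 W2 T2) - (Im (b1^4) - Im (b2^4)) / 4 * sin6 T2
        = - ((momF e Z2 W2 T2 - momF e Z1 W1 T1) - (Im (b2^4) - Im (b1^4)) / 4 * sin6 T2)"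
      by (simp add: field_simps)
    then have "\<bar>(momF e Z1 W1 T1 - momF e Z2 W2 T2) - (Im (b1^4) - Im (b2^4)) / 4 * sin6 T2\<bar>
        \<le> norm (b1 - b2) / 1000"
      using *(2) by (simp only: abs_minus_cancel norm_minus_commute)
    then show ?thesis using *(1) False by (intro conjI bexI[of _ T2]) (auto simp: norm_minus_commute)
  qed
  then show "\<bar>T2 - T1\<bar> \<le> 16 * norm (b1 - b2)"
    and "\<exists>t \<in> {T1, T2}. \<bar>(momF e Z1 W1 T1 - momF e Z2 W2 T2) - (Im (b1^4) - Im (b2^4)) / 4 * sin6 t\<bar>
      \<le> norm (b1 - b2) / 1000" by auto
qed

text \<open>Both values of \<open>momF\<close> vanish, so the sines of the fourfold angles differ by
  at most 32/1000 of the distance of the directions, while \<open>sin4_expanding\<close> demands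
  twice the difference of the angles. The range 1/5, wider than the 1/10 of
  \<open>ec_direction\<close>, admits the reversed orbit in \<open>ec_precession\<close>.\<close>

theorem ec_unique:
  assumes e1: "ec k T1 (w * cis \<theta>1) Z1 W1" and e2: "ec k T2 (w * cis \<theta>2) Z2 W2" and k: "1 \<le> k"
    and w: "w * w \<in> axis_dirs" and \<theta>: "\<bar>\<theta>1\<bar> \<le> 1/5" "\<bar>\<theta>2\<bar> \<le> 1/5"
  shows "\<theta>1 = \<theta>2" "T1 = T2" "\<And>t. t \<in> {0..T1} \<Longrightarrow> Z1 t = Z2 t"
proof -
  let ?d = "norm (w * cis \<theta>1 - w * cis \<theta>2)"
  have d: "?d \<le> \<bar>\<theta>1 - \<theta>2\<bar>"
    using norm_cis_diff_le[of \<theta>1 \<theta>2] axis_root_unit[OF w] by (simp add: norm_mult flip: right_diff_distrib)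
  obtain s where s: "s = 1 \<or> s = -1" "\<And>\<theta>. Im ((w * cis \<theta>)^4) = s * sin (4 * \<theta>)"
    using Im_axis_pow4[OF w] by metis
  obtain t where t: "t \<in> {T1, T2}"
    and *: "\<bar>(s * sin (4 * \<theta>1) - s * sin (4 * \<theta>2)) / 4 * sin6 t\<bar> \<le> ?d / 1000"
    using crit_diff(2)[OF ec_crit[OF e1] ec_crit[OF e2]] ec_momF[OF e1] ec_momF[OF e2]
    unfolding s(2) by auto
  have "1/8 \<le> sin6 t" using t window_ge(2)[OF k] e1 e2 by (auto simp: ec_def)
  then have "\<bar>sin (4 * \<theta>1) - sin (4 * \<theta>2)\<bar> / 4 * (1/8) \<le> \<bar>sin (4 * \<theta>1) - sin (4 * \<theta>2)\<bar> / 4 * sin6 t"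
    by (intro mult_left_mono) auto
  also have "\<dots> = \<bar>(s * sin (4 * \<theta>1) - s * sin (4 * \<theta>2)) / 4 * sin6 t\<bar>"
    using s(1) \<open>1/8 \<le> sin6 t\<close> by (auto simp: abs_mult abs_minus_commute)
  finally have "\<bar>sin (4 * \<theta>1) - sin (4 * \<theta>2)\<bar> / 4 * (1/8) \<le> ?d / 1000"
    using * by (rule order_trans)
  then have "\<bar>sin (4 * \<theta>1) - sin (4 * \<theta>2)\<bar> \<le> 32 * (?d / 1000)" by simp
  moreover have "y \<le> 0" if "S \<le> 32 * (x / 1000)" "2 * y \<le> S" "x \<le> y" for S x y :: real
    using that by linarith
  ultimately have "\<bar>\<theta>1 - \<theta>2\<bar> \<le> 0" using sin4_expanding[OF \<theta>] d by blast
  then show eq: "\<theta>1 = \<theta>2" by simp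
  then show TT: "T1 = T2" using crit_diff(1)[OF ec_crit[OF e1] ec_crit[OF e2]] by simp
  fix t assume "t \<in> {0..T1}"
  then show "Z1 t = Z2 t"
    using launch_diff(1)[of T1 _ Z1 W1 _ Z2 W2 t] e1 e2 eq TT by (fastforce simp: ec_def)
qed

text \<open>With \<open>momF\<close> equal to 0, \<open>momF_close\<close> and the lower bound 1/8
  for \<open>sin6\<close> give |Im (b^4)| \<le> 32 * 6/10^4 < 1/50.\<close>

lemma ec_direction:
  assumes e1: "ec k T b Z W" and k: "1 \<le> k"
  obtains w \<theta> where "b = w * cis \<theta>" "w * w \<in> axis_dirs" "\<bar>\<theta>\<bar> \<le> 1/10"
proof -
  have l: "launch T b Z W" and win: "\<bar>T - real k * pi\<bar> \<le> pi / 8" using e1 by (auto simp: ec_def)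
  have "\<bar>Im (b^4) / 4 * sin6 T\<bar> \<le> 6/10^4"
    using momF_close[OF l, of T] ec_momF[OF e1] launchD(1)[OF l] by simp
  moreover have "\<bar>Im (b^4)\<bar> / 4 * (1/8) \<le> \<bar>Im (b^4)\<bar> / 4 * sin6 T"
    by (rule mult_left_mono[OF window_ge(2)[OF k win]]) auto
  moreover have "\<bar>Im (b^4) / 4 * sin6 T\<bar> = \<bar>Im (b^4)\<bar> / 4 * sin6 T"
    using window_ge(2)[OF k win] by (simp add: abs_mult)
  ultimately have I: "\<bar>Im (b^4)\<bar> \<le> 1/50" by simp
  define \<phi> where "\<phi> = Arg b"
  have b: "b = cis \<phi>"
    using launch_unit[OF l] by (metis \<phi>_def cis_Arg norm_zero sgn_eq zero_neq_one div_by_1 of_real_1)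
  have sb: "\<bar>sin (4 * \<phi>)\<bar> \<le> 1/50" using I by (simp add: b Complex.DeMoivre)
  obtain j :: int where j: "\<bar>4 * \<phi> - of_int j * pi\<bar> \<le> pi / 2"
    "\<bar>sin (4 * \<phi> - of_int j * pi)\<bar> = \<bar>sin (4 * \<phi>)\<bar>"
    by (rule nearest_multiple_pi)
  define \<theta> where "\<theta> = (4 * \<phi> - of_int j * pi) / 4"
  \<comment> \<open>Squaring turns multiples of pi/4 into multiples of pi/2, so the half axis
    depends only on \<open>j mod 4\<close>.\<close>
  define w where "w = cis (of_int j * pi / 4)"
  have "4 * \<theta> = 4 * \<phi> - of_int j * pi" by (simp add: \<theta>_def)
  then have "\<bar>4 * \<theta>\<bar> \<le> 2 * (1/50)"
    using abs_le_of_sin_small[OF j(1), of "1/50"] j(2) sb by simp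
  then have "\<bar>\<theta>\<bar> \<le> 1/10" by simp
  moreover have "b = w * cis \<theta>" by (simp add: b w_def \<theta>_def cis_mult field_simps)
  moreover have "w * w \<in> axis_dirs"
  proof -
    have "of_int j * pi / 4 + of_int j * pi / 4 = of_int j * pi / 2" by simp
    then have ww: "w * w = cis (of_int j * pi / 2)" by (simp only: w_def cis_mult)
    have "j mod 4 \<in> {0, 1, 2, 3}" by auto
    moreover have jm: "of_int j * pi / 2 = 2 * pi * of_int (j div 4) + of_int (j mod 4) * pi / 2"
    proof -
      have "real_of_int j = 4 * of_int (j div 4) + of_int (j mod 4)"
        by (metis mult_div_mod_eq of_int_add of_int_mult of_int_numeral)
      then show ?thesis by (simp add: field_simps)
    qed
    have "w * w = cis (2 * pi * of_int (j div 4)) * cis (of_int (j mod 4) * pi / 2)"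
      unfolding ww cis_mult jm ..
    then have "w * w = cis (of_int (j mod 4) * pi / 2)"
      by (simp add: cis_multiple_2pi)
    moreover have "cis (3 * pi / 2) = - \<i>" 
      using sin_3over2_pi cos_3over2_pi by (simp add: complex_eq_iff)
    moreover have "cis (2 * pi / 2) = -1" "cis (pi / 2) = \<i>" by (simp_all add: complex_eq_iff)
    ultimately show ?thesis by (auto simp: axis_dirs_def)
  qed
  ultimately show thesis using that by blast
qed

lemma collision_time:
  assumes l: "launch T b Z W" and T: "0 < T" "Z T = 0"
  obtains k where "1 \<le> k" "ec k T b Z W"
proof -
  obtain j :: int where j: "\<bar>T - of_int j * pi\<bar> \<le> pi / 2" "\<bar>sin (T - of_int j * pi)\<bar> = \<bar>sin T\<bar>"
    by (rule nearest_multiple_pi)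
  have "\<bar>sin T\<bar> \<le> kap"
    using launch_close(1)[OF l, of T] T launch_unit[OF l] by (simp add: norm_mult)
  then have "\<bar>T - of_int j * pi\<bar> \<le> 2 * kap"
    using abs_le_of_sin_small[OF j(1), of kap] j(2) kap_small(3) by simp
  then have w: "\<bar>T - of_int j * pi\<bar> \<le> pi / 8" using kap_small(3) pi_gt3 by simp
  have "of_int j * pi > (-1) * pi" using w T pi_gt_zero unfolding abs_le_iff by linarith
  then have "of_int j > (-1 :: real)" using pi_gt_zero by (simp only: mult_less_cancel_right_pos)
  then have j0: "0 \<le> j" by linarith
  \<comment> \<open>After the ejection \<open>rho\<close> grows from 0 at rate at least 1/2
    throughout window 0, which excludes a return there.\<close>
  have "j \<noteq> 0"
  proof
    assume "j = 0"
    then have "1/2 * (T - 0) \<le> (-1)^0 * rho Z W T - (-1)^0 * rho Z W 0"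
      using T w by (intro rho_monotone[OF l]) auto
    then show False using T launchD(4)[OF l] by (simp add: rho_def)
  qed
  then show thesis using that[of "nat j"] j0 l w T by (auto simp: ec_def)
qed

section \<open>Symmetry, precession and absence of intermediate collisions\<close>

lemma ec_minus: "ec k T b Z W \<Longrightarrow> ec k T (- b) (\<lambda>t. - Z t) (\<lambda>t. - W t)"
  by (auto simp: ec_def launch_def hill_sol_minus)

lemma ec_reverse:
  assumes "ec k T b Z W" "c \<in> axis_dirs"
  shows "ec k T (- (c * cnj (W T))) (\<lambda>t. c * cnj (Z (T - t))) (\<lambda>t. - (c * cnj (W (T - t))))"
  using assms hill_sol_reverse[of e T Z W c] by (auto simp: ec_def launch_def axis_dirs_def)

text \<open>First-order expansion in \<open>e\<close>: on the harmonic solution the Coriolis term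
  drives the slow velocity by - \<i> e sin^2 cos^2 b, which integrates to \<open>sc2\<close>. The
  remainder is \<open>e\<close> times a multiple of \<open>kap * N\<close>.\<close>

lemma launch_slow_expansion:
  assumes l: "launch T b Z W"
  shows "norm (of_real (sin T) * Z T + of_real (cos T) * W T - b + \<i> * of_real (e * sc2 T) * b) \<le> e / 100"
proof -
  have u: "norm b = 1" by (rule launch_unit[OF l])
  have bb: "b * cnj b = 1" using u by (simp add: complex_norm_square[symmetric])
  note L = launchD[OF l]
  define f where "f = (\<lambda>t. of_real (sin t) * Z t + of_real (cos t) * W t + of_real (sc2 t) * (\<i> * of_real e * b))"
  have "norm (f T - f 0) \<le> e * (400 * kap) * \<bar>T - 0\<bar>"
  proof (rule vector_derivative_bound)
    fix t assume t: "t \<in> {0..T}"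
    have sc: "((\<lambda>t. of_real (sc2 t) * (\<i> * of_real e * b)) has_vector_derivative
        of_real ((sin t)^2 * (cos t)^2) * (\<i> * of_real e * b)) (at t within {0..T})"
      by (intro has_vector_derivative_mult_left has_vector_derivative_of_real sc2_deriv)
    show "(f has_vector_derivative of_real (e * cos t) * pert e (Z t) (W t)
        + of_real ((sin t)^2 * (cos t)^2) * (\<i> * of_real e * b)) (at t within {0..T})"
      unfolding f_def by (rule has_vector_derivative_add[OF hill_sol_slow_deriv(2)[OF L(3) t] sc])
    let ?z = "of_real (sin t) * b" and ?w = "of_real (cos t) * b"
    have zc: "lip_pair kap 2 (Z t) ?z" "lip_pair kap 2 (W t) ?w"
      using launch_close[OF l t] launch_bounded[OF l t] u kap_small(1)
        order_trans[OF abs_sin_le_one[of t], of 2] order_trans[OF abs_cos_le_one[of t], of 2]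
      unfolding lip_pair_def by (auto simp: norm_mult)
    have "lip_pair kap 32 ((Z t * cnj (Z t)) * W t) ((?z * cnj ?z) * ?w)"
      using lip_pair_mult[OF lip_pair_mult[OF zc(1) lip_pair_cnj[OF zc(1)]] zc(2)] kap_small(1) by simp
    then have 1: "norm ((Z t * cnj (Z t)) * W t - (?z * cnj ?z) * ?w) \<le> 32 * kap" by (simp add: lip_pair_def)
    have "lip_pair 0 2 (Z t) (Z t)" "lip_pair 0 2 (W t) (W t)"
      using launch_bounded[OF l t] by (auto simp: lip_pair_def)
    from pert_lip(2)[OF _ _ _ this, of e] have 2: "norm (pert e (Z t) (W t) + \<i> * ((Z t * cnj (Z t)) * W t)) \<le> 300 * e"
      using e_pos eN_small(2) by (auto simp: lip_pair_def)
    have zz: "(?z * cnj ?z) * ?w = of_real ((sin t)\<^sup>2 * cos t) * (b * (b * cnj b))"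
      by (simp add: power2_eq_square mult_ac)
    have eq: "of_real (e * cos t) * pert e (Z t) (W t) + of_real ((sin t)^2 * (cos t)^2) * (\<i> * of_real e * b)
        = of_real (e * cos t) * ((pert e (Z t) (W t) + \<i> * ((Z t * cnj (Z t)) * W t))
          - \<i> * ((Z t * cnj (Z t)) * W t - (?z * cnj ?z) * ?w))"
      unfolding zz bb by (simp add: algebra_simps power2_eq_square)
    have "norm (\<i> * ((Z t * cnj (Z t)) * W t - (?z * cnj ?z) * ?w)) \<le> 32 * kap"
      using 1 by (simp add: norm_mult)
    then have "norm ((pert e (Z t) (W t) + \<i> * ((Z t * cnj (Z t)) * W t))
          - \<i> * ((Z t * cnj (Z t)) * W t - (?z * cnj ?z) * ?w)) \<le> 300 * e + 32 * kap"
      using norm_triangle_ineq4 2 by (meson add_mono order_trans)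
    also have "\<dots> \<le> 400 * kap"
      using e_pos N_ge by (simp add: kap_def)
    finally show "norm (of_real (e * cos t) * pert e (Z t) (W t)
        + of_real ((sin t)^2 * (cos t)^2) * (\<i> * of_real e * b)) \<le> e * (400 * kap)"
      unfolding eq by (rule norm_trig_mult_le(2))
  qed (use L in auto)
  also have "\<dots> \<le> e * (400 * kap) * N" using L e_pos kap_small(1) by (intro mult_left_mono) auto
  also have "\<dots> = e * (400 * (kap * N))" by simp
  also have "\<dots> \<le> e * (1/100)" using kap_small(2) e_pos by (intro mult_left_mono) auto
  finally have "norm (f T - f 0) \<le> e / 100" by simp
  moreover have "sc2 0 = 0" by (simp add: sc2_def)
  then have "f T - f 0 = of_real (sin T) * Z T + of_real (cos T) * W T - b + \<i> * of_real (e * sc2 T) * b"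
    using L(5) by (simp add: f_def algebra_simps)
  ultimately show ?thesis by simp
qed

text \<open>The total turning equals \<open>- 2 * \<theta>\<close>, so the sign of the offset from
  the axis is visible at first order in \<open>e\<close>, although the axis itself is selected at
  second order.\<close>

theorem ec_precession:
  assumes ec: "ec k T (w * cis \<theta>) Z W" and k: "1 \<le> k" and w: "w * w \<in> axis_dirs" and \<theta>: "\<bar>\<theta>\<bar> \<le> 1/10"
  shows "0 < \<theta>" "\<exists>\<sigma>\<in>{1, -1}. W T = \<sigma> * (w * cis (- \<theta>))"
proof -
  define b where "b = w * cis \<theta>"
  have l: "launch T b Z W" and win: "\<bar>T - real k * pi\<bar> \<le> pi / 8" and ZT: "Z T = 0"
    using ec by (auto simp: ec_def b_def)
  have T: "T \<in> {0..T}" using launchD[OF l] by simp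
  have u: "norm b = 1" "norm w = 1" using launch_unit[OF l] axis_root_unit[OF w] by auto
  have uW: "norm (W T) = 1"
    using hill_solD(3)[OF launchD(3)[OF l] T] ZT norm_ge_zero[of "W T"] by (auto simp: power2_eq_1_iff)
  have cT: "9/10 \<le> \<bar>cos T\<bar>" by (rule window_cos_abs[OF win])
  \<comment> \<open>The sign with which the oscillator velocity returns at \<open>T\<close>; it
    makes \<open>\<sigma> * W T\<close> close to \<open>b\<close>.\<close>
  define \<sigma> where "\<sigma> = complex_of_real (sgn (cos T))"
  have \<sigma>: "\<sigma> \<in> {1, -1}" "\<sigma> * \<sigma> = 1" "of_real (cos T) = \<sigma> * of_real \<bar>cos T\<bar>" using cT by (auto simp: \<sigma>_def sgn_if)
  define b' where "b' = \<sigma> * W T"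
  have WT: "W T = \<sigma> * b'" using \<sigma>(2) by (simp add: b'_def flip: mult.assoc)
  have u': "norm b' = 1" using \<sigma>(1) uW by (auto simp: b'_def norm_mult)
  have "norm (b' - of_real \<bar>cos T\<bar> * b) \<le> kap"
  proof -
    have "b' - of_real \<bar>cos T\<bar> * b = \<sigma> * (W T - of_real (cos T) * b)"
      using \<sigma>(2) unfolding b'_def \<sigma>(3) by (simp add: algebra_simps)
    then show ?thesis using launch_close(2)[OF l T] \<sigma>(1) by (auto simp: norm_mult)
  qed
  note c1 = this
  then have c2: "\<bar>1 - \<bar>cos T\<bar>\<bar> \<le> kap"
    using norm_triangle_ineq3[of b' "of_real \<bar>cos T\<bar> * b"] u u' by (simp add: norm_mult)
  have nb: "norm (b' - b) \<le> 1/20"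
  proof -
    have "norm (of_real \<bar>cos T\<bar> * b - b) = \<bar>\<bar>cos T\<bar> - 1\<bar>"
      using u by (metis left_diff_distrib mult_1 mult_1_right norm_mult norm_of_real of_real_1 of_real_diff)
    then show ?thesis
      using norm_triangle_ineq[of "b' - of_real \<bar>cos T\<bar> * b" "of_real \<bar>cos T\<bar> * b - b"] c1 c2 kap_small(3)
      by simp
  qed
  have cb: "cnj b * b = 1" "cnj w * w = 1"
    using u by (metis complex_norm_square mult.commute of_real_1 power_one)+
  obtain \<phi> where \<phi>: "cnj b * b' = cis \<phi>" "\<bar>\<phi>\<bar> \<le> 1/10"
  proof (rule unit_near_one[of "cnj b * b'"])
    show "norm (cnj b * b') = 1" using u u' by (simp add: norm_mult)
    have "cnj b * b' - 1 = cnj b * (b' - b)" using cb by (simp add: algebra_simps)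
    then show "norm (cnj b * b' - 1) \<le> 1/20" using nb u by (simp add: norm_mult)
  qed
  have b': "b' = w * cis (\<theta> + \<phi>)"
  proof -
    have "b' = b * (cnj b * b')" using cb by (simp add: mult.commute[of b] flip: mult.assoc)
    then show ?thesis by (simp add: \<phi>(1)) (simp add: b_def cis_mult mult.assoc)
  qed
  \<comment> \<open>Among the reversing symmetries, the factor \<open>- \<sigma> * (w * w)\<close>
    is the one whose reversed orbit is again ejected near \<open>w\<close>, so that
    \<open>ec_unique\<close> can compare it with the given orbit.\<close>
  have "- (- \<sigma> * (w * w) * cnj (W T)) = w * cis (- \<theta> - \<phi>)"
  proof -
    have "cnj \<sigma> = \<sigma>" using \<sigma>(1) by auto
    then have "- (- \<sigma> * (w * w) * cnj (W T)) = (\<sigma> * \<sigma>) * (cnj w * w) * (w * cis (- (\<theta> + \<phi>)))"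
      by (simp add: WT b' cis_cnj mult_ac)
    then show ?thesis using \<sigma>(2) cb(2) by simp
  qed
  moreover have "- \<sigma> * (w * w) \<in> axis_dirs" using \<sigma>(1) w axis_dirs_simps(4)[OF w] by auto
  ultimately have rev: "ec k T (w * cis (- \<theta> - \<phi>)) (\<lambda>t. - \<sigma> * (w * w) * cnj (Z (T - t)))
      (\<lambda>t. - (- \<sigma> * (w * w) * cnj (W (T - t))))"
    using ec_reverse[OF ec, of "- \<sigma> * (w * w)"] by metis
  have "\<theta> = - \<theta> - \<phi>"
  proof (rule ec_unique(1)[OF ec rev k w])
    show "\<bar>\<theta>\<bar> \<le> 1/5" "\<bar>- \<theta> - \<phi>\<bar> \<le> 1/5" using \<theta> \<phi>(2) by linarith+
  qed
  then have ph: "\<phi> = - 2 * \<theta>" by simp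
  then have "b' = w * cis (- \<theta>)" using b' by simp
  then show "\<exists>\<sigma>\<in>{1, -1}. W T = \<sigma> * (w * cis (- \<theta>))" using WT \<sigma>(1) by blast
  have "sin \<phi> < 0"
  proof -
    let ?X = "of_real \<bar>cos T\<bar> * cis \<phi> - 1 + \<i> * of_real (e * sc2 T)"
    \<comment> \<open>With \<open>T\<close> at least 21/8, \<open>sc2 T\<close> is at least 13/64 >
      1/10; this exceeds the error 1/100 of the expansion and decides the sign.\<close>
    have 1: "e * (1/10) \<le> e * sc2 T"
      using sc2_ge[of T] window_ge(1)[OF k win] e_pos by (intro mult_left_mono) auto
    have "norm (cnj b * (of_real (cos T) * W T - b + \<i> * of_real (e * sc2 T) * b)) \<le> e / 100"
      using launch_slow_expansion[OF l] u ZT by (simp add: norm_mult)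
    moreover have "cnj b * (of_real (cos T) * W T - b + \<i> * of_real (e * sc2 T) * b) = ?X"
      using \<sigma>(2) cb unfolding \<phi>(1)[symmetric] WT \<sigma>(3) by algebra
    ultimately have "norm ?X \<le> e / 100" by (simp only:)
    moreover have "\<bar>cos T\<bar> * sin \<phi> + e * sc2 T = Im ?X" by simp
    ultimately have "\<bar>cos T\<bar> * sin \<phi> + e * sc2 T \<le> e / 100"
      using order_trans[OF abs_ge_self abs_Im_le_cmod, of ?X] by linarith
    then have "\<bar>cos T\<bar> * sin \<phi> < 0" using 1 e_pos by linarith
    then show ?thesis using cT by (auto simp: mult_less_0_iff)
  qed
  then have "0 < sin (2 * \<theta>)" by (simp add: ph)
  show "0 < \<theta>"
  proof (rule ccontr)
    assume "\<not> 0 < \<theta>"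
    then have "0 \<le> - (2 * \<theta>)" "- (2 * \<theta>) \<le> pi" using \<theta> pi_gt3 by linarith+
    then have "0 \<le> sin (- (2 * \<theta>))" by (rule sin_ge_zero)
    then show False using \<open>0 < sin (2 * \<theta>)\<close> by simp
  qed
qed

theorem ec_no_mid_collision:
  assumes ec: "ec k T b Z W" and t: "0 < t" "t < T"
  shows "Z t \<noteq> 0"
proof
  assume Zt: "Z t = 0"
  have l: "launch T b Z W" and ZT: "Z T = 0" using ec by (auto simp: ec_def)
  have "launch t b Z W" using launch_restrict[OF l] t by simp
  then obtain k1 where k1: "1 \<le> k1" "ec k1 t b Z W" using collision_time t Zt by blast
  then obtain w \<theta> where w: "b = w * cis \<theta>" "w * w \<in> axis_dirs" "\<bar>\<theta>\<bar> \<le> 1/10"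
    using ec_direction by metis
  note p = ec_precession[OF k1(2)[unfolded w(1)] k1(1) w(2,3)]
  obtain \<sigma> where \<sigma>: "\<sigma> \<in> {1, -1}" "W t = \<sigma> * (w * cis (- \<theta>))" using p(2) by blast
  have lt: "launch (T - t) (\<sigma> * (w * cis (- \<theta>))) (\<lambda>r. Z (t + r)) (\<lambda>r. W (t + r))"
    using hill_sol_shift[OF launchD(3)[OF l], of t] launchD[OF l] t Zt \<sigma>(2) by (auto simp: launch_def)
  obtain k2 where k2: "1 \<le> k2" "ec k2 (T - t) (\<sigma> * (w * cis (- \<theta>))) (\<lambda>r. Z (t + r)) (\<lambda>r. W (t + r))"
    by (rule collision_time[OF lt]) (use t ZT in auto)
  have "\<exists>Z' W'. ec k2 (T - t) (w * cis (- \<theta>)) Z' W'"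
  proof (cases "\<sigma> = 1")
    case True
    then show ?thesis using k2(2) by (intro exI) simp
  next
    case False
    then show ?thesis using ec_minus[OF k2(2)] \<sigma>(1) by (intro exI) simp
  qed
  then have "0 < - \<theta>" using ec_precession(1)[OF _ k2(1) w(2), of "T - t" "- \<theta>"] w(3) by auto
  then show False using p(1) by simp
qed

text \<open>Critical times and solutions are picked by choice, with no continuity built in.
  \<open>crit_diff\<close> shows that the value of \<open>momF\<close> at the critical time is
  nevertheless Lipschitz in the angle, so the intermediate value theorem applies.\<close>

theorem ec_exists:
  assumes w: "w * w \<in> axis_dirs" and k: "1 \<le> k" and N: "real k * pi + pi / 8 \<le> N"
  obtains \<theta> T Z W where "\<bar>\<theta>\<bar> \<le> 1/10" "ec k T (w * cis \<theta>) Z W"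
proof -
  have "\<exists>T Z W. crit k T (w * cis \<theta>) Z W" for \<theta>
  proof -
    have "norm (w * cis \<theta>) = 1" using axis_root_unit[OF w] by (simp add: norm_mult)
    then obtain Z W where l: "launch N (w * cis \<theta>) Z W" using launch_exists by metis
    obtain T where T: "\<bar>T - real (2 * k) * (pi/2)\<bar> \<le> pi/8" "rho Z W T = 0" "T < real (2 * k) * (pi/2) + pi/8"
      using rho_zero_exists[OF l, of "2 * k"] k N by auto
    have T': "\<bar>T - real k * pi\<bar> \<le> pi/8" using T(1) by simp
    then have "0 \<le> T" using window_ge(1)[OF k] by fastforce
    then have "crit k T (w * cis \<theta>) Z W"
      using launch_restrict[OF l, of T] N T T' by (simp add: crit_def)
    then show ?thesis by blast
  qed
  then obtain TT ZZ WW where c: "\<And>\<theta>. crit k (TT \<theta>) (w * cis \<theta>) (ZZ \<theta>) (WW \<theta>)" by metis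
  obtain s where s: "s = 1 \<or> s = (-1::real)" "\<And>\<theta>. Im ((w * cis \<theta>)^4) = s * sin (4 * \<theta>)"
    using Im_axis_pow4[OF w] by metis
  define \<Phi> where "\<Phi> = (\<lambda>\<theta>. s * momF e (ZZ \<theta>) (WW \<theta>) (TT \<theta>))"
  have T: "launch (TT \<theta>) (w * cis \<theta>) (ZZ \<theta>) (WW \<theta>)" "TT \<theta> \<in> {0..TT \<theta>}" "1/8 \<le> sin6 (TT \<theta>)" "sin6 (TT \<theta>) \<le> N" for \<theta>
  proof -
    show *: "launch (TT \<theta>) (w * cis \<theta>) (ZZ \<theta>) (WW \<theta>)" using c[of \<theta>] by (simp add: crit_def)
    show "TT \<theta> \<in> {0..TT \<theta>}" using launchD[OF *] by simp
    show "1/8 \<le> sin6 (TT \<theta>)" using c[of \<theta>] k window_ge(2) by (auto simp: crit_def)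
    show "sin6 (TT \<theta>) \<le> N" using sin6_bounds(2)[of "TT \<theta>"] launchD[OF *] N_ge by linarith
  qed
  have lip: "\<bar>\<Phi> x - \<Phi> y\<bar> \<le> (N + 1) * \<bar>x - y\<bar>" for x y
  proof -
    have d: "norm (w * cis x - w * cis y) \<le> \<bar>x - y\<bar>"
      using norm_cis_diff_le[of x y] axis_root_unit[OF w] by (simp add: norm_mult flip: right_diff_distrib)
    obtain t where t: "t \<in> {TT x, TT y}"
      and *: "\<bar>(momF e (ZZ x) (WW x) (TT x) - momF e (ZZ y) (WW y) (TT y))
         - (s * sin (4 * x) - s * sin (4 * y)) / 4 * sin6 t\<bar> \<le> norm (w * cis x - w * cis y) / 1000"
      using crit_diff(2)[OF c[of x] c[of y]] unfolding s(2) by blast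
    have "\<bar>sin (4 * x) - sin (4 * y)\<bar> \<le> \<bar>4 * x - 4 * y\<bar>"
      using norm_cis_diff_le[of "4 * x" "4 * y"] abs_Im_le_cmod[of "cis (4 * x) - cis (4 * y)"] by simp
    also have "\<bar>4 * x - 4 * y\<bar> = 4 * \<bar>x - y\<bar>"
      using abs_mult[of 4 "x - y"] by (simp only: right_diff_distrib abs_numeral)
    finally have "\<bar>sin (4 * x) - sin (4 * y)\<bar> / 4 \<le> \<bar>x - y\<bar>" by simp
    then have "\<bar>sin (4 * x) - sin (4 * y)\<bar> / 4 * sin6 t \<le> \<bar>x - y\<bar> * N"
      using t T(3,4)[of x] T(3,4)[of y] by (intro mult_mono) auto
    moreover have "\<bar>(s * sin (4 * x) - s * sin (4 * y)) / 4 * sin6 t\<bar> = \<bar>sin (4 * x) - sin (4 * y)\<bar> / 4 * sin6 t"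
      using s(1) t T(3)[of x] T(3)[of y] by (auto simp: abs_mult abs_minus_commute)
    moreover have "\<bar>\<Phi> x - \<Phi> y\<bar> = \<bar>momF e (ZZ x) (WW x) (TT x) - momF e (ZZ y) (WW y) (TT y)\<bar>"
      using s(1) by (auto simp: \<Phi>_def abs_minus_commute)
    ultimately have "\<bar>\<Phi> x - \<Phi> y\<bar> \<le> \<bar>x - y\<bar> * N + \<bar>x - y\<bar>" using * d by linarith
    then show ?thesis by (simp add: algebra_simps)
  qed
  have cont: "continuous_on {-1/10..1/10} \<Phi>"
    by (rule lipschitz_on_continuous_on[of "N + 1"], rule lipschitz_onI)
      (use lip N_ge in \<open>auto simp: dist_real_def\<close>)
  have val: "\<bar>\<Phi> x - sin (4 * x) / 4 * sin6 (TT x)\<bar> \<le> 6/10^4" for x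
  proof -
    have "\<Phi> x - sin (4 * x) / 4 * sin6 (TT x) = s * (momF e (ZZ x) (WW x) (TT x) - s * sin (4 * x) / 4 * sin6 (TT x))"
      using s(1) by (auto simp: \<Phi>_def)
    moreover have "\<bar>s\<bar> = 1" using s(1) by auto
    ultimately show ?thesis using momF_close[OF T(1,2), of x] unfolding s(2) by (simp only: abs_mult mult_1)
  qed
  have sg: "1/5 \<le> sin (4 * (1/10) :: real)"
  proof -
    have "0 \<le> sin (4 * (1/10) :: real)" using pi_gt3 by (intro sin_ge_zero) auto
    then show ?thesis using abs_sin_ge_half[of "4 * (1/10)"] by simp
  qed
  \<comment> \<open>At both ends the main term has modulus at least 1/160, more than ten times the
    error 6/10^4.\<close>
  have lb: "1/5 / 4 * (1/8) \<le> sin (4 * (1/10)) / 4 * sin6 (TT x)" for x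
    using sg T(3)[of x] by (intro mult_mono) auto
  have pos: "0 \<le> y" if "\<bar>y - x\<bar> \<le> 6/10^4" "1/5 / 4 * (1/8) \<le> x" for x y :: real
    using that unfolding abs_le_iff by simp
  have \<Phi>1: "0 \<le> \<Phi> (1/10)" by (rule pos[OF val lb])
  have "\<bar>- \<Phi> (-1/10) - sin (4 * (1/10)) / 4 * sin6 (TT (-1/10))\<bar> \<le> 6/10^4"
    using val[of "-1/10"] unfolding abs_le_iff by auto
  from pos[OF this lb] have "\<Phi> (-1/10) \<le> 0" by simp
  with \<Phi>1 obtain \<theta> where th: "-1/10 \<le> \<theta>" "\<theta> \<le> 1/10" "\<Phi> \<theta> = 0"
    using IVT'[of \<Phi> "-1/10" 0 "1/10"] cont by auto
  then have "ec k (TT \<theta>) (w * cis \<theta>) (ZZ \<theta>) (WW \<theta>)"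
    using crit_ec[OF c] s(1) by (auto simp: \<Phi>_def)
  then show thesis using that[of \<theta>] th by auto
qed

end

section \<open>Counting the maxima of the distance\<close>

definition maxset :: "real \<Rightarrow> (real \<Rightarrow> complex) \<Rightarrow> real set" where
  "maxset T Z = {t \<in> {0<..<T}. \<forall>\<^sub>F t' in at t. norm (Z t') \<le> norm (Z t)}"

lemma maxset_mono: "T \<le> T' \<Longrightarrow> maxset T Z \<subseteq> maxset T' Z"
  by (auto simp: maxset_def)

lemma eventually_at_scale:
  fixes c x :: real
  assumes c: "0 < c"
  shows "(\<forall>\<^sub>F s in at x. P (c * s)) \<longleftrightarrow> (\<forall>\<^sub>F t in at (c * x). P t)"
proof
  assume "\<forall>\<^sub>F s in at x. P (c * s)"
  then obtain d where d: "d > 0" "\<And>s. s \<noteq> x \<Longrightarrow> dist s x < d \<Longrightarrow> P (c * s)"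
    unfolding eventually_at by auto
  have "P t" if "t \<noteq> c * x" "dist t (c * x) < c * d" for t
  proof -
    have "t / c - x = (t - c * x) / c" using c by (simp add: field_simps)
    then have "dist (t / c) x < d" using that c by (simp add: dist_real_def abs_div pos_divide_less_eq mult.commute)
    then show ?thesis using d(2)[of "t / c"] that c by (auto simp: field_simps)
  qed
  then show "\<forall>\<^sub>F t in at (c * x). P t"
    unfolding eventually_at using d(1) c by (auto intro!: exI[of _ "c * d"])
next
  assume "\<forall>\<^sub>F t in at (c * x). P t"
  then obtain d where d: "d > 0" "\<And>t. t \<noteq> c * x \<Longrightarrow> dist t (c * x) < d \<Longrightarrow> P t"
    unfolding eventually_at by auto
  have "P (c * s)" if "s \<noteq> x" "dist s x < d / c" for s
  proof -
    have "c * s - c * x = c * (s - x)" by (simp add: algebra_simps)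
    then have "dist (c * s) (c * x) < d"
      using that c by (simp add: dist_real_def abs_mult pos_less_divide_eq mult.commute)
    then show ?thesis using d(2)[of "c * s"] that c by auto
  qed
  then show "\<forall>\<^sub>F s in at x. P (c * s)"
    unfolding eventually_at using d(1) c by (auto intro!: exI[of _ "d / c"])
qed

context weak_hill
begin

text \<open>An integrated second derivative test: up to the sign \<open>(-1)^m\<close>, the
  derivative \<open>2 * rho\<close> of the squared distance has slope at least 1 in the window. The
  quadratic gap makes the extremum strict.\<close>

lemma norm_extremum:
  assumes l: "launch T b Z W" and r: "rho Z W t = 0" and ts: "t \<in> {0..T}" "s \<in> {0..T}"
    and win: "\<bar>t - real m * (pi/2)\<bar> \<le> pi/8" "\<bar>s - real m * (pi/2)\<bar> \<le> pi/8"
  shows "(s - t)\<^sup>2 / 2 \<le> (-1)^m * (norm (Z s))\<^sup>2 - (-1)^m * (norm (Z t))\<^sup>2"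
proof -
  define g where "g = (\<lambda>s. (-1)^m * (norm (Z s))\<^sup>2 - (s - t)\<^sup>2 / 2)"
  have g': "(g has_real_derivative ((-1)^m * (2 * rho Z W x) - (x - t))) (at x within A)"
    if "x \<in> {0..T}" "A \<subseteq> {0..T}" for x A
    unfolding g_def
    by (rule DERIV_diff[OF DERIV_cmult[OF DERIV_subset[OF hill_sol_norm_deriv[OF launchD(3)[OF l] that(1)] that(2)]]])
      (auto intro!: derivative_eq_intros)
  have b: "real m * (pi/2) - pi/8 \<le> t" "t \<le> real m * (pi/2) + pi/8"
    "real m * (pi/2) - pi/8 \<le> s" "s \<le> real m * (pi/2) + pi/8"
    using win unfolding abs_le_iff by linarith+
  have "g t \<le> g s"
  proof (cases "t \<le> s")
    case True
    have "0 * (s - t) \<le> g s - g t"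
    proof (rule derivative_lower_bound[OF _ _ True])
      fix x assume x: "x \<in> {t..s}"
      show "(g has_real_derivative ((-1)^m * (2 * rho Z W x) - (x - t))) (at x within {t..s})"
        by (rule g') (use x ts in auto)
      have "1/2 * (x - t) \<le> (-1)^m * rho Z W x - (-1)^m * rho Z W t"
        by (rule rho_monotone[OF l]) (use x ts b in auto)
      then show "0 \<le> (-1)^m * (2 * rho Z W x) - (x - t)" using r by simp
    qed
    then show ?thesis by simp
  next
    case False
    then have st: "s \<le> t" by simp
    have "0 * (t - s) \<le> (- g t) - (- g s)"
    proof (rule derivative_lower_bound[OF _ _ st])
      fix x assume x: "x \<in> {s..t}"
      show "((\<lambda>x. - g x) has_real_derivative - ((-1)^m * (2 * rho Z W x) - (x - t))) (at x within {s..t})"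
        by (intro DERIV_minus g') (use x ts in auto)
      have "1/2 * (t - x) \<le> (-1)^m * rho Z W t - (-1)^m * rho Z W x"
        by (rule rho_monotone[OF l]) (use x ts b in auto)
      then show "0 \<le> - ((-1)^m * (2 * rho Z W x) - (x - t))" using r by simp
    qed
    then show ?thesis by simp
  qed
  then show ?thesis by (simp add: g_def)
qed

text \<open>The radius 1/10 instead of pi/8 keeps a neighbourhood of the zero inside the window,
  where \<open>norm_extremum\<close> can be used.\<close>

lemma rho_zero_window:
  assumes l: "launch T b Z W" and t: "t \<in> {0..T}" and r: "rho Z W t = 0"
  obtains m :: nat where "\<bar>t - real m * (pi/2)\<bar> \<le> 1/10"
proof -
  obtain j :: int where j: "\<bar>2 * t - of_int j * pi\<bar> \<le> pi / 2" "\<bar>sin (2 * t - of_int j * pi)\<bar> = \<bar>sin (2 * t)\<bar>"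
    by (rule nearest_multiple_pi)
  have "\<bar>sin (2 * t)\<bar> \<le> 1/100"
    using rho_close[OF l t] r kap_small(3) by (simp add: sin_double abs_mult)
  then have *: "\<bar>2 * t - of_int j * pi\<bar> \<le> 2 * (1/100)"
    using abs_le_of_sin_small[OF j(1), of "1/100"] j(2) by simp
  then have "- (2 * (1/100)) \<le> of_int j * pi" using t unfolding abs_le_iff atLeastAtMost_iff by linarith
  then have "(-1) * pi < of_int j * pi" using pi_gt3 by linarith
  then have "of_int j > (-1 :: real)" using pi_gt_zero by (simp only: mult_less_cancel_right_pos)
  then have "0 \<le> j" by linarith
  then have "real (nat j) * (pi/2) = of_int j * pi / 2" by simp
  then have "\<bar>t - real (nat j) * (pi/2)\<bar> \<le> 1/10" using * unfolding abs_le_iff by linarith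
  then show thesis by (rule that)
qed

lemma interior_max_iff:
  assumes l: "launch T b Z W" and t: "t \<in> {0<..<T}"
  shows "t \<in> maxset T Z \<longleftrightarrow> rho Z W t = 0 \<and> (\<exists>j. \<bar>t - real (2 * j + 1) * (pi/2)\<bar> \<le> pi/8)"
proof
  have t': "t \<in> {0..T}" using t by auto
  assume "t \<in> maxset T Z"
  then obtain d where d: "d > 0" "\<And>s. s \<noteq> t \<Longrightarrow> dist s t < d \<Longrightarrow> norm (Z s) \<le> norm (Z t)"
    by (auto simp: maxset_def eventually_at)
  then have dle: "(norm (Z s))\<^sup>2 \<le> (norm (Z t))\<^sup>2" if "\<bar>t - s\<bar> < d" for s
    using d(2)[of s] that by (cases "s = t") (auto simp: dist_real_def abs_minus_commute intro: power_mono)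
  have "at t within {0..T} = at t" by (rule at_within_interior) (use t in simp)
  then have "((\<lambda>t. (norm (Z t))\<^sup>2) has_real_derivative 2 * rho Z W t) (at t)"
    using hill_sol_norm_deriv[OF launchD(3)[OF l] t'] by simp
  then have "2 * rho Z W t = 0" by (rule DERIV_local_max[OF _ d(1)]) (use dle in auto)
  then have r: "rho Z W t = 0" by simp
  obtain m :: nat where m: "\<bar>t - real m * (pi/2)\<bar> \<le> 1/10" using rho_zero_window[OF l t' r] .
  have m8: "\<bar>t - real m * (pi/2)\<bar> \<le> pi/8" using m pi_gt3 by simp
  \<comment> \<open>In an even window the point would be a strict minimum; one nearby point to the
    right refutes this.\<close>
  have "odd m"
  proof
    assume e: "even m"
    define \<epsilon> where "\<epsilon> = min (d / 2) (min (T - t) (1/10))"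
    have \<epsilon>: "0 < \<epsilon>" "\<epsilon> < d" "\<epsilon> \<le> T - t" "\<epsilon> \<le> 1/10" 
      using d(1) t unfolding \<epsilon>_def min_le_iff_disj min_less_iff_disj min_less_iff_conj by auto
    have "(t + \<epsilon> - t)\<^sup>2 / 2 \<le> (-1)^m * (norm (Z (t + \<epsilon>)))\<^sup>2 - (-1)^m * (norm (Z t))\<^sup>2"
    proof (rule norm_extremum[OF l r t' _ m8])
      show "\<bar>t + \<epsilon> - real m * (pi/2)\<bar> \<le> pi/8" using m \<epsilon> pi_gt3 by linarith
    qed (use t \<epsilon> in auto)
    moreover have m1: "(-1::real)^m = 1" using e by simp
    moreover have "(norm (Z (t + \<epsilon>)))\<^sup>2 \<le> (norm (Z t))\<^sup>2" using \<epsilon> by (intro dle) simp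
    ultimately have "\<epsilon>\<^sup>2 / 2 \<le> 0" unfolding m1 add_diff_cancel_left' by linarith
    then show False using \<epsilon>(1) by simp
  qed
  then obtain j where "m = 2 * j + 1" using oddE by blast
  then show "rho Z W t = 0 \<and> (\<exists>j. \<bar>t - real (2 * j + 1) * (pi/2)\<bar> \<le> pi/8)" using r m8 by blast
next
  assume "rho Z W t = 0 \<and> (\<exists>j. \<bar>t - real (2 * j + 1) * (pi/2)\<bar> \<le> pi/8)"
  then obtain j where r: "rho Z W t = 0" and j: "\<bar>t - real (2 * j + 1) * (pi/2)\<bar> \<le> pi/8" by blast
  have t': "t \<in> {0..T}" using t by auto
  obtain m :: nat where m: "\<bar>t - real m * (pi/2)\<bar> \<le> 1/10" using rho_zero_window[OF l t' r] .
  have "m = 2 * j + 1"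
  proof -
    have "\<bar>real m * (pi/2) - real (2 * j + 1) * (pi/2)\<bar> < pi/2"
      using m j pi_gt3 by linarith
    moreover have "\<bar>real m * (pi/2) - real (2 * j + 1) * (pi/2)\<bar> = \<bar>real m - real (2 * j + 1)\<bar> * (pi/2)"
      by (simp only: left_diff_distrib[symmetric] abs_mult) simp
    ultimately have "\<bar>real m - real (2 * j + 1)\<bar> * (pi/2) < 1 * (pi/2)" by simp
    then have "\<bar>real m - real (2 * j + 1)\<bar> < 1" using pi_gt_zero by (simp only: mult_less_cancel_right_pos)
    then show ?thesis by linarith
  qed
  then have j': "\<bar>t - real (2 * j + 1) * (pi/2)\<bar> \<le> 1/10" using m by simp
  define \<epsilon> where "\<epsilon> = min t (min (T - t) (1/10))"
  have \<epsilon>: "0 < \<epsilon>" "\<epsilon> \<le> t" "\<epsilon> \<le> T - t" "\<epsilon> \<le> 1/10" 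
    using t unfolding \<epsilon>_def min_le_iff_disj min_less_iff_disj min_less_iff_conj by auto
  have "norm (Z s) \<le> norm (Z t)" if s: "dist s t < \<epsilon>" for s
  proof -
    have s': "\<bar>s - t\<bar> < \<epsilon>" using s by (simp add: dist_real_def)
    have "(s - t)\<^sup>2 / 2 \<le> (-1)^(2 * j + 1) * (norm (Z s))\<^sup>2 - (-1)^(2 * j + 1) * (norm (Z t))\<^sup>2"
    proof (rule norm_extremum[OF l r t' _ j])
      show "\<bar>s - real (2 * j + 1) * (pi/2)\<bar> \<le> pi/8" using j' s' \<epsilon>(4) pi_gt3 by linarith
      show "s \<in> {0..T}" using s' \<epsilon> by auto
    qed
    moreover have m1: "(-1::real)^(2 * j + 1) = -1" by simp
    ultimately have "(norm (Z s))\<^sup>2 \<le> (norm (Z t))\<^sup>2"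
      using zero_le_power2[of "s - t"] unfolding m1 by linarith
    then show ?thesis by (rule power2_le_imp_le) simp
  qed
  then show "t \<in> maxset T Z" using t \<epsilon>(1) by (auto simp: maxset_def eventually_at)
qed

lemma window_index_unique:
  fixes i j :: nat
  assumes "\<bar>t - real (2 * i + 1) * (pi/2)\<bar> \<le> pi/8" "\<bar>t - real (2 * j + 1) * (pi/2)\<bar> \<le> pi/8"
  shows "i = j"
proof -
  have "\<bar>real (2 * i + 1) * (pi/2) - real (2 * j + 1) * (pi/2)\<bar> < pi/2"
    using assms pi_gt_zero by linarith
  moreover have "\<bar>real (2 * i + 1) * (pi/2) - real (2 * j + 1) * (pi/2)\<bar> = \<bar>real (2 * i + 1) - real (2 * j + 1)\<bar> * (pi/2)"
    by (simp only: left_diff_distrib[symmetric] abs_mult) simp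
  ultimately have "\<bar>real (2 * i + 1) - real (2 * j + 1)\<bar> * (pi/2) < 1 * (pi/2)" by simp
  then have "\<bar>real (2 * i + 1) - real (2 * j + 1)\<bar> < 1" using pi_gt_zero by (simp only: mult_less_cancel_right_pos)
  then show ?thesis by linarith
qed

text \<open>The last of the \<open>n\<close> odd windows, centred at (2 n - 1) pi / 2, ends at n pi
  - 3 pi / 8, which explains the margin.\<close>

lemma window_maxima:
  assumes l: "launch T b Z W" and n: "real (2 * n) * (pi/2) - 3 * (pi/8) \<le> T"
  obtains f where "inj_on f {..<n}" "f ` {..<n} \<subseteq> maxset T Z"
    "\<And>j. j < n \<Longrightarrow> rho Z W (f j) = 0 \<and> \<bar>f j - real (2 * j + 1) * (pi/2)\<bar> \<le> pi/8"
proof -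
  have "\<exists>t. t \<in> {0<..<T} \<and> rho Z W t = 0 \<and> \<bar>t - real (2 * j + 1) * (pi/2)\<bar> \<le> pi/8" if j: "j < n" for j
  proof -
    have "real (2 * j + 1) * (pi/2) \<le> (real (2 * n) - 1) * (pi/2)"
      using j by (intro mult_right_mono) auto
    also have "\<dots> = real (2 * n) * (pi/2) - pi/2" by (simp add: algebra_simps)
    finally have T: "real (2 * j + 1) * (pi/2) + pi/8 \<le> T" using n by linarith
    then obtain t where t: "\<bar>t - real (2 * j + 1) * (pi/2)\<bar> \<le> pi/8" "rho Z W t = 0" "t < real (2 * j + 1) * (pi/2) + pi/8"
      using rho_zero_exists[OF l, of "2 * j + 1"] by auto
    have "1 * (pi/2) \<le> real (2 * j + 1) * (pi/2)" by (intro mult_right_mono) auto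
    then have "0 < t" using t(1) pi_gt_zero unfolding abs_le_iff by linarith
    then show ?thesis using t T by (intro exI[of _ t]) auto
  qed
  then obtain f where f: "\<And>j. j < n \<Longrightarrow> f j \<in> {0<..<T} \<and> rho Z W (f j) = 0 \<and> \<bar>f j - real (2 * j + 1) * (pi/2)\<bar> \<le> pi/8"
    by metis
  show thesis
  proof (rule that[of f])
    show "inj_on f {..<n}"
      using f window_index_unique by (auto simp: inj_on_def) (metis f window_index_unique)
    show "f ` {..<n} \<subseteq> maxset T Z" using interior_max_iff[OF l] f by blast
  qed (use f in blast)
qed

lemma maxset_card:
  assumes ec: "ec k T b Z W"
  shows "finite (maxset T Z)" "card (maxset T Z) = k"
proof -
  have l: "launch T b Z W" and win: "\<bar>T - real k * pi\<bar> \<le> pi/8" using ec by (auto simp: ec_def)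
  have kk: "real (2 * k) * (pi/2) = real k * pi" by simp
  have "real (2 * k) * (pi/2) - 3 * (pi/8) \<le> T" unfolding kk using win pi_gt_zero unfolding abs_le_iff by linarith
  then obtain f where f: "inj_on f {..<k}" "f ` {..<k} \<subseteq> maxset T Z"
    "\<And>j. j < k \<Longrightarrow> rho Z W (f j) = 0 \<and> \<bar>f j - real (2 * j + 1) * (pi/2)\<bar> \<le> pi/8"
    using window_maxima[OF l] by blast
  have "maxset T Z \<subseteq> f ` {..<k}"
  proof
    fix t assume t: "t \<in> maxset T Z"
    then have t0: "t \<in> {0<..<T}" by (simp add: maxset_def)
    obtain j where r: "rho Z W t = 0" and j: "\<bar>t - real (2 * j + 1) * (pi/2)\<bar> \<le> pi/8"
      using interior_max_iff[OF l t0] t by blast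
    have jk: "j < k"
    proof (rule ccontr)
      assume "\<not> j < k"
      then have "(real (2 * k) + 1) * (pi/2) \<le> real (2 * j + 1) * (pi/2)" by (intro mult_right_mono) auto
      moreover have "(real (2 * k) + 1) * (pi/2) = real k * pi + pi/2" by (simp add: algebra_simps)
      moreover have "t < T" using t0 by simp
      ultimately show False using j win pi_gt_zero unfolding abs_le_iff by linarith
    qed
    note fj = f(3)[OF jk]
    have fT: "f j \<in> {0<..<T}" using f(2) jk by (auto simp: maxset_def)
    have "t = f j"
    proof (rule ccontr)
      assume ne: "t \<noteq> f j"
      \<comment> \<open>Two critical points in one window would each have a strictly larger distance
        than the other; adding the two estimates gives the contradiction.\<close>
      have "(f j - t)\<^sup>2 / 2 \<le> (-1)^(2 * j + 1) * (norm (Z (f j)))\<^sup>2 - (-1)^(2 * j + 1) * (norm (Z t))\<^sup>2"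
        "(t - f j)\<^sup>2 / 2 \<le> (-1)^(2 * j + 1) * (norm (Z t))\<^sup>2 - (-1)^(2 * j + 1) * (norm (Z (f j)))\<^sup>2"
        by (rule norm_extremum[OF l]; use r fj j t0 fT in auto)+
      then have "(f j - t)\<^sup>2 + (t - f j)\<^sup>2 \<le> 0" by linarith
      moreover have "0 < (f j - t)\<^sup>2" "0 < (t - f j)\<^sup>2" using ne by auto
      ultimately show False by linarith
    qed
    then show "t \<in> f ` {..<k}" using jk by simp
  qed
  then have "maxset T Z = f ` {..<k}" using f(2) by blast
  then show "finite (maxset T Z)" "card (maxset T Z) = k" using card_image[OF f(1)] by auto
qed

text \<open>A solution lasting beyond \<open>N\<close> already has \<open>n + 1\<close> maxima by
  time \<open>N\<close>, which bounds the duration. Then \<open>collision_time\<close> provides some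
  index, and counting maxima identifies it with \<open>n\<close>.\<close>

lemma ec_iff_maxima:
  assumes n: "1 \<le> n" and N: "real (n + 1) * pi \<le> N"
    and h: "hill_sol e T Z W" "0 < T" "Z 0 = 0" "Z T = 0"
  shows "finite (maxset T Z) \<and> card (maxset T Z) = n \<longleftrightarrow> ec n T (W 0) Z W"
proof
  assume m: "finite (maxset T Z) \<and> card (maxset T Z) = n"
  have "T \<le> N"
  proof (rule ccontr)
    assume "\<not> T \<le> N"
    then have l: "launch N (W 0) Z W" using hill_sol_restrict[OF h(1)] h N_ge by (auto simp: launch_def)
    have "real (2 * Suc n) * (pi/2) = real (n + 1) * pi" by (simp add: field_simps)
    then have "real (2 * Suc n) * (pi/2) - 3 * (pi/8) \<le> N" using N pi_gt_zero by linarith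
    then obtain f where "inj_on f {..<Suc n}" "f ` {..<Suc n} \<subseteq> maxset N Z"
      using window_maxima[OF l] by blast
    moreover have "maxset N Z \<subseteq> maxset T Z" using \<open>\<not> T \<le> N\<close> by (intro maxset_mono) simp
    ultimately have "card {..<Suc n} \<le> card (maxset T Z)" using m by (intro card_inj_on_le[of f]) auto
    then show False using m by simp
  qed
  then have "launch T (W 0) Z W" using h by (simp add: launch_def)
  then obtain k where "ec k T (W 0) Z W" using collision_time h by blast
  then show "ec n T (W 0) Z W" using maxset_card m by metis
qed (use maxset_card in blast)

end

section \<open>Passage to the regularized Hill problem\<close>

lemma scaled_has_derivative:
  fixes f :: "real \<Rightarrow> real"
  assumes c: "0 < c" and x: "x \<in> {0..S}"
    and d: "\<And>y. y \<in> {0..c * S} \<Longrightarrow> (f has_real_derivative f' y) (at y within {0..c * S})"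
  shows "((\<lambda>x. k * f (c * x)) has_real_derivative k * (c * f' (c * x))) (at x within {0..S})"
proof -
  have sub: "(\<lambda>x. c * x) ` {0..S} \<subseteq> {0..c * S}" using c by auto
  have "((\<lambda>x. c * x) has_real_derivative c) (at x within {0..S})"
    by (auto intro!: derivative_eq_intros)
  moreover have "(f has_real_derivative f' (c * x)) (at (c * x) within (\<lambda>x. c * x) ` {0..S})"
    by (rule DERIV_subset[OF d sub]) (use x c in auto)
  ultimately have "((f \<circ> (\<lambda>x. c * x)) has_real_derivative f' (c * x) * c) (at x within {0..S})"
    by (intro DERIV_image_chain)
  then show ?thesis using DERIV_cmult[of _ "f' (c * x) * c" x "{0..S}" k] by (simp add: o_def mult.commute)
qed

lemma deriv_hill_W:
  "deriv (\<lambda>t. hill_W K t b) a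
    = 12 * a * (a^2 - b^2)^2 + 24 * a * (a^2 + b^2) * (a^2 - b^2) - 4 * K * a"
  "deriv (\<lambda>t. hill_W K a t) b
    = 12 * b * (a^2 - b^2)^2 - 24 * b * (a^2 + b^2) * (a^2 - b^2) - 4 * K * b"
proof -
  show "deriv (\<lambda>t. hill_W K t b) a
    = 12 * a * (a^2 - b^2)^2 + 24 * a * (a^2 + b^2) * (a^2 - b^2) - 4 * K * a"
    unfolding hill_W_def
    by (rule DERIV_imp_deriv) (auto intro!: derivative_eq_intros simp: power2_eq_square algebra_simps)
  show "deriv (\<lambda>t. hill_W K a t) b
    = 12 * b * (a^2 - b^2)^2 - 24 * b * (a^2 + b^2) * (a^2 - b^2) - 4 * K * b"
    unfolding hill_W_def
    by (rule DERIV_imp_deriv) (auto intro!: derivative_eq_intros simp: power2_eq_square algebra_simps)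
qed

text \<open>\<open>a\<close> scales length and \<omega> time. \<open>c2\<close> turns the linear
  part into a unit oscillator, \<open>c1\<close> makes \<open>e\<close> the strength of the Coriolis
  term, and \<open>c3\<close> normalizes the ejection speed to 1.\<close>

lemma hill_rescaling_identities:
  fixes a \<omega> e K :: real
  assumes c1: "8 * a^2 = e * \<omega>" and c2: "4 * K = \<omega>^2" and c3: "a^2 * \<omega>^2 = 8"
  shows "8 * ((a*x)^2 + (a*y)^2) * (a * \<omega> * q) + deriv (\<lambda>t. hill_W K t (a*y)) (a*x)
      = a * \<omega> * (\<omega> * (- x + e * Re (pert e (Complex x y) (Complex p q))))" (is ?u)
    and "- 8 * ((a*x)^2 + (a*y)^2) * (a * \<omega> * p) + deriv (\<lambda>t. hill_W K (a*x) t) (a*y)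
      = a * \<omega> * (\<omega> * (- y + e * Im (pert e (Complex x y) (Complex p q))))" (is ?v)
    and "(a * \<omega> * p)^2 + (a * \<omega> * q)^2 = 2 * hill_W K (a*x) (a*y) \<longleftrightarrow>
      (norm (Complex p q))\<^sup>2 + (norm (Complex x y))\<^sup>2
        = 1 + 3/16 * e\<^sup>2 * (norm (Complex x y))\<^sup>2 * (Re (Complex x y * Complex x y))\<^sup>2" (is ?e)
proof -
  have a4: "64 * a^4 = e^2 * \<omega>^2"
    using arg_cong[OF c1, of "\<lambda>x. x^2"] by (simp add: power_mult_distrib)
  show ?u unfolding deriv_hill_W Re_pert using c1 c2 a4 by algebra
  show ?v unfolding deriv_hill_W Im_pert using c1 c2 a4 by algebra
  have a6: "8 * a^6 = e^2"
  proof -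
    have "64 * a^6 = a^2 * (64 * a^4)" by (simp add: eval_nat_numeral)
    also have "\<dots> = e^2 * (a^2 * \<omega>^2)" unfolding a4 by (simp add: mult.left_commute)
    finally show ?thesis unfolding c3 by simp
  qed
  have l: "(a * \<omega> * p)^2 + (a * \<omega> * q)^2 = 8 * (p^2 + q^2)"
  proof -
    have "(a * \<omega> * p)^2 + (a * \<omega> * q)^2 = (a^2 * \<omega>^2) * (p^2 + q^2)" by algebra
    then show ?thesis unfolding c3 .
  qed
  have "K * a^2 = 2" using c2 c3 by algebra
  then have r: "2 * hill_W K (a*x) (a*y) = 8 * (1 + 3/16 * e\<^sup>2 * (x^2+y^2) * (x^2-y^2)^2 - (x^2+y^2))"
  proof -
    have "2 * hill_W K (a*x) (a*y) = 12 * a^6 * (x^2+y^2) * (x^2-y^2)^2 + 8 - 4 * (K * a^2) * (x^2+y^2)"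
      unfolding hill_W_def by algebra
    moreover have "a^6 = e^2 / 8" using a6 by simp
    ultimately show ?thesis unfolding \<open>K * a^2 = 2\<close> by (simp add: algebra_simps)
  qed
  have D: "Re (Complex x y * Complex x y) = x^2 - y^2" by (simp add: power2_eq_square)
  show ?e unfolding l r cmod_power2 D complex.sel
  proof -
    have "8 * A = 8 * (1 + B - C) \<longleftrightarrow> A + C = 1 + B" for A B C :: real by auto
    then show "8 * (p^2 + q^2) = 8 * (1 + 3/16 * e\<^sup>2 * (x^2+y^2) * (x^2-y^2)^2 - (x^2+y^2)) \<longleftrightarrow>
        p^2 + q^2 + (x^2 + y^2) = 1 + 3/16 * e\<^sup>2 * (x^2+y^2) * (x^2-y^2)\<^sup>2" by blast
  qed
qed

text \<open>Since \<open>x + \<i> y = 2/K Z\<^sup>2\<close> and \<open>\<bar>Z\<bar>\<close> has maximum about \<open>1\<close>, an orbit along the ray through \<open>c\<close> reaches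
  distance about \<open>2/K\<close> in this direction.\<close>

definition near :: "real \<Rightarrow> complex \<Rightarrow> real \<times> (real \<Rightarrow> real \<times> real) \<Rightarrow> bool" where
  "near K c \<eta> \<longleftrightarrow> (\<exists>p \<in> trace_of \<eta>. 1 / K < Re (cnj c * Complex (fst p) (snd p)))"

locale orbit_hill = weak_hill +
  fixes K :: real and n :: nat
  assumes K_pos: "0 < K" and e_eq: "e = 8 / (K * sqrt K)" and n_ge: "1 \<le> n"
    and N_large: "real (n + 1) * pi \<le> N"
begin

definition freq :: real where "freq = 2 * sqrt K"
definition amp :: real where "amp = sqrt (2 / K)"

lemma freq_amp: "0 < freq" "0 < amp" "amp\<^sup>2 = 2 / K"
  "8 * amp^2 = e * freq" "4 * K = freq^2" "amp^2 * freq^2 = 8"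
  using K_pos by (auto simp: freq_def amp_def e_eq power_mult_distrib field_simps)

lemma rescale_solution:
  assumes h: "hill_reg_solution K S u v"
  shows "\<exists>W. hill_sol e (freq * S) (\<lambda>t. Complex (1/amp * u (1/freq * t)) (1/amp * v (1/freq * t))) W"
proof -
  obtain u' v' where sol: "\<And>s. s \<in> {0..S} \<Longrightarrow>
      (u has_real_derivative u' s) (at s within {0..S}) \<and>
      (v has_real_derivative v' s) (at s within {0..S}) \<and>
      (u' has_real_derivative
         8 * ((u s)^2 + (v s)^2) * v' s + deriv (\<lambda>a. hill_W K a (v s)) (u s)) (at s within {0..S}) \<and>
      (v' has_real_derivative
         - 8 * ((u s)^2 + (v s)^2) * u' s + deriv (\<lambda>b. hill_W K (u s) b) (v s)) (at s within {0..S}) \<and>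
      (u' s)^2 + (v' s)^2 = 2 * hill_W K (u s) (v s)"
    using h unfolding hill_reg_solution_def by blast
  define Z where "Z = (\<lambda>t. Complex (1/amp * u (1/freq * t)) (1/amp * v (1/freq * t)))"
  define W where "W = (\<lambda>t. Complex (1/amp * (1/freq * u' (1/freq * t))) (1/amp * (1/freq * v' (1/freq * t))))"
  have c: "0 < 1/freq" "1/freq * (freq * S) = S" using freq_amp by auto
  have "hill_sol e (freq * S) Z W"
    unfolding hill_sol_def
  proof (intro ballI conjI)
    fix t assume t: "t \<in> {0..freq * S}"
    have s: "1/freq * t \<in> {0..S}" using t freq_amp by (auto simp: field_simps)
    define x y p q where "x = Re (Z t)" "y = Im (Z t)" "p = Re (W t)" "q = Im (W t)"
    note xy = this
    have uv: "u (1/freq * t) = amp * x" "v (1/freq * t) = amp * y"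
      "u' (1/freq * t) = amp * freq * p" "v' (1/freq * t) = amp * freq * q"
      using freq_amp by (simp_all add: xy Z_def W_def)
    have ZW: "Z t = Complex x y" "W t = Complex p q" by (simp_all add: xy)
    note scale = scaled_has_derivative[OF c(1) t, unfolded c(2)]
    have D: "((\<lambda>t. 1/amp * u (1/freq * t)) has_real_derivative 1/amp * (1/freq * u' (1/freq * t))) (at t within {0..freq * S})"
      "((\<lambda>t. 1/amp * v (1/freq * t)) has_real_derivative 1/amp * (1/freq * v' (1/freq * t))) (at t within {0..freq * S})"
      by (rule scale; use sol in blast)+
    then show "(Z has_vector_derivative W t) (at t within {0..freq * S})"
      by (simp add: has_vector_derivative_complex_iff Z_def W_def)
    have "((\<lambda>t. 1/amp * (1/freq) * u' (1/freq * t)) has_real_derivative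
        1/amp * (1/freq) * (1/freq * (8 * ((u (1/freq * t))^2 + (v (1/freq * t))^2) * v' (1/freq * t)
          + deriv (\<lambda>a. hill_W K a (v (1/freq * t))) (u (1/freq * t))))) (at t within {0..freq * S})"
      by (rule scale; use sol in blast)
    then have D1: "((\<lambda>t. Re (W t)) has_real_derivative - x + e * Re (pert e (Z t) (W t))) (at t within {0..freq * S})"
      unfolding uv hill_rescaling_identities(1)[OF freq_amp(4-6), where p = p] ZW[symmetric]
      using freq_amp(1,2) by (simp add: W_def)
    have "((\<lambda>t. 1/amp * (1/freq) * v' (1/freq * t)) has_real_derivative
        1/amp * (1/freq) * (1/freq * (- 8 * ((u (1/freq * t))^2 + (v (1/freq * t))^2) * u' (1/freq * t)
          + deriv (\<lambda>a. hill_W K (u (1/freq * t)) a) (v (1/freq * t))))) (at t within {0..freq * S})"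
      by (rule scale; use sol in blast)
    then have D2: "((\<lambda>t. Im (W t)) has_real_derivative - y + e * Im (pert e (Z t) (W t))) (at t within {0..freq * S})"
      unfolding uv hill_rescaling_identities(2)[OF freq_amp(4-6), where q = q] ZW[symmetric]
      using freq_amp(1,2) by (simp add: W_def)
    show "(W has_vector_derivative - Z t + of_real e * pert e (Z t) (W t)) (at t within {0..freq * S})"
      using D1 D2 by (simp add: has_vector_derivative_complex_iff xy)
    show "(norm (W t))\<^sup>2 + (norm (Z t))\<^sup>2 = 1 + 3/16 * e\<^sup>2 * (norm (Z t))\<^sup>2 * (Re (Z t * Z t))\<^sup>2"
      using sol[OF s] unfolding uv ZW hill_rescaling_identities(3)[OF freq_amp(4-6)] by blast
  qed
  then show ?thesis unfolding Z_def by blast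
qed

lemma unscale_solution:
  assumes h: "hill_sol e T Z W"
  shows "hill_reg_solution K (T / freq) (\<lambda>s. amp * Re (Z (freq * s))) (\<lambda>s. amp * Im (Z (freq * s)))"
  unfolding hill_reg_solution_def
proof (intro exI ballI)
  fix s assume s: "s \<in> {0..T / freq}"
  have c: "0 < freq" "freq * (T / freq) = T" using freq_amp by auto
  have t: "freq * s \<in> {0..T}" using s freq_amp by (auto simp: field_simps)
  define x y p q where "x = Re (Z (freq * s))" "y = Im (Z (freq * s))" "p = Re (W (freq * s))" "q = Im (W (freq * s))"
  note xy = this
  have ZW: "Z (freq * s) = Complex x y" "W (freq * s) = Complex p q" by (simp_all add: xy)
  note scale = scaled_has_derivative[OF c(1) s, unfolded c(2)]
  have D: "((\<lambda>s. amp * Re (Z (freq * s))) has_real_derivative amp * (freq * Re (W (freq * s)))) (at s within {0..T / freq})"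
    "((\<lambda>s. amp * Im (Z (freq * s))) has_real_derivative amp * (freq * Im (W (freq * s)))) (at s within {0..T / freq})"
    "((\<lambda>s. amp * freq * Re (W (freq * s))) has_real_derivative
      amp * freq * (freq * (- Re (Z (freq * s)) + e * Re (pert e (Z (freq * s)) (W (freq * s)))))) (at s within {0..T / freq})"
    "((\<lambda>s. amp * freq * Im (W (freq * s))) has_real_derivative
      amp * freq * (freq * (- Im (Z (freq * s)) + e * Im (pert e (Z (freq * s)) (W (freq * s)))))) (at s within {0..T / freq})"
    by (rule scale; rule hill_sol_components[OF h]; simp)+
  have id: "8 * ((amp * x)\<^sup>2 + (amp * y)\<^sup>2) * (amp * freq * q) + deriv (\<lambda>a. hill_W K a (amp * y)) (amp * x)
      = amp * freq * (freq * (- Re (Z (freq * s)) + e * Re (pert e (Z (freq * s)) (W (freq * s)))))"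
    "- 8 * ((amp * x)\<^sup>2 + (amp * y)\<^sup>2) * (amp * freq * p) + deriv (\<lambda>b. hill_W K (amp * x) b) (amp * y)
      = amp * freq * (freq * (- Im (Z (freq * s)) + e * Im (pert e (Z (freq * s)) (W (freq * s)))))"
    unfolding ZW complex.sel by (rule hill_rescaling_identities(1,2)[OF freq_amp(4-6)])+
  have en: "(amp * freq * p)\<^sup>2 + (amp * freq * q)\<^sup>2 = 2 * hill_W K (amp * x) (amp * y)"
    using hill_solD(3)[OF h t] unfolding ZW hill_rescaling_identities(3)[OF freq_amp(4-6)] .
  show "((\<lambda>s. amp * Re (Z (freq * s))) has_real_derivative amp * freq * Re (W (freq * s))) (at s within {0..T / freq}) \<and>
      ((\<lambda>s. amp * Im (Z (freq * s))) has_real_derivative amp * freq * Im (W (freq * s))) (at s within {0..T / freq}) \<and>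
      ((\<lambda>s. amp * freq * Re (W (freq * s))) has_real_derivative
         8 * ((amp * Re (Z (freq * s)))\<^sup>2 + (amp * Im (Z (freq * s)))\<^sup>2) * (amp * freq * Im (W (freq * s))) +
         deriv (\<lambda>a. hill_W K a (amp * Im (Z (freq * s)))) (amp * Re (Z (freq * s)))) (at s within {0..T / freq}) \<and>
      ((\<lambda>s. amp * freq * Im (W (freq * s))) has_real_derivative
         - 8 * ((amp * Re (Z (freq * s)))\<^sup>2 + (amp * Im (Z (freq * s)))\<^sup>2) * (amp * freq * Re (W (freq * s))) +
         deriv (\<lambda>b. hill_W K (amp * Re (Z (freq * s))) b) (amp * Im (Z (freq * s)))) (at s within {0..T / freq}) \<and>
      (amp * freq * Re (W (freq * s)))\<^sup>2 + (amp * freq * Im (W (freq * s)))\<^sup>2 =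
        2 * hill_W K (amp * Re (Z (freq * s))) (amp * Im (Z (freq * s)))"
    using D en unfolding xy[symmetric] id by (simp add: xy mult.assoc)
qed

section \<open>Projected orbits and their maxima\<close>

definition orb :: "real \<Rightarrow> (real \<Rightarrow> complex) \<Rightarrow> real \<times> (real \<Rightarrow> real \<times> real)" where
  "orb T Z = (T / freq,
    restrict (\<lambda>s. levi_civita (amp * Re (Z (freq * s))) (amp * Im (Z (freq * s)))) {0..T / freq})"

lemma levi_civita_amp:
  "levi_civita (amp * Re z) (amp * Im z) = (amp\<^sup>2 * Re (z * z), amp\<^sup>2 * Im (z * z))"
  by (simp add: levi_civita_def power2_eq_square algebra_simps)

lemma norm_levi_civita_amp: "norm (levi_civita (amp * Re z) (amp * Im z)) = amp\<^sup>2 * (norm z)\<^sup>2"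
proof -
  have "(norm (levi_civita (amp * Re z) (amp * Im z)))\<^sup>2 = (amp\<^sup>2)\<^sup>2 * ((Re (z * z))\<^sup>2 + (Im (z * z))\<^sup>2)"
  proof -
    have "(norm (A * x, A * y))\<^sup>2 = A\<^sup>2 * (x\<^sup>2 + y\<^sup>2)" for A x y :: real
      by (simp add: norm_Pair power_mult_distrib distrib_left)
    then show ?thesis unfolding levi_civita_amp .
  qed
  also have "(Re (z * z))\<^sup>2 + (Im (z * z))\<^sup>2 = ((norm z)\<^sup>2)\<^sup>2"
    by (metis cmod_power2 norm_mult power2_eq_square)
  finally have "(norm (levi_civita (amp * Re z) (amp * Im z)))\<^sup>2 = (amp\<^sup>2 * (norm z)\<^sup>2)\<^sup>2"
    by (simp add: power_mult_distrib)
  then show ?thesis by (simp add: power2_eq_iff_nonneg)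
qed

lemma orb_maxima:
  assumes T: "0 < T"
  shows "{s \<in> {0<..<fst (orb T Z)}. \<forall>\<^sub>F s' in at s. norm (snd (orb T Z) s') \<le> norm (snd (orb T Z) s)}
    = (\<lambda>t. t / freq) ` maxset T Z"
proof -
  have iff: "(\<forall>\<^sub>F s' in at s. norm (snd (orb T Z) s') \<le> norm (snd (orb T Z) s)) \<longleftrightarrow>
      (\<forall>\<^sub>F t in at (freq * s). norm (Z t) \<le> norm (Z (freq * s)))" if s: "s \<in> {0<..<T / freq}" for s
  proof -
    have val: "norm (snd (orb T Z) s) = amp\<^sup>2 * (norm (Z (freq * s)))\<^sup>2" if "s \<in> {0<..<T / freq}" for s
      using that by (simp add: orb_def norm_levi_civita_amp)
    have "\<forall>\<^sub>F s' in at s. s' \<in> {0<..<T / freq}"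
      using eventually_at_in_open'[OF open_greaterThanLessThan s] .
    then have "(\<forall>\<^sub>F s' in at s. norm (snd (orb T Z) s') \<le> norm (snd (orb T Z) s)) \<longleftrightarrow>
        (\<forall>\<^sub>F s' in at s. norm (Z (freq * s')) \<le> norm (Z (freq * s)))"
    proof (rule eventually_cong)
      fix s' assume "s' \<in> {0<..<T / freq}"
      then show "norm (snd (orb T Z) s') \<le> norm (snd (orb T Z) s) \<longleftrightarrow> norm (Z (freq * s')) \<le> norm (Z (freq * s))"
        using val s freq_amp(2) by (simp add: power2_le_iff_abs_le)
    qed
    then show ?thesis
      using eventually_at_scale[OF freq_amp(1), where P = "\<lambda>t. norm (Z t) \<le> norm (Z (freq * s))" and x = s] by simp
  qed
  have mem: "s \<in> (\<lambda>t. t / freq) ` A \<longleftrightarrow> freq * s \<in> A" for s A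
    using freq_amp(1) by (force simp: image_iff)
  have rng: "s \<in> {0<..<T / freq} \<longleftrightarrow> freq * s \<in> {0<..<T}" for s
    using freq_amp(1) by (auto simp: field_simps zero_less_mult_iff)
  have f: "fst (orb T Z) = T / freq" by (simp add: orb_def)
  show ?thesis
  proof (rule set_eqI)
    fix s
    show "s \<in> {s \<in> {0<..<fst (orb T Z)}. \<forall>\<^sub>F s' in at s. norm (snd (orb T Z) s') \<le> norm (snd (orb T Z) s)}
      \<longleftrightarrow> s \<in> (\<lambda>t. t / freq) ` maxset T Z"
      unfolding mem f maxset_def mem_Collect_eq using iff rng by blast
  qed
qed

lemma orb_maxima_card:
  assumes T: "0 < T"
  shows "(let M = {s \<in> {0<..<fst (orb T Z)}. \<forall>\<^sub>F s' in at s. norm (snd (orb T Z) s') \<le> norm (snd (orb T Z) s)}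
      in finite M \<and> card M = n) \<longleftrightarrow> finite (maxset T Z) \<and> card (maxset T Z) = n"
proof -
  have inj: "inj_on (\<lambda>t. t / freq) A" for A using freq_amp(1) by (auto simp: inj_on_def)
  show ?thesis unfolding orb_maxima[OF T] Let_def
    by (simp add: finite_image_iff[OF inj] card_image[OF inj])
qed

text \<open>The right side does not forbid intermediate collisions;
  \<open>ec_no_mid_collision\<close> supplies their absence in the inclusion from right to
  left.\<close>

theorem nEC_orbits_eq: "hill_nEC_orbits K n = {orb T Z |T b Z W. ec n T b Z W}"
proof (intro set_eqI iffI)
  fix \<eta> assume "\<eta> \<in> hill_nEC_orbits K n"
  moreover obtain S \<gamma> where \<eta>: "\<eta> = (S, \<gamma>)" by (cases \<eta>)
  ultimately obtain u v where S: "0 < S"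
    and sol: "hill_reg_solution K S u v"
    and ends: "(u 0, v 0) = (0, 0)" "(u S, v S) = (0, 0)"
    and \<gamma>: "\<gamma> = restrict (\<lambda>s. levi_civita (u s) (v s)) {0..S}"
    and M: "let M = {s \<in> {0<..<S}. \<forall>\<^sub>F s' in at s. norm (\<gamma> s') \<le> norm (\<gamma> s)} in finite M \<and> card M = n"
    unfolding hill_nEC_orbits_def mem_Collect_eq case_prod_conv by blast
  define Z where "Z = (\<lambda>t. Complex (1/amp * u (1/freq * t)) (1/amp * v (1/freq * t)))"
  define T where "T = freq * S"
  obtain W where h: "hill_sol e T Z W" using rescale_solution[OF sol] unfolding Z_def T_def by blast
  have T: "0 < T" using S freq_amp by (simp add: T_def)
  have o: "orb T Z = (S, \<gamma>)"
    using freq_amp(1,2) by (auto simp: orb_def T_def \<gamma> Z_def)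
  have "Z 0 = 0" "Z T = 0" using ends freq_amp(1) by (simp_all add: Z_def T_def complex_eq_iff)
  moreover have "finite (maxset T Z) \<and> card (maxset T Z) = n"
    using M orb_maxima_card[OF T, of Z] unfolding o by simp
  ultimately have "ec n T (W 0) Z W" using ec_iff_maxima[OF n_ge N_large h T] by blast
  then show "\<eta> \<in> {orb T Z |T b Z W. ec n T b Z W}" using o \<eta> by force
next
  fix \<eta> assume "\<eta> \<in> {orb T Z |T b Z W. ec n T b Z W}"
  then obtain T b Z W where \<eta>: "\<eta> = orb T Z" and ec: "ec n T b Z W" by blast
  have l: "launch T b Z W" and win: "\<bar>T - real n * pi\<bar> \<le> pi/8" and ZT: "Z T = 0" using ec by (auto simp: ec_def)
  note L = launchD[OF l]
  have T: "0 < T" using window_ge(1)[OF n_ge win] by simp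
  have "finite (maxset T Z) \<and> card (maxset T Z) = n" using maxset_card[OF ec] by simp
  then have M: "let M = {s \<in> {0<..<fst (orb T Z)}. \<forall>\<^sub>F s' in at s. norm (snd (orb T Z) s') \<le> norm (snd (orb T Z) s)}
      in finite M \<and> card M = n"
    using orb_maxima_card[OF T, of Z] by blast
  have mid: "(amp * Re (Z (freq * s)), amp * Im (Z (freq * s))) \<noteq> (0, 0)" if s: "s \<in> {0<..<T / freq}" for s
  proof -
    have "0 < freq * s" "freq * s < T" using s freq_amp(1) by (auto simp: field_simps)
    then have "Z (freq * s) \<noteq> 0" by (rule ec_no_mid_collision[OF ec])
    then show ?thesis using freq_amp(2) by (auto simp: complex_eq_iff)
  qed
  have "0 < T / freq" using T freq_amp(1) by simp
  moreover have "\<exists>u v. hill_reg_solution K (T / freq) u v \<and> (u 0, v 0) = (0, 0) \<and> (u (T / freq), v (T / freq)) = (0, 0) \<and>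
      (\<forall>s\<in>{0<..<T / freq}. (u s, v s) \<noteq> (0, 0)) \<and>
      snd (orb T Z) = restrict (\<lambda>s. levi_civita (u s) (v s)) {0..T / freq}"
    using unscale_solution[OF L(3)] mid L(4) ZT freq_amp(1)
    by (intro exI[of _ "\<lambda>s. amp * Re (Z (freq * s))"] exI[of _ "\<lambda>s. amp * Im (Z (freq * s))"])
      (auto simp: orb_def)
  ultimately have "(T / freq, snd (orb T Z)) \<in> hill_nEC_orbits K n"
    using M unfolding hill_nEC_orbits_def by (simp add: orb_def)
  then show "\<eta> \<in> hill_nEC_orbits K n" by (simp add: \<eta> orb_def)
qed

section \<open>Traces, directions and reflections of the orbits\<close>

lemma trace_orb:
  assumes "0 < T"
  shows "trace_of (orb T Z) = (\<lambda>t. (amp\<^sup>2 * Re (Z t * Z t), amp\<^sup>2 * Im (Z t * Z t))) ` {0..T}"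
proof -
  have "{0..T} = (\<lambda>s. freq * s) ` {0..T / freq}"
  proof (intro set_eqI iffI)
    fix t assume "t \<in> {0..T}"
    then have "t / freq \<in> {0..T / freq}" "t = freq * (t / freq)"
      using freq_amp(1) by (auto simp: divide_right_mono)
    then show "t \<in> (\<lambda>s. freq * s) ` {0..T / freq}" by blast
  qed (use freq_amp(1) in \<open>auto simp: field_simps\<close>)
  then show ?thesis by (auto simp: trace_of_def orb_def levi_civita_amp image_image)
qed

lemma near_orb_iff:
  assumes "0 < T"
  shows "near K c (orb T Z) \<longleftrightarrow> (\<exists>t\<in>{0..T}. 1/2 < Re (cnj c * (Z t * Z t)))"
proof -
  have eq: "Re (cnj c * Complex (amp\<^sup>2 * Re z) (amp\<^sup>2 * Im z)) = 2 / K * Re (cnj c * z)" for z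
    unfolding freq_amp(3)[symmetric] by (simp add: algebra_simps)
  have iff: "1 / K < 2 / K * r \<longleftrightarrow> 1/2 < r" for r using K_pos by (simp add: field_simps)
  show ?thesis by (simp only: near_def trace_orb[OF assms] bex_simps fst_conv snd_conv eq iff)
qed

text \<open>At time pi/2 the component of Z^2 along \<open>w * w\<close> is about cos (2 \<theta>)
  \<ge> 9/10. Along the other three half axes the harmonic part never exceeds |sin (2 \<theta>)|
  \<le> 1/5. With errors of 1/10, the threshold 1/2 separates the two cases.\<close>

lemma near_ec_iff:
  assumes ec: "ec n T (w * cis \<theta>) Z W" and w: "w * w \<in> axis_dirs" and \<theta>: "\<bar>\<theta>\<bar> \<le> 1/10" and c: "c \<in> axis_dirs"
  shows "near K c (orb T Z) \<longleftrightarrow> c = w * w"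
proof -
  define b where "b = w * cis \<theta>"
  have l: "launch T b Z W" and win: "\<bar>T - real n * pi\<bar> \<le> pi/8" using ec by (auto simp: ec_def b_def)
  have T: "0 < T" "pi/2 \<in> {0..T}" using window_ge(1)[OF n_ge win] pi_less_4 by auto
  have u: "norm b = 1" by (rule launch_unit[OF l])
  have bb: "b * b = w * w * cis (2 * \<theta>)" by (simp add: b_def cis_mult mult_ac)
  have err: "\<bar>Re (cnj c * (Z t * Z t)) - (sin t)\<^sup>2 * Re (cnj c * (w * w) * cis (2 * \<theta>))\<bar> \<le> 1/10"
    if t: "t \<in> {0..T}" for t
  proof -
    have "lip_pair kap 2 (Z t) (of_real (sin t) * b)"
      using launch_close(1)[OF l t] launch_bounded(1)[OF l t] u kap_small(1)
        order_trans[OF abs_sin_le_one[of t], of 2]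
      by (auto simp: lip_pair_def norm_mult)
    then have "norm (Z t * Z t - (of_real (sin t) * b) * (of_real (sin t) * b)) \<le> 8 * kap"
      using lip_pair_mult[of kap 2 "Z t" _ 2 "Z t"] kap_small(1) by (fastforce simp: lip_pair_def)
    then have "norm (cnj c * (Z t * Z t - (of_real (sin t) * b) * (of_real (sin t) * b))) \<le> 8 * kap"
      using axis_dirs_simps(1)[OF c] by (simp add: norm_mult)
    moreover have "cnj c * (Z t * Z t - (of_real (sin t) * b) * (of_real (sin t) * b))
        = cnj c * (Z t * Z t) - of_real ((sin t)\<^sup>2) * (cnj c * (b * b))"
      by (simp add: power2_eq_square algebra_simps)
    ultimately have A: "norm (cnj c * (Z t * Z t) - of_real ((sin t)\<^sup>2) * (cnj c * (b * b))) \<le> 8 * kap" by (simp only:)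
    have "8 * kap \<le> 1/10" using kap_small(3) by simp
    then have "\<bar>Re (cnj c * (Z t * Z t) - of_real ((sin t)\<^sup>2) * (cnj c * (b * b)))\<bar> \<le> 1/10"
      by (rule order_trans[OF order_trans[OF abs_Re_le_cmod A]])
    then show ?thesis unfolding bb by (simp add: mult.assoc)
  qed
  have s: "\<bar>sin (2 * \<theta>)\<bar> \<le> 1/5" using abs_sin_x_le_abs_x[of "2 * \<theta>"] \<theta> by simp
  have cs: "9/10 \<le> cos (2 * \<theta>)"
  proof -
    have "\<bar>sin \<theta>\<bar> \<le> 1/10" using abs_sin_x_le_abs_x[of \<theta>] \<theta> by linarith
    then have "\<bar>sin \<theta>\<bar>^2 \<le> (1/10)^2" by (rule power_mono) simp
    then show ?thesis by (simp add: cos_double_sin power2_eq_square)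
  qed
  show ?thesis
  proof
    assume cw: "c = w * w"
    have "cnj c * (w * w) = 1" using axis_dirs_simps(2)[OF c] by (simp add: cw mult.commute)
    then have "\<bar>Re (cnj c * (Z (pi/2) * Z (pi/2))) - cos (2 * \<theta>)\<bar> \<le> 1/10" using err[OF T(2)] by simp
    then have "1/2 < Re (cnj c * (Z (pi/2) * Z (pi/2)))" using cs unfolding abs_le_iff by linarith
    then show "near K c (orb T Z)" using T by (auto simp: near_orb_iff)
  next
    assume "near K c (orb T Z)"
    then obtain t where t: "t \<in> {0..T}" "1/2 < Re (cnj c * (Z t * Z t))" using T by (auto simp: near_orb_iff)
    then have 1: "2/5 < (sin t)\<^sup>2 * Re (cnj c * (w * w) * cis (2 * \<theta>))"
      using err[OF t(1)] unfolding abs_le_iff by linarith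
    show "c = w * w"
    proof (rule ccontr)
      assume "c \<noteq> w * w"
      then have "cnj c * (w * w) \<in> {-1, \<i>, -\<i>}"
        using c w unfolding axis_dirs_def by (auto simp: algebra_simps)
      moreover have "Re (q * cis (2 * \<theta>)) \<le> 1/5" if "q \<in> {-1, \<i>, -\<i>}" for q
        using that s cs by auto
      ultimately have "Re (cnj c * (w * w) * cis (2 * \<theta>)) \<le> 1/5" by blast
      then have "(sin t)\<^sup>2 * Re (cnj c * (w * w) * cis (2 * \<theta>)) \<le> (sin t)\<^sup>2 * (1/5)"
        by (intro mult_left_mono) auto
      also have "\<dots> \<le> 1 * (1/5)" by (intro mult_right_mono) (auto simp: abs_square_le_1)
      finally show False using 1 by simp
    qed
  qed
qed

lemma orbit_has_direction:
  assumes "\<eta> \<in> hill_nEC_orbits K n"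
  obtains c where "c \<in> axis_dirs" "\<And>c'. c' \<in> axis_dirs \<Longrightarrow> near K c' \<eta> \<longleftrightarrow> c' = c"
proof -
  obtain T b Z W where \<eta>: "\<eta> = orb T Z" and ec: "ec n T b Z W" using assms nEC_orbits_eq by blast
  obtain w \<theta> where w: "b = w * cis \<theta>" "w * w \<in> axis_dirs" "\<bar>\<theta>\<bar> \<le> 1/10" using ec_direction[OF ec n_ge] .
  show thesis using that[OF w(2)] near_ec_iff[OF ec[unfolded w(1)] w(2,3)] \<eta> by blast
qed

lemma orbit_near_exists:
  assumes "c \<in> axis_dirs"
  shows "\<exists>\<eta>\<in>hill_nEC_orbits K n. near K c \<eta>"
proof -
  have w: "csqrt c * csqrt c = c" by (metis power2_csqrt power2_eq_square)
  have "real (n + 1) * pi = real n * pi + pi" by (simp add: algebra_simps)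
  then have "real n * pi + pi / 8 \<le> N" using N_large pi_gt_zero by linarith
  then obtain \<theta> T Z W where "\<bar>\<theta>\<bar> \<le> 1/10" "ec n T (csqrt c * cis \<theta>) Z W"
    using ec_exists[of "csqrt c" n] n_ge assms w by metis
  then have "near K c (orb T Z)" "orb T Z \<in> hill_nEC_orbits K n"
    using near_ec_iff[of T "csqrt c" \<theta> Z W c] assms w nEC_orbits_eq by (simp, blast)
  then show ?thesis by blast
qed

lemma orb_minus: "orb T (\<lambda>t. - Z t) = orb T Z"
  by (simp add: orb_def levi_civita_def)

text \<open>The two square roots of \<open>c\<close> parametrize the same projected orbits, so every
  representation can be moved to directions near \<open>csqrt c\<close>, where
  \<open>ec_unique\<close> applies.\<close>

lemma orbit_near_unique:
  assumes "\<eta>1 \<in> hill_nEC_orbits K n" "\<eta>2 \<in> hill_nEC_orbits K n" and c: "c \<in> axis_dirs"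
    and near: "near K c \<eta>1" "near K c \<eta>2"
  shows "\<eta>1 = \<eta>2"
proof -
  have rep: "\<exists>T \<theta> Z W. \<eta> = orb T Z \<and> ec n T (csqrt c * cis \<theta>) Z W \<and> \<bar>\<theta>\<bar> \<le> 1/10"
    if \<eta>: "\<eta> \<in> hill_nEC_orbits K n" "near K c \<eta>" for \<eta>
  proof -
    obtain T b Z W where o: "\<eta> = orb T Z" and ec: "ec n T b Z W" using \<eta> nEC_orbits_eq by blast
    obtain w \<theta> where w: "b = w * cis \<theta>" "w * w \<in> axis_dirs" "\<bar>\<theta>\<bar> \<le> 1/10" using ec_direction[OF ec n_ge] .
    have "w * w = csqrt c * csqrt c"
      using near_ec_iff[OF ec[unfolded w(1)] w(2,3) c] \<eta>(2) o by (metis power2_csqrt power2_eq_square)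
    then have "w = csqrt c \<or> w = - csqrt c" by (simp add: square_eq_iff)
    then show ?thesis
    proof
      assume "w = csqrt c"
      then show ?thesis using o ec w by blast
    next
      assume "w = - csqrt c"
      then have "ec n T (csqrt c * cis \<theta>) (\<lambda>t. - Z t) (\<lambda>t. - W t)" using ec_minus[OF ec] w(1) by simp
      moreover have "\<eta> = orb T (\<lambda>t. - Z t)" using o orb_minus by simp
      ultimately show ?thesis using w(3) by blast
    qed
  qed
  obtain T1 \<theta>1 Z1 W1 where 1: "\<eta>1 = orb T1 Z1" "ec n T1 (csqrt c * cis \<theta>1) Z1 W1" "\<bar>\<theta>1\<bar> \<le> 1/10"
    using rep assms by blast
  obtain T2 \<theta>2 Z2 W2 where 2: "\<eta>2 = orb T2 Z2" "ec n T2 (csqrt c * cis \<theta>2) Z2 W2" "\<bar>\<theta>2\<bar> \<le> 1/10"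
    using rep assms by blast
  have w: "csqrt c * csqrt c \<in> axis_dirs" using c by (metis power2_csqrt power2_eq_square)
  have b: "\<bar>\<theta>1\<bar> \<le> 1/5" "\<bar>\<theta>2\<bar> \<le> 1/5" using 1(3) 2(3) by auto
  note U = ec_unique[OF 1(2) 2(2) n_ge w b]
  have "orb T1 Z1 = orb T1 Z2"
    unfolding orb_def
  proof (intro arg_cong2[where f = Pair] refl restrict_ext)
    fix s assume "s \<in> {0..T1 / freq}"
    then have "freq * s \<in> {0..T1}" using freq_amp(1) by (auto simp: field_simps)
    then show "levi_civita (amp * Re (Z1 (freq * s))) (amp * Im (Z1 (freq * s)))
      = levi_civita (amp * Re (Z2 (freq * s))) (amp * Im (Z2 (freq * s)))" using U(3) by simp
  qed
  then show ?thesis using 1(1) 2(1) U(2) by simp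
qed

text \<open>A trace forgets the direction of time, so the reversing symmetries act on traces as
  plain reflections.\<close>

lemma orbit_reflection:
  assumes "\<eta> \<in> hill_nEC_orbits K n" and d: "d \<in> {1, \<i>}"
  shows "\<exists>\<eta>'\<in>hill_nEC_orbits K n. trace_of \<eta>' = (if d = 1 then reflect_x_axis else reflect_y_axis) ` trace_of \<eta>"
proof -
  obtain T b Z W where \<eta>: "\<eta> = orb T Z" and ec: "ec n T b Z W" using assms nEC_orbits_eq by blast
  have T: "0 < T" using ec window_ge(1)[OF n_ge] by (force simp: ec_def)
  have "d \<in> axis_dirs" using d by (auto simp: axis_dirs_def)
  from ec_reverse[OF ec this] have o: "orb T (\<lambda>t. d * cnj (Z (T - t))) \<in> hill_nEC_orbits K n"
    using nEC_orbits_eq by blast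
  define g where "g = (\<lambda>t. (amp\<^sup>2 * Re (Z t * Z t), amp\<^sup>2 * Im (Z t * Z t)))"
  define r where "r = (if d = 1 then reflect_x_axis else reflect_y_axis)"
  have "(amp\<^sup>2 * Re ((d * cnj z) * (d * cnj z)), amp\<^sup>2 * Im ((d * cnj z) * (d * cnj z)))
      = r (amp\<^sup>2 * Re (z * z), amp\<^sup>2 * Im (z * z))" for z
    using d by (auto simp: r_def reflect_x_axis_def reflect_y_axis_def algebra_simps complex_eq_iff)
  then have "trace_of (orb T (\<lambda>t. d * cnj (Z (T - t)))) = (\<lambda>t. r (g (T - t))) ` {0..T}"
    unfolding trace_orb[OF T] g_def by simp
  also have "\<dots> = (\<lambda>t. r (g t)) ` ((\<lambda>t. T - t) ` {0..T})" by (simp only: image_image)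
  also have "(\<lambda>t. T - t) ` {0..T} = {0..T}" by (simp add: image_diff_atLeastAtMost)
  also have "(\<lambda>t. r (g t)) ` {0..T} = r ` trace_of \<eta>"
    unfolding \<eta> trace_orb[OF T] g_def by (simp add: image_image)
  finally show ?thesis using o unfolding r_def by blast
qed

lemma near_reflect:
  "trace_of \<eta>' = reflect_x_axis ` trace_of \<eta> \<Longrightarrow> near K c \<eta>' \<longleftrightarrow> near K (cnj c) \<eta>"
  "trace_of \<eta>' = reflect_y_axis ` trace_of \<eta> \<Longrightarrow> near K c \<eta>' \<longleftrightarrow> near K (- cnj c) \<eta>"
  by (simp_all add: near_def reflect_x_axis_def reflect_y_axis_def algebra_simps)

definition axis_orbit :: "complex \<Rightarrow> real \<times> (real \<Rightarrow> real \<times> real)" where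
  "axis_orbit c = (SOME \<eta>. \<eta> \<in> hill_nEC_orbits K n \<and> near K c \<eta>)"

lemma axis_orbit:
  assumes "c \<in> axis_dirs"
  shows "axis_orbit c \<in> hill_nEC_orbits K n" "near K c (axis_orbit c)"
  using someI_ex[of "\<lambda>\<eta>. \<eta> \<in> hill_nEC_orbits K n \<and> near K c \<eta>"] orbit_near_exists[OF assms]
  unfolding axis_orbit_def by blast+

lemma axis_orbit_near:
  assumes "c \<in> axis_dirs" "c' \<in> axis_dirs" "near K c' (axis_orbit c)"
  shows "c' = c"
  using orbit_has_direction[OF axis_orbit(1)[OF assms(1)]] axis_orbit(2)[OF assms(1)] assms by metis

lemma orbits_eq_axis_orbits: "hill_nEC_orbits K n = axis_orbit ` axis_dirs"
proof
  show "axis_orbit ` axis_dirs \<subseteq> hill_nEC_orbits K n" using axis_orbit(1) by blast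
  show "hill_nEC_orbits K n \<subseteq> axis_orbit ` axis_dirs"
  proof
    fix \<eta> assume \<eta>: "\<eta> \<in> hill_nEC_orbits K n"
    then obtain c where c: "c \<in> axis_dirs" "near K c \<eta>" using orbit_has_direction by metis
    then have "\<eta> = axis_orbit c" using orbit_near_unique[OF \<eta> axis_orbit(1)] axis_orbit(2) by blast
    then show "\<eta> \<in> axis_orbit ` axis_dirs" using c by blast
  qed
qed

lemma trace_axis_orbit_inj:
  assumes "c \<in> axis_dirs" "c' \<in> axis_dirs" "trace_of (axis_orbit c) = trace_of (axis_orbit c')"
  shows "c = c'"
proof -
  have "near K c (axis_orbit c')" using axis_orbit(2)[OF assms(1)] assms(3) by (simp add: near_def)
  then show ?thesis using axis_orbit_near assms by blast
qed

text \<open>Conjugation fixes 1 and -1 and swaps \<i> and -\<i>; its negative does the opposite. The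
  two kinds of symmetric orbits are the fixed points of these maps.\<close>

lemma reflect_axis_orbit:
  assumes c: "c \<in> axis_dirs"
  shows "reflect_x_axis ` trace_of (axis_orbit c) = trace_of (axis_orbit (cnj c))"
    and "reflect_y_axis ` trace_of (axis_orbit c) = trace_of (axis_orbit (- cnj c))"
proof -
  have d: "cnj c \<in> axis_dirs" "- cnj c \<in> axis_dirs" using c by (auto simp: axis_dirs_def)
  obtain \<eta> where \<eta>: "\<eta> \<in> hill_nEC_orbits K n" "trace_of \<eta> = reflect_x_axis ` trace_of (axis_orbit c)"
    using orbit_reflection[OF axis_orbit(1)[OF c], of 1] by auto
  have "near K (cnj c) \<eta>" using near_reflect(1)[OF \<eta>(2), of "cnj c"] axis_orbit(2)[OF c] by simp
  then show "reflect_x_axis ` trace_of (axis_orbit c) = trace_of (axis_orbit (cnj c))"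
    using orbit_near_unique[OF \<eta>(1) axis_orbit(1) d(1) _ axis_orbit(2)] d \<eta>(2) by metis
  obtain \<eta> where \<eta>: "\<eta> \<in> hill_nEC_orbits K n" "trace_of \<eta> = reflect_y_axis ` trace_of (axis_orbit c)"
    using orbit_reflection[OF axis_orbit(1)[OF c], of \<i>] by auto
  have "near K (- cnj c) \<eta>" using near_reflect(2)[OF \<eta>(2), of "- cnj c"] axis_orbit(2)[OF c] by simp
  then show "reflect_y_axis ` trace_of (axis_orbit c) = trace_of (axis_orbit (- cnj c))"
    using orbit_near_unique[OF \<eta>(1) axis_orbit(1) d(2) _ axis_orbit(2)] d \<eta>(2) by metis
qed

end

text \<open>\<open>sqrt K\<close> is at least 1, hence \<open>e\<close> is at most 8 / K, which is
  where the bound on \<open>K\<close> comes from; the factor 4 in \<open>N\<close> is an upper bound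
  for pi.\<close>

lemma orbit_hill_large:
  assumes n: "1 \<le> n" and N: "N = 4 * real (n + 1)" and K: "8 * 10^10 * N\<^sup>2 \<le> K"
  shows "orbit_hill (8 / (K * sqrt K)) N K n"
proof -
  have "4 \<le> N" using N by simp
  then have "1 \<le> N\<^sup>2" by (intro one_le_power) simp
  then have K1: "1 \<le> K" using K by simp
  then have "1 \<le> sqrt K" by simp
  then have KK: "K * 1 \<le> K * sqrt K" using K1 by (intro mult_left_mono) auto
  show ?thesis
  proof
    show "0 < 8 / (K * sqrt K)" "0 < K" using K1 by auto
    have "8 * 10^10 * N\<^sup>2 \<le> K * sqrt K" using K KK by simp
    then show "10^10 * (8 / (K * sqrt K) * N\<^sup>2) \<le> 1" using K1 by (simp add: field_simps)
    show "real (n + 1) * pi \<le> N" unfolding N using pi_less_4 mult_left_mono[of pi 4 "real (n + 1)"] by simp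
  qed (use \<open>4 \<le> N\<close> n in auto)
qed

theorem corollary1:
  fixes n :: nat
  assumes "n \<ge> 1"
  shows "\<exists>K_hat > 0. \<exists>\<alpha> \<beta> \<gamma> \<delta>. \<forall>K \<ge> K_hat.
    hill_nEC_orbits K n = {\<alpha> K, \<beta> K, \<gamma> K, \<delta> K} \<and>
    distinct [trace_of (\<alpha> K), trace_of (\<beta> K), trace_of (\<gamma> K), trace_of (\<delta> K)] \<and>
    (reflect_x_axis ` trace_of (\<alpha> K) = trace_of (\<alpha> K) \<and>
     reflect_x_axis ` trace_of (\<gamma> K) = trace_of (\<gamma> K) \<and>
     reflect_y_axis ` trace_of (\<alpha> K) = trace_of (\<gamma> K)) \<and>
    (reflect_y_axis ` trace_of (\<beta> K) = trace_of (\<beta> K) \<and>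
     reflect_y_axis ` trace_of (\<delta> K) = trace_of (\<delta> K) \<and>
     reflect_x_axis ` trace_of (\<beta> K) = trace_of (\<delta> K))"
proof -
  define N where "N = 4 * real (n + 1)"
  \<comment> \<open>The families are indexed by the half axis along which the orbit extends:
    \<alpha>, \<beta>, \<gamma>, \<delta> belong to 1, \<i>, -1, -\<i>.\<close>
  define U where "U = (\<lambda>c K. orbit_hill.axis_orbit K n c)"
  have "hill_nEC_orbits K n = {U 1 K, U \<i> K, U (-1) K, U (-\<i>) K} \<and>
    distinct [trace_of (U 1 K), trace_of (U \<i> K), trace_of (U (-1) K), trace_of (U (-\<i>) K)] \<and>
    (reflect_x_axis ` trace_of (U 1 K) = trace_of (U 1 K) \<and>
     reflect_x_axis ` trace_of (U (-1) K) = trace_of (U (-1) K) \<and>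
     reflect_y_axis ` trace_of (U 1 K) = trace_of (U (-1) K)) \<and>
    (reflect_y_axis ` trace_of (U \<i> K) = trace_of (U \<i> K) \<and>
     reflect_y_axis ` trace_of (U (-\<i>) K) = trace_of (U (-\<i>) K) \<and>
     reflect_x_axis ` trace_of (U \<i> K) = trace_of (U (-\<i>) K))"
    if K: "8 * 10^10 * N\<^sup>2 \<le> K" for K
  proof -
    interpret orbit_hill "8 / (K * sqrt K)" N K n by (rule orbit_hill_large[OF assms N_def K])
    have d: "1 \<in> axis_dirs" "-1 \<in> axis_dirs" "\<i> \<in> axis_dirs" "-\<i> \<in> axis_dirs" by (auto simp: axis_dirs_def)
    have "hill_nEC_orbits K n = {U 1 K, U \<i> K, U (-1) K, U (-\<i>) K}"
      unfolding orbits_eq_axis_orbits axis_dirs_def U_def by auto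
    moreover have ne: "1 \<noteq> \<i>" "\<i> \<noteq> -1" "\<i> \<noteq> -\<i>" "1 \<noteq> -\<i>" "-1 \<noteq> -\<i>" "1 \<noteq> (-1 :: complex)"
      by (auto simp: complex_eq_iff)
    then have "distinct [trace_of (U 1 K), trace_of (U \<i> K), trace_of (U (-1) K), trace_of (U (-\<i>) K)]"
      using trace_axis_orbit_inj d unfolding U_def by (simp, metis)
    ultimately show ?thesis
      using reflect_axis_orbit[OF d(1)] reflect_axis_orbit[OF d(2)] reflect_axis_orbit[OF d(3)]
        reflect_axis_orbit[OF d(4)] unfolding U_def by simp
  qed
  moreover have "0 < 8 * 10^10 * N\<^sup>2" by (simp add: N_def)
  ultimately show ?thesis by blast
qed

end
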